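(* There is an algorithm that, given a word $u$ in the free group $F_2$, decides whether or not $u$ is potentially positive.
   Context: $F_2$ is the free group with basis $\{a,b\}$, with elements given as reduced words in $a^{\pm1},b^{\pm1}$. A word is positive if it has no negative exponents (no occurrence of $a^{-1}$ or $b^{-1}$). A word $u$ in $F_2$ is potentially positive if $\phi(u)$ is positive for some automorphism $\phi$ of $F_2$. *)

theory Defs
  imports "HOL-Algebra.Bij" "HOL-Library.Nat_Bijection"
begin

section \<open>The free group of rank two\<close>

datatype gen = Gen_a | Gen_b

text \<open>A letter is a basis element with the sign of its exponent: \<^term>\<open>(Gen_a, True)\<close> is $a$
  and \<^term>\<open>(Gen_a, False)\<close> is $a^{-1}$.\<close>

type_synonym letter = "gen \<times> bool"
type_synonym word = "letter list"

definition inv_letter :: "letter \<Rightarrow> letter" where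
  "inv_letter x = (fst x, \<not> snd x)"

definition reduced :: "word \<Rightarrow> bool" where
  "reduced w \<longleftrightarrow> successively (\<lambda>x y. y \<noteq> inv_letter x) w"

text \<open>Left multiplication of a reduced word by a single letter, with cancellation.\<close>

fun push :: "letter \<Rightarrow> word \<Rightarrow> word" where
  "push x [] = [x]"
| "push x (y # w) = (if y = inv_letter x then w else x # y # w)"

definition F2 :: "word monoid" where
  "F2 = \<lparr>carrier = {w. reduced w}, mult = foldr push, one = []\<rparr>"

lemma inv_letter_inv_letter [simp]: "inv_letter (inv_letter x) = x"
  by (simp add: inv_letter_def)

lemma inv_letter_neq [simp]: "inv_letter x \<noteq> x" "x \<noteq> inv_letter x"
  by (auto simp: inv_letter_def prod_eq_iff)

lemma reduced_Nil [simp]: "reduced []"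
  by (simp add: reduced_def)

lemma reduced_tl: "reduced (x # w) \<Longrightarrow> reduced w"
  by (cases w) (auto simp: reduced_def)

lemma reduced_push: "reduced w \<Longrightarrow> reduced (push x w)"
  by (cases w) (auto simp: reduced_def successively_Cons)

lemma reduced_foldr_push: "reduced v \<Longrightarrow> reduced (foldr push u v)"
  by (induction u) (auto intro: reduced_push)

lemma push_inv_letter: "reduced w \<Longrightarrow> push x (push (inv_letter x) w) = w"
proof (cases w)
  case (Cons y v)
  assume "reduced w"
  with Cons show ?thesis by (cases v) (auto simp: reduced_def)
qed simp

lemma foldr_push_push:
  "reduced w \<Longrightarrow> foldr push (push x v) w = push x (foldr push v w)"
  by (cases v) (auto simp: push_inv_letter reduced_foldr_push)

lemma foldr_push_assoc:
  "reduced w \<Longrightarrow> foldr push (foldr push u v) w = foldr push u (foldr push v w)"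
  by (induction u) (auto simp: foldr_push_push)

lemma foldr_push_Nil: "reduced w \<Longrightarrow> foldr push w [] = w"
proof (induction w)
  case (Cons x w)
  then have "foldr push w [] = w" by (simp add: reduced_tl)
  with Cons.prems show ?case by (cases w) (auto simp: reduced_def)
qed simp

lemma foldr_push_inverse:
  "reduced v \<Longrightarrow> foldr push (map inv_letter (rev w)) (foldr push w v) = v"
proof (induction w arbitrary: v)
  case (Cons x w)
  have "push (inv_letter x) (push x (foldr push w v)) = foldr push w v"
    using push_inv_letter[of "foldr push w v" "inv_letter x"] Cons.prems
    by (simp add: reduced_foldr_push)
  with Cons show ?case by simp
qed simp

theorem group_F2: "group F2"
proof (rule groupI)
  fix w assume "w \<in> carrier F2"
  then have w: "reduced w" by (simp add: F2_def)
  let ?v = "foldr push (map inv_letter (rev w)) []"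
  have "foldr push ?v w = foldr push (map inv_letter (rev w)) (foldr push w [])"
    using w by (simp add: foldr_push_assoc foldr_push_Nil)
  then have "foldr push ?v w = []" by (simp add: foldr_push_inverse)
  then show "\<exists>v\<in>carrier F2. v \<otimes>\<^bsub>F2\<^esub> w = \<one>\<^bsub>F2\<^esub>"
    by (intro bexI[of _ ?v]) (simp_all add: F2_def reduced_foldr_push)
qed (auto simp: F2_def reduced_foldr_push foldr_push_assoc)

section \<open>Potential positivity\<close>

text \<open>The empty word has no negative exponents, so it counts as positive.\<close>

definition positive :: "word \<Rightarrow> bool" where
  "positive w \<longleftrightarrow> (\<forall>x\<in>set w. snd x)"

definition potentially_positive :: "word \<Rightarrow> bool" where
  "potentially_positive u \<longleftrightarrow> (\<exists>\<phi>\<in>auto F2. positive (\<phi> u))"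

section \<open>Algorithms\<close>

text \<open>Algorithms are programs for partial recursive functions (zero, successor, projections,
  composition, primitive recursion, minimisation). \<^term>\<open>rec_eval f xs y\<close> says that program
  \<open>f\<close> halts on the arguments \<open>xs\<close> with value \<open>y\<close>. Primitive recursion is on the first argument;
  its step function receives the previous value, the counter and the parameters, in this order.
  Programs carry no arities: \<open>f\<close> has no value on argument lists that no rule matches.\<close>

datatype recf =
    Zero
  | Succ
  | Proj nat
  | Comp recf "recf list"
  | PrimRec recf recf
  | Mu recf

inductive rec_eval :: "recf \<Rightarrow> nat list \<Rightarrow> nat \<Rightarrow> bool" where
  Zero: "rec_eval Zero xs 0"
| Succ: "rec_eval Succ [x] (Suc x)"
| Proj: "i < length xs \<Longrightarrow> rec_eval (Proj i) xs (xs ! i)"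
| Comp: "list_all2 (\<lambda>g y. rec_eval g xs y) gs ys \<Longrightarrow> rec_eval f ys z
    \<Longrightarrow> rec_eval (Comp f gs) xs z"
| PrimRec_0: "rec_eval f xs y \<Longrightarrow> rec_eval (PrimRec f g) (0 # xs) y"
| PrimRec_Suc: "rec_eval (PrimRec f g) (n # xs) y \<Longrightarrow> rec_eval g (y # n # xs) z
    \<Longrightarrow> rec_eval (PrimRec f g) (Suc n # xs) z"
| Mu: "rec_eval f (n # xs) 0 \<Longrightarrow> (\<forall>m<n. \<exists>y. rec_eval f (m # xs) (Suc y))
    \<Longrightarrow> rec_eval (Mu f) xs n"
monos list_all2_mono

inductive_cases rec_eval_ZeroE: "rec_eval Zero xs y"
inductive_cases rec_eval_SuccE: "rec_eval Succ xs y"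
inductive_cases rec_eval_ProjE: "rec_eval (Proj i) xs y"
inductive_cases rec_eval_CompE: "rec_eval (Comp f gs) xs y"
inductive_cases rec_eval_PrimRec_0E: "rec_eval (PrimRec f g) (0 # xs) y"
inductive_cases rec_eval_PrimRec_SucE: "rec_eval (PrimRec f g) (Suc n # xs) y"
inductive_cases rec_eval_MuE: "rec_eval (Mu f) xs y"

theorem rec_eval_deterministic: "rec_eval f xs y \<Longrightarrow> rec_eval f xs z \<Longrightarrow> y = z"
proof (induction arbitrary: z rule: rec_eval.induct)
  case (Comp xs gs ys f z)
  from Comp.prems obtain ys' where ys': "list_all2 (\<lambda>g y. rec_eval g xs y) gs ys'"
    and z: "rec_eval f ys' z" by (rule rec_eval_CompE)
  have "ys = ys'"
    using Comp.IH(1) ys' by (auto simp: list_all2_conv_all_nth intro!: nth_equalityI)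
  with z Comp.IH show ?case by blast
next
  case (PrimRec_Suc f g n xs y w)
  from PrimRec_Suc.prems obtain y' where y': "rec_eval (PrimRec f g) (n # xs) y'"
    and z: "rec_eval g (y' # n # xs) z" by (rule rec_eval_PrimRec_SucE)
  from PrimRec_Suc.IH(1)[OF y'] z have "rec_eval g (y # n # xs) z" by simp
  then show ?case by (rule PrimRec_Suc.IH(2))
next
  case (Mu f n xs)
  from Mu.prems obtain z0: "rec_eval f (z # xs) 0"
    and zl: "\<forall>m<z. \<exists>y. rec_eval f (m # xs) (Suc y)" by (rule rec_eval_MuE)
  have "\<not> n < z" using Mu.IH(1) zl by blast
  moreover have "\<not> z < n" using Mu.IH(2) z0 by blast
  ultimately show ?case by simp
next
  case (PrimRec_0 f xs y g)
  from PrimRec_0.prems have "rec_eval f xs z" by (rule rec_eval_PrimRec_0E)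
  then show ?case by (rule PrimRec_0.IH)
qed (auto elim: rec_eval_ZeroE rec_eval_SuccE rec_eval_ProjE)

text \<open>Words are passed to programs as single numbers: the four letters are numbered and the
  resulting list is coded by iterated Cantor pairing.\<close>

fun letter_code :: "letter \<Rightarrow> nat" where
  "letter_code (Gen_a, True) = 0"
| "letter_code (Gen_a, False) = 1"
| "letter_code (Gen_b, True) = 2"
| "letter_code (Gen_b, False) = 3"

definition word_code :: "word \<Rightarrow> nat" where
  "word_code w = list_encode (map letter_code w)"

lemma inj_letter_code: "inj letter_code"
proof (rule injI)
  fix x y :: letter assume "letter_code x = letter_code y"
  then show "x = y" by (cases x rule: letter_code.cases; cases y rule: letter_code.cases) auto
qed

lemma inj_word_code: "inj word_code"
  unfolding word_code_def
  by (rule injI) (simp add: list_encode_eq inj_map_eq_map[OF inj_letter_code])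

end

theory Submission
  imports Defs
begin

text \<open>Only the conjugacy class of a word matters. A reduced cyclic word in \<open>a, b\<close> is, up to inversion, positive iff it
  has no bad turn, i.e. no place where adjacent powers of \<open>a\<close> and \<open>b\<close> have opposite signs. By
  Nielsen's theorem and the geometry of the Farey tree, a potentially positive word becomes positive
  up to conjugacy and sign changes along a path of the monoid generated by \<open>a \<mapsto> ab\<close> and \<open>b \<mapsto> ba\<close>,
  possibly after one initial exchange of \<open>b\<close> with its inverse. Along such a path the number of bad
  turns never increases.
  A lone bad turn between two good ones persists for ever; if there is none, a path that stays long
  enough without removing a bad turn can be cut short so that all of them disappear. Hence
  the length of a shortest path is bounded by a computable function of the length of the word, and a
  bounded search over products of elementary automorphisms decides the problem.\<close>

text \<open>The link between automorphisms and paths is the property \<open>reaches\<close>: it is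
  invariant under \<open>swap\<close>, \<open>flip\<close> and \<open>alpha\<close>, so Nielsen
  reduction pulls it back through every generating pair. Inverse moves cost nothing, since
  \<open>flip\<close> conjugates \<open>alpha\<close> to its inverse. Words may grow along a path,
  so length gives no bound, and the count of bad turns may stand still for a long time. Cyclic gap
  lists show what happens meanwhile: \<open>alpha\<close> moves each exponent of b between
  like-signed a's by one towards their sign and keeps all others. Hence a run of one kind of step
  either loses a bad turn or, after a number of steps bounded by the word length, arrives at level
  0, where a single step of the other kind finishes. Paths that change kind too early are caught
  because a step which loses no bad turn leaves the letters of one generator isolated, and this
  confines the exponents to 1 and -1 for the next change. Each loss of a bad turn may cost an
  exponential growth in length, whence the iterated bound \<open>depth\<close>. Every list of moves
  tried in the search is an automorphism, so only completeness depends on the bound.\<close>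

abbreviation "la \<equiv> (Gen_a, True)"
abbreviation "lA \<equiv> (Gen_a, False)"
abbreviation "lb \<equiv> (Gen_b, True)"
abbreviation "lB \<equiv> (Gen_b, False)"

section \<open>Words modulo free cancellation, and formal inverses\<close>

definition nf :: "word \<Rightarrow> word" where
  "nf w = foldr push w []"

text \<open>Calculating with unreduced words modulo this relation keeps product, inverse and
  substitution plain list operations; reduction enters only where lengths matter.\<close>

definition weq :: "word \<Rightarrow> word \<Rightarrow> bool" (infix "\<doteq>" 50) where
  "u \<doteq> v \<longleftrightarrow> nf u = nf v"

definition winv :: "word \<Rightarrow> word" where
  "winv w = map inv_letter (rev w)"

lemma reduced_nf [simp]: "reduced (nf w)"
  by (simp add: nf_def reduced_foldr_push)

lemma nf_reduced: "reduced w \<Longrightarrow> nf w = w"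
  by (simp add: nf_def foldr_push_Nil)

lemma nf_append: "nf (u @ v) = foldr push u (nf v)"
  by (simp add: nf_def)

lemma foldr_push_nf: "reduced v \<Longrightarrow> foldr push (nf u) v = foldr push u v"
  by (simp add: nf_def foldr_push_assoc)

lemma length_nf: "length (nf w) \<le> length w"
proof (induction w)
  case (Cons x w)
  have "length (push x v) \<le> Suc (length v)" for v by (cases v) auto
  from le_trans[OF this, of "nf w"] Cons show ?case by (simp add: nf_def)
qed (simp add: nf_def)

lemma weq_refl [simp]: "u \<doteq> u" and weq_sym: "u \<doteq> v \<Longrightarrow> v \<doteq> u"
  and weq_trans [trans]: "u \<doteq> v \<Longrightarrow> v \<doteq> w \<Longrightarrow> u \<doteq> w"
  by (simp_all add: weq_def)

lemma weq_append: "u \<doteq> u' \<Longrightarrow> v \<doteq> v' \<Longrightarrow> u @ v \<doteq> u' @ v'"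
  unfolding weq_def nf_append by (metis foldr_push_nf reduced_nf)

lemma weq_nf [simp]: "nf w \<doteq> w"
  by (simp add: weq_def nf_reduced)

lemma weq_reduced: "u \<doteq> v \<Longrightarrow> reduced u \<Longrightarrow> reduced v \<Longrightarrow> u = v"
  by (simp add: weq_def nf_reduced)

lemma winv_simps [simp]: "winv [] = []" "winv (x # w) = winv w @ [inv_letter x]"
  "winv (u @ v) = winv v @ winv u" "length (winv w) = length w"
  by (simp_all add: winv_def)

lemma winv_winv [simp]: "winv (winv w) = w"
  by (induction w) auto

lemma inv_letter_simps [simp]: "inv_letter (g, s) = (g, \<not> s)"
  by (simp add: inv_letter_def)

lemma inv_letter_eq_iff [simp]: "inv_letter x = inv_letter y \<longleftrightarrow> x = y"
  by (metis inv_letter_inv_letter)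

lemma winv_left: "winv w @ w \<doteq> []"
  using foldr_push_inverse[of "[]" w] by (simp add: weq_def nf_def winv_def)

lemma winv_right: "w @ winv w \<doteq> []"
  using winv_left[of "winv w"] by simp

lemma winv_cancel: "u @ winv w @ w @ v \<doteq> u @ v" "u @ w @ winv w @ v \<doteq> u @ v"
  using weq_append[OF weq_refl weq_append[OF winv_left weq_refl], of u w v]
    weq_append[OF weq_refl weq_append[OF winv_right weq_refl], of u w v] by simp_all

lemma weq_winv: "u \<doteq> v \<Longrightarrow> winv u \<doteq> winv v"
proof -
  assume "u \<doteq> v"
  have "winv u \<doteq> winv u @ v @ winv v"
    using weq_sym[OF winv_cancel(2)[of "winv u" v "[]"]] by simp
  also have "\<dots> \<doteq> winv u @ u @ winv v"
    by (intro weq_append weq_refl weq_sym[OF \<open>u \<doteq> v\<close>])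
  also have "\<dots> \<doteq> winv v"
    using winv_cancel(1)[of "[]" u "winv v"] by simp
  finally show ?thesis .
qed

lemma reduced_winv: "reduced w \<Longrightarrow> reduced (winv w)"
proof (induction w)
  case (Cons x w)
  then show ?case
    by (cases w) (auto simp: reduced_def successively_append_iff successively_Cons)
qed simp

section \<open>Substitutions\<close>

fun letter_image :: "word \<Rightarrow> word \<Rightarrow> letter \<Rightarrow> word" where
  "letter_image p q (Gen_a, True) = p"
| "letter_image p q (Gen_a, False) = winv p"
| "letter_image p q (Gen_b, True) = q"
| "letter_image p q (Gen_b, False) = winv q"

definition extend :: "word \<Rightarrow> word \<Rightarrow> word \<Rightarrow> word" where
  "extend p q w = concat (map (letter_image p q) w)"

lemma letter_cases: obtains "x = la" | "x = lA" | "x = lb" | "x = lB"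
  by (cases x rule: letter_code.cases) auto

lemma letter_image_inv: "letter_image p q (inv_letter x) = winv (letter_image p q x)"
  by (cases x rule: letter_cases) auto

lemma extend_simps [simp]: "extend p q [] = []" "extend p q (x # w) = letter_image p q x @ extend p q w"
  "extend p q (u @ v) = extend p q u @ extend p q v"
  by (simp_all add: extend_def)

lemma extend_winv: "extend p q (winv w) = winv (extend p q w)"
  by (induction w) (auto simp: letter_image_inv)

lemma extend_nf: "extend p q (nf w) \<doteq> extend p q w"
proof (induction w)
  case (Cons x w)
  have "extend p q (push x v) \<doteq> letter_image p q x @ extend p q v" for v
    using weq_sym[OF winv_cancel(2)[of "[]" "letter_image p q x"]]
    by (cases v) (auto simp: letter_image_inv)
  then have "extend p q (push x (nf w)) \<doteq> letter_image p q x @ extend p q (nf w)" .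
  also have "\<dots> \<doteq> letter_image p q x @ extend p q w" by (intro weq_append Cons weq_refl)
  finally show ?case by (simp add: nf_def)
qed (simp add: nf_def)

lemma extend_weq: "u \<doteq> v \<Longrightarrow> extend p q u \<doteq> extend p q v"
  by (metis extend_nf weq_def weq_sym weq_trans)

lemma extend_weq2: "p \<doteq> p' \<Longrightarrow> q \<doteq> q' \<Longrightarrow> extend p q w \<doteq> extend p' q' w"
proof (induction w)
  case (Cons x w)
  then show ?case by (cases x rule: letter_cases) (auto intro!: weq_append weq_winv)
qed simp

lemma extend_extend: "extend p q (extend p' q' w) = extend (extend p q p') (extend p q q') w"
proof (induction w)
  case (Cons x w)
  then show ?case by (cases x rule: letter_cases) (auto simp: extend_winv)
qed simp

lemma extend_id [simp]: "extend [la] [lb] w = w"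
proof (induction w)
  case (Cons x w)
  then show ?case by (cases x rule: letter_cases) auto
qed simp

abbreviation "alpha \<equiv> extend [la, lb] [lb]"
abbreviation "beta \<equiv> extend [la] [lb, la]"
abbreviation "flip \<equiv> extend [la] [lB]"
abbreviation "swap \<equiv> extend [lb] [la]"
abbreviation "neg \<equiv> extend [lA] [lB]"

section \<open>Conjugacy\<close>

definition cnj :: "word \<Rightarrow> word \<Rightarrow> bool" (infix "\<frown>" 50) where
  "u \<frown> v \<longleftrightarrow> (\<exists>c. u \<doteq> c @ v @ winv c)"

lemma cnjI: "u \<doteq> c @ v @ winv c \<Longrightarrow> u \<frown> v"
  by (auto simp: cnj_def)

lemma weq_cnj: "u \<doteq> v \<Longrightarrow> u \<frown> v"
  by (rule cnjI[of _ "[]"]) simp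

lemma cnj_refl [simp]: "u \<frown> u" by (simp add: weq_cnj)

lemma cnj_sym: "u \<frown> v \<Longrightarrow> v \<frown> u"
proof -
  assume "u \<frown> v"
  then obtain c where c: "u \<doteq> c @ v @ winv c" by (auto simp: cnj_def)
  have "winv c @ u @ c \<doteq> winv c @ (c @ v @ winv c) @ c"
    by (intro weq_append c weq_refl)
  also have "\<dots> \<doteq> v"
    using winv_cancel(1)[of "[]" c "v @ winv c @ c"] winv_cancel(1)[of v c "[]"]
    by simp (blast intro: weq_trans)
  finally show ?thesis
    by (intro cnjI[of _ "winv c"]) (simp add: weq_sym)
qed

lemma cnj_trans [trans]: "u \<frown> v \<Longrightarrow> v \<frown> w \<Longrightarrow> u \<frown> w"
proof -
  assume "u \<frown> v" "v \<frown> w"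
  then obtain c d where c: "u \<doteq> c @ v @ winv c" and d: "v \<doteq> d @ w @ winv d"
    by (auto simp: cnj_def)
  note c
  also have "c @ v @ winv c \<doteq> c @ (d @ w @ winv d) @ winv c"
    by (intro weq_append d weq_refl)
  finally show ?thesis by (intro cnjI[of _ "c @ d"]) simp
qed

lemma weq_cnj_trans [trans]: "u \<doteq> v \<Longrightarrow> v \<frown> w \<Longrightarrow> u \<frown> w"
  and cnj_weq_trans [trans]: "u \<frown> v \<Longrightarrow> v \<doteq> w \<Longrightarrow> u \<frown> w"
  by (meson cnj_trans weq_cnj)+

lemma cnj_rotate: "u @ v \<frown> v @ u"
proof (rule cnjI[of _ u])
  show "u @ v \<doteq> u @ (v @ u) @ winv u"
    using weq_sym[OF winv_cancel(2)[of "u @ v" u "[]"]] by simp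
qed

lemma cnj_extend: "u \<frown> v \<Longrightarrow> extend p q u \<frown> extend p q v"
proof -
  assume "u \<frown> v"
  then obtain c where "u \<doteq> c @ v @ winv c" by (auto simp: cnj_def)
  from extend_weq[OF this, of p q] show ?thesis
    by (intro cnjI[of _ "extend p q c"]) (simp add: extend_winv)
qed

lemma extend_conj: "extend (c @ p @ winv c) (c @ q @ winv c) w \<doteq> c @ extend p q w @ winv c"
proof (induction w)
  case Nil
  then show ?case using weq_sym[OF winv_right[of c]] by simp
next
  case (Cons x w)
  have "letter_image (c @ p @ winv c) (c @ q @ winv c) x = c @ letter_image p q x @ winv c"
    by (cases x rule: letter_cases) auto
  then have "extend (c @ p @ winv c) (c @ q @ winv c) (x # w) \<doteq> 
    (c @ letter_image p q x @ winv c) @ (c @ extend p q w @ winv c)"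
    using weq_append[OF weq_refl Cons, of "c @ letter_image p q x @ winv c"] by simp
  also have "\<dots> \<doteq> c @ extend p q (x # w) @ winv c"
    using winv_cancel(1)[of "c @ letter_image p q x" c "extend p q w @ winv c"] by simp
  finally show ?case .
qed

lemma extend_conj_cnj: "extend (c @ p @ winv c) (c @ q @ winv c) w \<frown> extend p q w"
  by (rule cnjI[OF extend_conj])

section \<open>Positive cones\<close>

definition homog :: "word \<Rightarrow> bool" where
  "homog w \<longleftrightarrow> (\<exists>s. \<forall>x\<in>set w. snd x = s)"

definition good :: "word \<Rightarrow> bool" where
  "good w \<longleftrightarrow> (\<exists>h. w \<frown> h \<and> homog h)"

lemma good_cnj: "u \<frown> v \<Longrightarrow> good u \<longleftrightarrow> good v"
  unfolding good_def using cnj_trans[of v u] cnj_trans[of u v] cnj_sym[of u v] by metis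

lemma homog_extend:
  assumes "homog w" "\<forall>s. \<exists>t. \<forall>g. \<forall>x\<in>set (letter_image p q (g, s)). snd x = t"
  shows "homog (extend p q w)"
proof -
  from assms(1) obtain s where s: "\<forall>x\<in>set w. snd x = s" by (auto simp: homog_def)
  from assms(2) obtain t where t: "\<forall>g. \<forall>x\<in>set (letter_image p q (g, s)). snd x = t" by blast
  have "snd x = t" if "x \<in> set (extend p q w)" for x
  proof -
    from that obtain y where "y \<in> set w" "x \<in> set (letter_image p q y)" by (auto simp: extend_def)
    moreover have "y = (fst y, s)" using s \<open>y \<in> set w\<close> by (auto intro: prod_eqI)
    ultimately show ?thesis using t by metis
  qed
  then show ?thesis unfolding homog_def by blast
qed

lemma all_gen: "(\<forall>g. P g) \<longleftrightarrow> P Gen_a \<and> P Gen_b"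
  by (metis gen.exhaust)

lemma all_bool: "(\<forall>s. P s) \<longleftrightarrow> P True \<and> P False"
  by (metis (full_types))

lemma good_extend:
  assumes "good w" "\<forall>s. \<exists>t. \<forall>g. \<forall>x\<in>set (letter_image p q (g, s)). snd x = t"
  shows "good (extend p q w)"
proof -
  from assms(1) obtain h where "w \<frown> h" "homog h" by (auto simp: good_def)
  then show ?thesis using homog_extend[OF _ assms(2)] cnj_extend unfolding good_def by metis
qed

lemma good_alpha: "good w \<Longrightarrow> good (alpha w)"
  by (erule good_extend) (simp add: all_gen all_bool; blast)

lemma good_neg: "good w \<Longrightarrow> good (neg w)"
  by (erule good_extend) (simp add: all_gen all_bool; blast)

lemma good_swap: "good w \<Longrightarrow> good (swap w)"
  by (erule good_extend) (simp add: all_gen all_bool; blast)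

fun path_map :: "bool list \<Rightarrow> word \<Rightarrow> word" where
  "path_map [] w = w"
| "path_map (s # p) w = path_map p (if s then alpha w else beta w)"

lemma cnj_path_map: "u \<frown> v \<Longrightarrow> path_map p u \<frown> path_map p v"
  by (induction p arbitrary: u v) (auto intro: cnj_extend)

lemma swap_swap [simp]: "swap (swap w) = w"
  by (simp add: extend_extend)

lemma path_map_swap: "path_map (map Not p) (swap w) = swap (path_map p w)"
proof (induction p arbitrary: w)
  case (Cons s p)
  show ?case using Cons[of "alpha w"] Cons[of "beta w"] by (auto simp: extend_extend)
qed simp

text \<open>\<open>alpha\<close> puts b behind a but b^-1 in front of a^-1, so it commutes with
  \<open>neg\<close> only up to conjugation by b^-1, which carries that letter across; likewise for
  \<open>beta\<close> with a^-1.\<close>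

lemma neg_path_map: "path_map p (neg w) \<frown> neg (path_map p w)"
proof (induction p arbitrary: w)
  case (Cons s p)
  have 1: "alpha (neg w) \<frown> neg (alpha w)"
  proof -
    have "alpha (neg w) \<doteq> extend ([lB] @ [lA, lB] @ winv [lB]) ([lB] @ [lB] @ winv [lB]) w"
      unfolding extend_extend by (rule extend_weq2) (simp_all add: weq_def nf_def)
    also have "\<dots> \<frown> extend [lA, lB] [lB] w" by (rule extend_conj_cnj)
    finally show ?thesis by (simp add: extend_extend weq_cnj)
  qed
  have 2: "beta (neg w) \<frown> neg (beta w)"
  proof -
    have "beta (neg w) \<doteq> extend ([lA] @ [lA] @ winv [lA]) ([lA] @ [lB, lA] @ winv [lA]) w"
      unfolding extend_extend by (rule extend_weq2) (simp_all add: weq_def nf_def)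
    also have "\<dots> \<frown> extend [lA] [lB, lA] w" by (rule extend_conj_cnj)
    finally show ?thesis by (simp add: extend_extend weq_cnj)
  qed
  show ?case
    using cnj_trans[OF cnj_path_map[OF 1] Cons] cnj_trans[OF cnj_path_map[OF 2] Cons] by simp
qed simp

section \<open>Words that become good along a path, and invariance under elementary moves\<close>

definition reaches_pos :: "word \<Rightarrow> bool" where
  "reaches_pos w \<longleftrightarrow> (\<exists>p. good (path_map p w))"

definition reaches :: "word \<Rightarrow> bool" where
  "reaches w \<longleftrightarrow> reaches_pos w \<or> reaches_pos (flip w)"

lemma reaches_pos_cnj: "u \<frown> v \<Longrightarrow> reaches_pos u \<longleftrightarrow> reaches_pos v"
  unfolding reaches_pos_def by (metis cnj_path_map good_cnj)

lemma reaches_cnj: "u \<frown> v \<Longrightarrow> reaches u \<longleftrightarrow> reaches v"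
  unfolding reaches_def using reaches_pos_cnj[of u v] reaches_pos_cnj[OF cnj_extend, of u v] by simp

lemma good_reaches: "good w \<Longrightarrow> reaches w"
  unfolding reaches_def reaches_pos_def by (metis path_map.simps(1))

lemma reaches_pos_neg: "reaches_pos w \<Longrightarrow> reaches_pos (neg w)"
  unfolding reaches_pos_def by (metis good_neg good_cnj neg_path_map)

lemma reaches_pos_swap: "reaches_pos w \<Longrightarrow> reaches_pos (swap w)"
  unfolding reaches_pos_def using good_swap path_map_swap by metis

lemma reaches_pos_alphaD: "reaches_pos (alpha w) \<Longrightarrow> reaches_pos w" and reaches_pos_betaD: "reaches_pos (beta w) \<Longrightarrow> reaches_pos w"
  unfolding reaches_pos_def using path_map.simps(2)[of True _ w] path_map.simps(2)[of False _ w] by (simp, metis)+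

lemma flip_flip [simp]: "flip (flip w) = w"
  by (simp add: extend_extend)

lemma reaches_flip [simp]: "reaches (flip w) \<longleftrightarrow> reaches w"
  unfolding reaches_def by auto

text \<open>Since \<open>flip\<close> after \<open>swap\<close> equals \<open>neg\<close> after
  \<open>swap\<close> after \<open>flip\<close>, each of the two alternatives in
  \<open>reaches\<close> is preserved by itself.\<close>

lemma reaches_swap: "reaches w \<Longrightarrow> reaches (swap w)"
proof -
  assume "reaches w"
  moreover have "flip (swap w) = neg (swap (flip w))" by (simp add: extend_extend)
  ultimately show ?thesis unfolding reaches_def using reaches_pos_swap reaches_pos_neg by metis
qed

text \<open>In the Farey tree the bases \<open>(ab, b)\<close> and \<open>(a, ba)\<close> lie in one triangle with \<open>(a, b)\<close>,
  so the passage from one to the other is again a single step.\<close>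

lemma reaches_pos_alpha: "reaches_pos w \<Longrightarrow> reaches (alpha w)"
proof -
  assume "reaches_pos w"
  then obtain p where p: "good (path_map p w)" by (auto simp: reaches_pos_def)
  show ?thesis
  proof (cases p)
    case Nil
    then show ?thesis using p good_alpha good_reaches by simp
  next
    case (Cons s p')
    show ?thesis
    proof (cases s)
      case True
      then show ?thesis using p Cons by (auto simp: reaches_def reaches_pos_def)
    next
      case False
      have "beta (flip (alpha w)) \<doteq> extend [lB] [lA, lB] w"
        unfolding extend_extend by (rule extend_weq2) (simp_all add: weq_def nf_def)
      also have "extend [lB] [lA, lB] w = neg (swap (beta w))" by (simp add: extend_extend)
      finally have "beta (flip (alpha w)) \<doteq> neg (swap (beta w))" .
      moreover have "reaches_pos (beta w)" using p Cons False by (auto simp: reaches_pos_def)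
      ultimately have "reaches_pos (beta (flip (alpha w)))"
        using reaches_pos_swap reaches_pos_neg reaches_pos_cnj weq_cnj by blast
      then show ?thesis unfolding reaches_def using reaches_pos_betaD by blast
    qed
  qed
qed

text \<open>The inverse of \<open>alpha\<close> is its conjugate by \<open>flip\<close>. A step back
  along \<open>alpha\<close> is thus a step forward on the flipped word, which is how invariance in
  both directions follows from the one-way result above.\<close>

lemma alpha_flip_alpha: "alpha (flip (alpha w)) \<frown> flip w"
proof -
  have "alpha (flip (alpha w)) \<doteq> flip w"
    unfolding extend_extend by (rule extend_weq2) (simp_all add: weq_def nf_def)
  then show ?thesis by (rule weq_cnj)
qed

lemma reaches_alpha: "reaches (alpha w) \<longleftrightarrow> reaches w"
proof
  assume "reaches (alpha w)"
  then consider "reaches_pos (alpha w)" | "reaches_pos (flip (alpha w))" by (auto simp: reaches_def)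
  then show "reaches w"
  proof cases
    case 1
    then show ?thesis by (auto simp: reaches_def dest: reaches_pos_alphaD)
  next
    case 2
    from reaches_pos_alpha[OF this] have "reaches (flip w)" using reaches_cnj alpha_flip_alpha by blast
    then show ?thesis by simp
  qed
next
  assume "reaches w"
  then consider "reaches_pos w" | "reaches_pos (flip w)" by (auto simp: reaches_def)
  then show "reaches (alpha w)"
  proof cases
    case 1
    then show ?thesis by (rule reaches_pos_alpha)
  next
    case 2
    then have "reaches_pos (alpha (flip (alpha w)))" using reaches_pos_cnj alpha_flip_alpha by blast
    then show ?thesis by (auto simp: reaches_def dest: reaches_pos_alphaD)
  qed
qed

section \<open>Nielsen reduction\<close>

definition generating :: "word \<Rightarrow> word \<Rightarrow> bool" where
  "generating u v \<longleftrightarrow> (\<exists>w. extend u v w \<doteq> [la]) \<and> (\<exists>w. extend u v w \<doteq> [lb])"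

text \<open>The statement proved by Nielsen reduction. It speaks of the substitution given by the
  pair, so a Nielsen move on the pair is compensated by a substitution on the argument under which
  \<open>reaches\<close> can be pulled back. Generation is carried along because it finally forces
  the reduced pair to consist of single letters.\<close>

definition descends :: "word \<Rightarrow> word \<Rightarrow> bool" where
  "descends u v \<longleftrightarrow> (generating u v \<longrightarrow> (\<forall>w. reaches (extend u v w) \<longrightarrow> reaches w))"

lemma reaches_weq: "u \<doteq> v \<Longrightarrow> reaches u \<longleftrightarrow> reaches v"
  by (intro reaches_cnj weq_cnj)

lemma descends_move:
  assumes d: "descends (extend u v p) (extend u v q)"
    and inv: "\<And>w. extend p q (extend p' q' w) \<doteq> w" and reaches: "\<And>w. reaches (extend p' q' w) \<Longrightarrow> reaches w"
  shows "descends u v"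
proof -
  have eq: "extend u v w \<doteq> extend (extend u v p) (extend u v q) (extend p' q' w)" for w
    using extend_weq[OF inv[of w], of u v] by (simp add: extend_extend weq_sym)
  show ?thesis unfolding descends_def
  proof (intro impI allI)
    fix w assume g: "generating u v" and Xw: "reaches (extend u v w)"
    have "generating (extend u v p) (extend u v q)"
      using g eq unfolding generating_def by (meson weq_sym weq_trans)
    moreover have "reaches (extend (extend u v p) (extend u v q) (extend p' q' w))"
      using Xw reaches_weq[OF eq[of w]] by simp
    ultimately show "reaches w" using d reaches unfolding descends_def by blast
  qed
qed

lemma descends_weq:
  assumes "descends u' v'" "u \<doteq> u'" "v \<doteq> v'"
  shows "descends u v"
proof -
  have "extend u v w \<doteq> extend u' v' w" for w by (intro extend_weq2 assms)
  then show ?thesis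
    using assms(1) reaches_weq unfolding descends_def generating_def by (meson weq_sym weq_trans)
qed

text \<open>Conjugating both members changes the substitution by an inner automorphism, which
  \<open>reaches\<close> cannot see. This extra move shortens pairs on which the ordinary Nielsen
  moves are stuck.\<close>

lemma descends_conj:
  assumes "descends (c @ u @ winv c) (c @ v @ winv c)"
  shows "descends u v"
  unfolding descends_def
proof (intro impI allI)
  fix w assume g: "generating u v" and Xw: "reaches (extend u v w)"
  let ?S = "extend (c @ u @ winv c) (c @ v @ winv c)"
  have "\<exists>w. ?S w \<doteq> z" if z: "\<And>y. \<exists>w. extend u v w \<doteq> y" for z
  proof -
    from z obtain w where w: "extend u v w \<doteq> winv c @ z @ c" by blast
    have "?S w \<doteq> c @ extend u v w @ winv c" by (rule extend_conj)
    also have "\<dots> \<doteq> c @ (winv c @ z @ c) @ winv c" by (intro weq_append w weq_refl)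
    also have "\<dots> \<doteq> z"
      using winv_cancel(2)[of "[]" c "z @ c @ winv c"] winv_cancel(2)[of z c "[]"]
      by simp (blast intro: weq_trans)
    finally show ?thesis by blast
  qed
  moreover have "\<exists>w. extend u v w \<doteq> y" for y
  proof -
    from g obtain w1 w2 where "extend u v w1 \<doteq> [la]" "extend u v w2 \<doteq> [lb]"
      by (auto simp: generating_def)
    then have "extend (extend u v w1) (extend u v w2) y \<doteq> extend [la] [lb] y" by (rule extend_weq2)
    then have "extend u v (extend w1 w2 y) \<doteq> y" by (simp add: extend_extend)
    then show ?thesis by blast
  qed
  ultimately have "generating (c @ u @ winv c) (c @ v @ winv c)"
    by (simp add: generating_def)
  moreover have "reaches (?S w)" using Xw reaches_cnj[OF extend_conj_cnj] by blast
  ultimately show "reaches w" using assms by (auto simp: descends_def)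
qed

lemma descends_swap: "descends v u \<Longrightarrow> descends u v"
  by (rule descends_move[where p = "[lb]" and q = "[la]" and p' = "[lb]" and q' = "[la]"])
    (auto dest: reaches_swap)

lemma descends_inv: "descends (winv u) v \<Longrightarrow> descends u v"
proof (rule descends_move[where p = "[lA]" and q = "[lb]" and p' = "[lA]" and q' = "[lb]"])
  fix w assume "reaches (extend [lA] [lb] w)"
  also have "extend [lA] [lb] w = swap (flip (swap w))" by (simp add: extend_extend)
  finally show "reaches w" using reaches_swap reaches_flip swap_swap by metis
qed (simp_all add: extend_extend)

lemma descends_mult: "descends (u @ v) v \<Longrightarrow> descends u v"
proof (rule descends_move[where p = "[la, lb]" and q = "[lb]" and p' = "[la, lB]" and q' = "[lb]"])
  have eq: "alpha (extend [la, lB] [lb] w) \<doteq> extend [la] [lb] w" for w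
    unfolding extend_extend by (rule extend_weq2) (simp_all add: weq_def nf_def)
  then show "alpha (extend [la, lB] [lb] w) \<doteq> w" for w by simp
  show "reaches w" if "reaches (extend [la, lB] [lb] w)" for w
    using that eq[of w] reaches_alpha reaches_weq by fastforce
qed simp_all

lemma descends_inv_iff: "descends (winv u) v \<longleftrightarrow> descends u v"
  using descends_inv[of u v] descends_inv[of "winv u" v] by auto

lemma descends_inv_iff': "descends u (winv v) \<longleftrightarrow> descends u v"
  using descends_inv_iff descends_swap by blast

lemma descends_mult': "descends u (u @ v) \<Longrightarrow> descends u v"
  using descends_mult[of "winv v" "winv u"] descends_inv_iff[of "u @ v"]
    descends_inv_iff descends_inv_iff' descends_swap by (metis winv_simps(3))

lemma descends_letter_image:
  "fst x \<noteq> fst y \<Longrightarrow> descends (letter_image u v x) (letter_image u v y) \<longleftrightarrow> descends u v"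
  by (cases x rule: letter_cases; cases y rule: letter_cases;
      auto simp: descends_inv_iff descends_inv_iff' dest: descends_swap)

subsection \<open>Exponent sums\<close>

definition expsum :: "gen \<Rightarrow> word \<Rightarrow> int" where
  "expsum g w = (\<Sum>x\<leftarrow>w. if fst x = g then if snd x then 1 else - 1 else 0)"

lemma expsum_simps [simp]: "expsum g [] = 0"
  "expsum g (x # w) = (if fst x = g then if snd x then 1 else - 1 else 0) + expsum g w"
  "expsum g (u @ v) = expsum g u + expsum g v"
  by (simp_all add: expsum_def)

lemma expsum_winv [simp]: "expsum g (winv w) = - expsum g w"
  by (induction w) (auto simp: inv_letter_def)

lemma expsum_extend: "expsum g (extend u v w) = expsum Gen_a w * expsum g u + expsum Gen_b w * expsum g v"
proof (induction w)
  case (Cons x w)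
  then show ?case by (cases x rule: letter_cases) (auto simp: algebra_simps)
qed simp

lemma expsum_nf: "expsum g (nf w) = expsum g w"
proof (induction w)
  case (Cons x w)
  have "expsum g (push x v) = expsum g (x # v)" for v
    by (cases v) (auto simp: inv_letter_def)
  with Cons show ?case by (simp add: nf_def)
qed (simp add: nf_def)

lemma expsum_weq: "u \<doteq> v \<Longrightarrow> expsum g u = expsum g v"
  by (metis expsum_nf weq_def)

text \<open>In the abelianisation all images would be multiples of the exponent vector of
  \<open>v\<close>, whereas a and b have independent vectors.\<close>

lemma not_generating_Nil: "\<not> generating [] v"
proof
  assume "generating [] v"
  then obtain w1 w2 where w: "extend [] v w1 \<doteq> [la]" "extend [] v w2 \<doteq> [lb]"
    by (auto simp: generating_def)
  from expsum_weq[OF w(1), of Gen_a] expsum_weq[OF w(1), of Gen_b] expsum_weq[OF w(2), of Gen_b]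
  show False by (auto simp: expsum_extend)
qed

lemma not_generating_Nil': "\<not> generating u []"
proof
  assume "generating u []"
  then obtain w1 w2 where w: "extend u [] w1 \<doteq> [la]" "extend u [] w2 \<doteq> [lb]"
    by (auto simp: generating_def)
  from expsum_weq[OF w(1), of Gen_a] expsum_weq[OF w(2), of Gen_a] expsum_weq[OF w(2), of Gen_b]
  show False by (auto simp: expsum_extend)
qed

subsection \<open>Cancellation\<close>

text \<open>Used as \<open>lcp (winv s) t\<close>: for reduced words this is the number of letters
  of \<open>s\<close> that cancel against \<open>t\<close>.\<close>

fun lcp :: "'a list \<Rightarrow> 'a list \<Rightarrow> nat" where
  "lcp (x # xs) (y # ys) = (if x = y then Suc (lcp xs ys) else 0)"
| "lcp xs ys = 0"

lemma lcp_le: "lcp xs ys \<le> length xs" "lcp xs ys \<le> length ys"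
  by (induction xs ys rule: lcp.induct) auto

lemma take_lcp: "k \<le> lcp xs ys \<Longrightarrow> take k xs = take k ys"
  by (induction xs ys arbitrary: k rule: lcp.induct) (auto simp: take_Cons' split: if_splits)

lemma lcp_take: "lcp xs ys < k \<Longrightarrow> lcp xs (take k ys @ zs) = lcp xs ys \<or> length ys < k"
proof (induction xs ys arbitrary: k rule: lcp.induct)
  case (1 x xs y ys)
  then obtain j where "k = Suc j" by (cases k) auto
  then show ?case using 1(1)[of j] 1(2) by (auto split: if_splits)
qed auto

lemma nf_cancel:
  assumes "reduced s" "reduced t"
  shows "nf (s @ t) = take (length s - lcp (winv s) t) s @ drop (lcp (winv s) t) t"
  using assms
proof (induction s arbitrary: t rule: rev_induct)
  case Nil
  then show ?case by (cases t) (simp_all add: nf_reduced)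
next
  case (snoc x s)
  show ?case
  proof (cases "t \<noteq> [] \<and> hd t = inv_letter x")
    case True
    then obtain t' where t: "t = inv_letter x # t'" by (cases t) auto
    have "nf (s @ [x] @ winv [x] @ t') = nf (s @ t')"
      using winv_cancel(2)[of s "[x]" t'] unfolding weq_def .
    moreover have "reduced s" "reduced t'"
      using snoc.prems t by (auto simp: reduced_def successively_append_iff dest: reduced_tl[unfolded reduced_def])
    ultimately show ?thesis using snoc.IH[of t'] t lcp_le[of "winv s" t'] by simp
  next
    case False
    then have "lcp (winv (s @ [x])) t = 0" by (cases t) auto
    moreover have "reduced ((s @ [x]) @ t)"
      using False snoc.prems by (auto simp: reduced_def successively_append_iff successively_Cons)
    ultimately show ?thesis by (simp add: nf_reduced)
  qed
qed

lemma reduced_nth: "reduced w \<Longrightarrow> Suc i < length w \<Longrightarrow> w ! Suc i \<noteq> inv_letter (w ! i)"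
  by (simp add: reduced_def successively_conv_nth)

text \<open>A word whose square cancels at least halfway would have an involution in its middle.\<close>

lemma lcp_self:
  assumes "reduced s" "s \<noteq> []"
  shows "2 * lcp (winv s) s < length s"
proof (rule ccontr)
  assume *: "\<not> ?thesis"
  let ?n = "length s"
  define i where "i = (?n - 1) div 2"
  have i: "i < lcp (winv s) s" "i < ?n"
  proof -
    have "0 < ?n" using assms(2) by simp
    then show "i < lcp (winv s) s" "i < ?n" using * unfolding i_def by presburger+
  qed
  have "take (Suc i) (winv s) ! i = take (Suc i) s ! i"
    using take_lcp[of "Suc i" "winv s" s] i by simp
  then have eq: "s ! i = inv_letter (s ! (?n - Suc i))"
    using i by (simp add: winv_def rev_nth)
  show False
  proof (cases "even ?n")
    case True
    moreover have "0 < ?n" using assms(2) by simp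
    ultimately have "?n - Suc i = Suc i" "Suc i < ?n" unfolding i_def by presburger+
    moreover note \<open>Suc i < ?n\<close>
    ultimately show False using eq reduced_nth[OF assms(1), of i] by (metis inv_letter_inv_letter)
  next
    case False
    then have "?n - Suc i = i" unfolding i_def by presburger
    then show False using eq by simp
  qed
qed

text \<open>By \<open>small\<close> the cancellations at the two ends of a factor never use it up.
  The number \<open>k\<close> records how much of the first factor survives on the right; being
  larger than any cancellation from the left, it leaves at least one letter whatever comes before.
  So every later letter of the argument contributes at least one letter to \<open>R\<close>.\<close>

lemma length_extend_reduced:
  assumes red: "\<And>x. reduced (letter_image u v x)"
    and small: "\<And>x' x y. x' \<noteq> inv_letter x \<Longrightarrow> y \<noteq> inv_letter x \<Longrightarrow>
      lcp (winv (letter_image u v x')) (letter_image u v x) + lcp (winv (letter_image u v x)) (letter_image u v y) < length (letter_image u v x)"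
    and "reduced (x # w)"
  shows "\<exists>k R. nf (extend u v (x # w)) = take k (letter_image u v x) @ R \<and> k \<le> length (letter_image u v x) \<and>
    (\<forall>x'. x' \<noteq> inv_letter x \<longrightarrow> lcp (winv (letter_image u v x')) (letter_image u v x) < k) \<and> length w \<le> length R"
  using assms(3)
proof (induction w arbitrary: x)
  case Nil
  have "lcp (winv (letter_image u v x')) (letter_image u v x) < length (letter_image u v x)" if "x' \<noteq> inv_letter x" for x'
    using small[OF that, of x] by simp
  then show ?case
    by (intro exI[of _ "length (letter_image u v x)"] exI[of _ "[]"]) (simp add: nf_reduced red)
next
  case (Cons y w)
  have yx: "y \<noteq> inv_letter x" and r: "reduced (y # w)"
    using Cons.prems by (auto simp: reduced_def)
  from Cons.IH[OF r] obtain k R where kR: "nf (extend u v (y # w)) = take k (letter_image u v y) @ R"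
    "k \<le> length (letter_image u v y)" "\<And>x'. x' \<noteq> inv_letter y \<Longrightarrow> lcp (winv (letter_image u v x')) (letter_image u v y) < k"
    "length w \<le> length R" by blast
  define c where "c = lcp (winv (letter_image u v x)) (letter_image u v y)"
  have xy: "x \<noteq> inv_letter y" using yx by auto
  then have ck: "c < k" using kR(3) c_def by blast
  have c: "lcp (winv (letter_image u v x)) (take k (letter_image u v y) @ R) = c"
    using lcp_take[OF kR(3)[OF xy], of R] kR(2) by (simp add: c_def)
  have "nf (extend u v (x # y # w)) = nf (letter_image u v x @ nf (extend u v (y # w)))"
    using weq_append[OF weq_refl weq_sym[OF weq_nf[of "extend u v (y # w)"]], of "letter_image u v x"]
    by (simp add: weq_def)
  also have "\<dots> = take (length (letter_image u v x) - c) (letter_image u v x) @ drop c (take k (letter_image u v y) @ R)"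
    using nf_cancel[OF red reduced_nf, of x "extend u v (y # w)"] kR(1) c by simp
  finally have 1: "nf (extend u v (x # y # w)) = \<dots>" .
  have 2: "lcp (winv (letter_image u v x')) (letter_image u v x) < length (letter_image u v x) - c" if "x' \<noteq> inv_letter x" for x'
    using small[OF that yx] by (simp add: c_def)
  have 3: "length (y # w) \<le> length (drop c (take k (letter_image u v y) @ R))"
    using kR ck by simp
  show ?case using 1 2 3 by (meson diff_le_self)
qed

lemma reduced_letter_image: "reduced u \<Longrightarrow> reduced v \<Longrightarrow> reduced (letter_image u v x)"
  by (cases x rule: letter_cases) (auto intro: reduced_winv)

lemma not_inv_cases: "y \<noteq> inv_letter x \<Longrightarrow> y = x \<or> fst x \<noteq> fst y"
  by (auto simp: inv_letter_def prod_eq_iff)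

text \<open>Nielsen reduction by induction on the total length. In a counterexample of least length
  no Nielsen move or conjugation shortens the pair; then no factor is consumed by its neighbours, so
  a and b can only be images of single letters, and the pair is (a, b) up to order and
  signs.\<close>

theorem descends:
  "reduced u \<Longrightarrow> reduced v \<Longrightarrow> descends u v"
proof (induction "length u + length v" arbitrary: u v rule: less_induct)
  case less
  note red = reduced_letter_image[OF less.prems]
  define L where "L = letter_image u v"
  note [simp] = L_def[symmetric]
  have redL: "reduced (L x)" for x using red by simp
  have Linv: "L (inv_letter x) = winv (L x)" for x by (metis L_def letter_image_inv)
  have len: "length (L x) + length (L y) = length u + length v" if "fst x \<noteq> fst y" for x y
    using that by (cases x rule: letter_cases; cases y rule: letter_cases) (auto simp: L_def simp del: L_def[symmetric])
  have short: "descends s t" if "length (nf s) + length (nf t) < length u + length v" for s t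
    using less.hyps[OF that] by (rule descends_weq) (simp_all add: weq_sym)
  show ?case
  proof (rule ccontr)
    assume neg: "\<not> ?case"
    then have gen: "generating u v" by (auto simp: descends_def)
    have notL: "\<not> descends (L x) (L y)" if "fst x \<noteq> fst y" for x y
      using neg descends_letter_image[OF that, of u v] by simp
    have nat_enc: "L x \<noteq> []" for x
    proof -
      have "u \<noteq> []" "v \<noteq> []" using gen not_generating_Nil not_generating_Nil' by auto
      then have "length u \<noteq> 0" "length v \<noteq> 0" by auto
      then have "length (L x) \<noteq> 0"
        by (cases x rule: letter_cases) (auto simp: L_def simp del: L_def[symmetric] length_0_conv length_greater_0_conv)
      then show ?thesis by auto
    qed
    define c where "c x y = lcp (winv (L x)) (L y)" for x y
    \<comment> \<open>Were more than half of one factor cancelled, the product would be shorter than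
      the other factor, and putting it in that place would give a shorter pair.\<close>
    have half: "2 * c x y \<le> length (L x)" "2 * c x y \<le> length (L y)" if xy: "fst x \<noteq> fst y" for x y
    proof -
      have l: "length (nf (L x @ L y)) = length (L x) + length (L y) - 2 * c x y"
        using nf_cancel[OF redL redL, of x y] lcp_le[of "winv (L x)" "L y"] by (simp add: c_def)
      have cle: "c x y \<le> length (L x)" "c x y \<le> length (L y)"
        using lcp_le[of "winv (L x)" "L y"] by (simp_all add: c_def)
      have "\<not> length (nf (L x @ L y)) + length (nf (L y)) < length u + length v"
        using short descends_mult notL[OF xy] by blast
      then show "2 * c x y \<le> length (L y)"
        using l cle len[OF xy] by (simp add: nf_reduced redL)
      have "\<not> length (nf (L x)) + length (nf (L x @ L y)) < length u + length v"
        using short descends_mult' notL[OF xy] by blast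
      then show "2 * c x y \<le> length (L x)"
        using l cle len[OF xy] by (simp add: nf_reduced redL)
    qed
    have half': "2 * c x y \<le> length (L x)" "2 * c x y \<le> length (L y)"
      "fst x = fst y \<Longrightarrow> 2 * c x y < length (L x)" if "y \<noteq> inv_letter x" for x y
    proof -
      have "2 * c x y \<le> length (L x) \<and> 2 * c x y \<le> length (L y) \<and>
        (fst x = fst y \<longrightarrow> 2 * c x y < length (L x))"
      proof (cases "fst x = fst y")
        case True
        then have "y = x" using not_inv_cases[OF that] by blast
        then show ?thesis using lcp_self[OF redL nat_enc, of x] by (simp add: c_def)
      next
        case False
        then show ?thesis using half[OF False] by blast
      qed
      then show "2 * c x y \<le> length (L x)" "2 * c x y \<le> length (L y)"
        "fst x = fst y \<Longrightarrow> 2 * c x y < length (L x)" by blast+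
    qed
    \<comment> \<open>Failure means that \<open>L x\<close> is consumed exactly by halves from both
      sides. Since \<open>lcp_self\<close> excludes \<open>x\<close> itself as a neighbour, both
      neighbours are letters of the other generator.\<close>
    have small: "c x' x + c x y < length (L x)"
      if x': "x' \<noteq> inv_letter x" and y: "y \<noteq> inv_letter x" for x' x y
    proof (rule ccontr)
      assume "\<not> ?thesis"
      moreover have x'': "x \<noteq> inv_letter x'" using x' by auto
      moreover note half'[OF x''] half'[OF y] half'(3)[of x x]
      ultimately have m: "2 * c x' x = length (L x)" "2 * c x y = length (L x)"
        and d: "fst x' \<noteq> fst x" "fst x \<noteq> fst y"
        using not_inv_cases[OF x''] not_inv_cases[OF y] by fastforce+
      define m where "m = c x y"
      define p q where "p = take m (L x)" and "q = drop m (L x)"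
      have Lx: "L x = p @ q" by (simp add: p_def q_def)
      have lp: "length p = m" "length q = m" using m by (simp_all add: p_def q_def m_def)
      have "take m (winv (L x')) = p" "take m (winv (L x)) = take m (L y)"
        using take_lcp[of m "winv (L x')" "L x"] take_lcp[of m "winv (L x)" "L y"] m
        by (simp_all add: p_def m_def c_def)
      then have 1: "take m (winv (L x')) = p" and 2: "take m (L y) = winv q"
        using lp by (simp_all add: Lx)
      from d have "y = x' \<or> y = inv_letter x'"
        by (cases x rule: letter_cases; cases y rule: letter_cases; cases x' rule: letter_cases) auto
      then show False
      proof
        assume "y = inv_letter x'"
        then have "p = winv q" using 1 2 Linv by simp
        then have "L x \<doteq> []" using winv_left Lx by simp
        then show False using redL nat_enc weq_reduced reduced_Nil by blast
      next
        assume y: "y = x'"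
        define z where "z = take (length (L y) - 2 * m) (drop m (L y))"
        have ly: "2 * m \<le> length (L y)" using half(2)[OF d(2)] by (simp add: m_def)
        have "drop (length (L y) - m) (L y) = winv (take m (winv (L y)))"
          using ly by (simp add: winv_def take_map take_rev rev_map comp_def)
        then have "drop (length (L y) - m) (L y) = winv p" using 1 y by simp
        moreover have "L y = take m (L y) @ z @ drop (length (L y) - m) (L y)"
        proof -
          have "drop m (L y) = z @ drop (length (L y) - 2 * m) (drop m (L y))"
            unfolding z_def by (rule append_take_drop_id[symmetric])
          moreover have "length (L y) - 2 * m + m = length (L y) - m" using ly by simp
          ultimately show ?thesis by (metis append_take_drop_id drop_drop)
        qed
        ultimately have Ly: "L y = winv q @ z @ winv p" using 2 by simp
        \<comment> \<open>Here \<open>L x\<close> is p q and \<open>L y\<close> is q^-1 z p^-1. The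
          pair \<open>L x\<close>, \<open>L x @ L y\<close> conjugated by p^-1 becomes q p, z, which
          is shorter by the length of \<open>L x\<close>. Nielsen's proof would use an ordering of
          half words at this point.\<close>
        let ?c = "winv p"
        have 3: "?c @ L x @ winv ?c \<doteq> q @ p"
          using winv_cancel(1)[of "[]" p "q @ p"] by (simp add: Lx)
        have 4: "?c @ (L x @ L y) @ winv ?c \<doteq> z"
        proof -
          have "?c @ (L x @ L y) @ winv ?c = winv p @ p @ (q @ winv q @ z @ winv p @ p)"
            by (simp add: Lx Ly)
          also have "\<dots> \<doteq> q @ winv q @ z @ winv p @ p"
            using winv_cancel(1)[of "[]" p "q @ winv q @ z @ winv p @ p"] by simp
          also have "\<dots> \<doteq> z @ winv p @ p"
            using winv_cancel(2)[of "[]" q "z @ winv p @ p"] by simp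
          also have "\<dots> \<doteq> z" using winv_cancel(1)[of z p "[]"] by simp
          finally show ?thesis .
        qed
        have "length (nf (q @ p)) + length (nf z) < length u + length v"
        proof -
          have "length (L x) > 0" using nat_enc by simp
          moreover have "length z = length (L y) - 2 * m" using ly by (simp add: z_def)
          moreover have "length (q @ p) = 2 * m" using lp by simp
          ultimately show ?thesis
            using length_nf[of "q @ p"] length_nf[of z] len[OF d(2)] m(2) ly unfolding m_def by linarith
        qed
        from short[OF this] have "descends (?c @ L x @ winv ?c) (?c @ (L x @ L y) @ winv ?c)"
          by (rule descends_weq[OF _ 3 4])
        then show False
          using descends_conj descends_mult' notL[OF d(2)] by blast
      qed
    qed
    \<comment> \<open>The product has \<open>k + length R\<close> letters with \<open>k\<close>
      positive and \<open>R\<close> at least as long as \<open>w1\<close>, so an image of length one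
      comes from a single letter.\<close>
    have one: "\<exists>x. L x = [l]" if w: "extend u v w \<doteq> [l]" for w l
    proof -
      have w': "nf (extend u v (nf w)) = [l]"
        using w extend_nf by (metis weq_def nf_reduced reduced_def successively.simps(2))
      obtain x w1 where xw: "nf w = x # w1"
        using w' by (cases "nf w") (auto simp: nf_def)
      then have "reduced (x # w1)" by (metis reduced_nf)
      with red small have "\<exists>k R. nf (extend u v (x # w1)) = take k (letter_image u v x) @ R \<and> k \<le> length (letter_image u v x) \<and>
        (\<forall>x'. x' \<noteq> inv_letter x \<longrightarrow> lcp (winv (letter_image u v x')) (letter_image u v x) < k) \<and> length w1 \<le> length R"
        by (intro length_extend_reduced) (simp_all add: c_def)
      then obtain k R where kR: "nf (extend u v (x # w1)) = take k (L x) @ R" "k \<le> length (L x)"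
        "\<And>x'. x' \<noteq> inv_letter x \<Longrightarrow> c x' x < k" "length w1 \<le> length R"
        unfolding c_def L_def by blast
      have *: "[l] = take k (L x) @ R" using kR(1) w' xw by metis
      note * = * kR(2) kR(3)[of x, OF inv_letter_neq(2)] kR(4)
      from arg_cong[OF *(1), of length] *(2) have "1 = k + length R" by simp
      with *(3,4) have "length w1 = 0" by linarith
      then have "w1 = []" by simp
      then have "nf (L x) = [l]" using w' xw by simp
      then show ?thesis using nf_reduced redL by metis
    qed
    from gen obtain x y where xy: "L x = [la]" "L y = [lb]"
      using one unfolding generating_def by metis
    have "fst x \<noteq> fst y"
    proof
      assume "fst x = fst y"
      then have "y = x \<or> y = inv_letter x" by (auto simp: inv_letter_def prod_eq_iff)
      then show False using xy Linv[of x] by auto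
    qed
    moreover have "descends [la] [lb]" by (simp add: descends_def)
    ultimately show False using notL xy by metis
  qed
qed

section \<open>Cyclic words\<close>

fun turns :: "word \<Rightarrow> bool list" where
  "turns (x # y # w) = (if fst x \<noteq> fst y then (snd x = snd y) # turns (y # w) else turns (y # w))"
| "turns _ = []"

text \<open>Repeating the first letter at the end turns cyclic adjacency into linear adjacency, so
  that \<open>turns\<close>, \<open>reduced\<close> and \<open>successively\<close> apply
  unchanged.\<close>

definition closed :: "word \<Rightarrow> word" where
  "closed w = w @ [hd w]"

definition cturns :: "word \<Rightarrow> bool list" where
  "cturns w = turns (closed w)"

definition bad :: "word \<Rightarrow> nat" where
  "bad w = length (filter Not (cturns w))"

definition cyc_reduced :: "word \<Rightarrow> bool" where
  "cyc_reduced w \<longleftrightarrow> w \<noteq> [] \<and> reduced (closed w)"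

text \<open>The obstruction: a bad turn whose two cyclic neighbours are good. The rotation lets the
  pattern run across the end of the list.\<close>

definition dead :: "bool list \<Rightarrow> bool" where
  "dead t \<longleftrightarrow> (\<exists>n x y. rotate n t = x @ [True, False, True] @ y)"

lemma turns_append: "turns (u @ x # v) = turns (u @ [x]) @ turns (x # v)"
  by (induction u rule: turns.induct) auto

lemma successively_closed_rotate1:
  "successively P (closed (rotate1 w)) \<longleftrightarrow> successively P (closed w)"
proof (cases w)
  case (Cons x v)
  show ?thesis
  proof (cases v)
    case (Cons y v')
    have "successively P ((v @ [x]) @ [y]) \<longleftrightarrow> successively P (v @ [x]) \<and> P x y"
      by (subst successively_append_iff) auto
    moreover have "successively P (x # (v @ [x])) \<longleftrightarrow> P x y \<and> successively P (v @ [x])"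
      using Cons by simp
    moreover have "closed (rotate1 w) = (v @ [x]) @ [y]" "closed w = x # (v @ [x])"
      using \<open>w = x # v\<close> Cons by (simp_all add: closed_def)
    ultimately show ?thesis by metis
  qed (simp add: Cons)
qed simp

lemma successively_closed_rotate:
  "successively P (closed (rotate n w)) \<longleftrightarrow> successively P (closed w)"
  by (induction n) (simp_all add: successively_closed_rotate1)

lemma cyc_reduced_rotate [simp]: "cyc_reduced (rotate n w) \<longleftrightarrow> cyc_reduced w"
  by (simp add: cyc_reduced_def reduced_def successively_closed_rotate)

lemma cturns_rotate1: "\<exists>m. cturns (rotate1 w) = rotate m (cturns w)"
proof (cases w)
  case Nil
  then show ?thesis by (intro exI[of _ 0]) simp
next
  case (Cons x v)
  show ?thesis
  proof (cases v)
    case Nil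
    then show ?thesis using Cons by (intro exI[of _ 0]) simp
  next
    case (Cons y v')
    have "turns (v @ [x] @ [y]) = turns (v @ [x]) @ turns [x, y]"
      using turns_append[of v x "[y]"] by simp
    moreover have "turns (x # v @ [x]) = turns [x, y] @ turns (v @ [x])"
      using turns_append[of "[x]" y "v' @ [x]"] Cons by simp
    ultimately show ?thesis using \<open>w = x # v\<close> Cons
      by (intro exI[of _ "length (turns [x, y])"])
        (simp only: cturns_def closed_def rotate1.simps append.simps append_assoc list.sel rotate_append)
  qed
qed

lemma cturns_rotate: "\<exists>m. cturns (rotate n w) = rotate m (cturns w)"
proof (induction n)
  case 0
  show ?case by (intro exI[of _ 0]) simp
next
  case (Suc n)
  then show ?case using cturns_rotate1[of "rotate n w"] by (auto simp: rotate_rotate)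
qed

lemma bad_rotate [simp]: "bad (rotate n w) = bad w"
proof -
  have "length (filter Not (rotate m t)) = length (filter Not t)" for m t
    using arg_cong[OF append_take_drop_id[of "m mod length t" t], of "\<lambda>t. length (filter Not t)"]
    by (simp only: rotate_drop_take filter_append length_append add.commute)
  then show ?thesis using cturns_rotate[of n w] by (auto simp: bad_def)
qed

lemma dead_rotate [simp]: "dead (rotate m t) \<longleftrightarrow> dead t"
proof
  show "dead (rotate m t) \<Longrightarrow> dead t"
    unfolding dead_def rotate_rotate by blast
next
  assume "dead t"
  then obtain n x y where n: "rotate n t = x @ [True, False, True] @ y" by (auto simp: dead_def)
  have "rotate (n + m * (length t - 1)) (rotate m t) = rotate (n + m * length t) t"
    using n by (cases t) (simp_all add: rotate_rotate algebra_simps)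
  also have "\<dots> = rotate n t"
    by (metis mod_mult_self1 mult.commute rotate_conv_mod)
  finally show "dead (rotate m t)" unfolding dead_def using n by metis
qed

lemma dead_cturns_rotate [simp]: "dead (cturns (rotate n w)) \<longleftrightarrow> dead (cturns w)"
  using cturns_rotate[of n w] by auto

lemma dead_append: "dead (u @ v) \<longleftrightarrow> dead (v @ u)"
  by (metis dead_rotate rotate_append)

lemma deadI: "t = x @ [True, False, True] @ y \<Longrightarrow> dead t"
  unfolding dead_def by (metis rotate0 id_apply)

lemma dead_bad: "dead (cturns w) \<Longrightarrow> 0 < bad w"
proof -
  assume "dead (cturns w)"
  then obtain n x y where n: "rotate n (cturns w) = x @ [True, False, True] @ y"
    by (auto simp: dead_def)
  then have "False \<in> set (rotate n (cturns w))" by simp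
  then have "False \<in> set (cturns w)" by simp
  then have "False \<in> set (filter Not (cturns w))" by simp
  then show ?thesis unfolding bad_def by (metis length_pos_if_in_set)
qed

lemma cnj_rotate_word: "w \<frown> rotate n w"
  using cnj_rotate[of "take (n mod length w) w" "drop (n mod length w) w"]
  by (simp add: rotate_drop_take)

subsection \<open>Exchanging the generators\<close>

lemma swap_map: "swap w = map (\<lambda>(g, s). (case g of Gen_a \<Rightarrow> Gen_b | Gen_b \<Rightarrow> Gen_a, s)) w"
proof (induction w)
  case (Cons x w)
  then show ?case by (cases x rule: letter_cases) auto
qed simp

lemma length_swap [simp]: "length (swap w) = length w"
  by (simp add: swap_map)

lemma swap_Nil_iff [simp]: "swap w = [] \<longleftrightarrow> w = []"
  by (simp add: swap_map)

lemma closed_swap: "w \<noteq> [] \<Longrightarrow> closed (swap w) = swap (closed w)"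
  by (cases w) (simp_all add: closed_def swap_map del: extend_simps)

lemma turns_swap: "turns (swap w) = turns w"
proof (induction w rule: turns.induct)
  case (1 x y w)
  then show ?case by (cases x rule: letter_cases; cases y rule: letter_cases) auto
qed (simp_all add: swap_map del: extend_simps)

lemma cturns_swap [simp]: "cturns (swap w) = cturns w"
  using turns_swap[of "closed w"] closed_swap[of w] by (cases "w = []") (auto simp: cturns_def)

lemma bad_swap [simp]: "bad (swap w) = bad w"
  by (simp add: bad_def)

lemma successively_swap:
  "successively P (swap w) \<longleftrightarrow> successively (\<lambda>x y. P (hd (swap [x])) (hd (swap [y]))) w"
  unfolding swap_map successively_map by simp

lemma cyc_reduced_swap [simp]: "cyc_reduced (swap w) \<longleftrightarrow> cyc_reduced w"
proof (cases "w = []")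
  case False
  have eq: "hd (swap [y]) = inv_letter (hd (swap [x])) \<longleftrightarrow> y = inv_letter x" for x y
    by (cases x rule: letter_cases; cases y rule: letter_cases) auto
  show ?thesis
    unfolding cyc_reduced_def reduced_def closed_swap[OF False] successively_swap eq by simp
qed (simp add: cyc_reduced_def)

lemma swap_in_iff: "(g, s) \<in> set (swap w) \<longleftrightarrow> (case g of Gen_a \<Rightarrow> Gen_b | Gen_b \<Rightarrow> Gen_a, s) \<in> set w"
proof (induction w)
  case (Cons x w)
  then show ?case by (cases g; cases x rule: letter_cases) auto
qed simp

subsection \<open>Words without bad turns\<close>

text \<open>Neighbouring letters agree in sign for two reasons: equal generators because the word is
  reduced, different generators because the turn between them is good.\<close>

lemma homog_if_no_bad:
  "reduced w \<Longrightarrow> False \<notin> set (turns w) \<Longrightarrow> homog w"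
proof (induction w rule: turns.induct)
  case (1 x y w)
  have "reduced (y # w)" using 1 by (auto dest: reduced_tl)
  moreover have "False \<notin> set (turns (y # w))" using 1(4) by (auto split: if_splits)
  ultimately obtain s where s: "\<forall>z\<in>set (y # w). snd z = s"
    using 1 by (auto simp: homog_def split: if_splits)
  moreover have "snd x = snd y"
    using 1(3,4) by (auto simp: reduced_def inv_letter_def prod_eq_iff split: if_splits)
  ultimately show ?case unfolding homog_def by (intro exI[of _ s]) auto
qed (auto simp: homog_def)

lemma good_if_no_bad: "cyc_reduced w \<Longrightarrow> bad w = 0 \<Longrightarrow> good w"
proof -
  assume "cyc_reduced w" "bad w = 0"
  then have "homog (closed w)"
    by (intro homog_if_no_bad) (auto simp: cyc_reduced_def bad_def cturns_def filter_empty_conv)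
  then have "homog w" by (auto simp: homog_def closed_def)
  then show ?thesis unfolding good_def using cnj_refl by blast
qed

text \<open>Passing to powers removes the dependence on the conjugator, which can only contribute
  boundedly many letters of the wrong sign.\<close>

lemma good_homog: "cyc_reduced w \<Longrightarrow> good w \<Longrightarrow> homog w"
proof -
  assume w: "cyc_reduced w" and "good w"
  then obtain c h s where ch: "w \<doteq> c @ h @ winv c" and h: "\<forall>x\<in>set h. snd x = s"
    by (auto simp: good_def cnj_def homog_def)
  define cnt where "cnt v = length (filter (\<lambda>x. snd x \<noteq> s) v)" for v :: word
  have cnt_append: "cnt (u @ v) = cnt u + cnt v" for u v by (simp add: cnt_def)
  have cnt_le: "cnt v \<le> length v" for v by (simp add: cnt_def)
  have cnt_nf: "cnt (nf v) \<le> cnt v" for v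
  proof (induction v)
    case (Cons x v)
    have "cnt (push x u) \<le> cnt (x # u)" for u by (cases u) (auto simp: cnt_def)
    from le_trans[OF this, of "nf v"] Cons show ?case by (auto simp: nf_def cnt_def)
  qed (simp add: nf_def)
  define pw where "pw n v = concat (replicate n v)" for n and v :: word
  have pw_Suc: "pw (Suc n) v = v @ pw n v" for n v by (simp add: pw_def)
  have red: "reduced (pw n w)" for n
  proof (induction n)
    case (Suc n)
    have "pw n w = [] \<or> hd (pw n w) = hd w" using w by (cases n) (auto simp: pw_def cyc_reduced_def)
    with Suc w show ?case
      by (auto simp: pw_Suc cyc_reduced_def closed_def reduced_def successively_append_iff)
  qed (simp add: pw_def)
  have "pw n w \<doteq> c @ pw n h @ winv c" for n
  proof (induction n)
    case 0
    then show ?case using weq_sym[OF winv_right[of c]] by (simp add: pw_def)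
  next
    case (Suc n)
    have "pw (Suc n) w \<doteq> (c @ h @ winv c) @ (c @ pw n h @ winv c)"
      unfolding pw_Suc by (intro weq_append ch Suc)
    also have "\<dots> \<doteq> c @ pw (Suc n) h @ winv c"
      using winv_cancel(1)[of "c @ h" c "pw n h @ winv c"] by (simp add: pw_Suc)
    finally show ?case .
  qed
  then have pw: "pw n w = nf (c @ pw n h @ winv c)" for n
    using red by (metis nf_reduced weq_def)
  have "cnt (pw n h) = 0" for n
    using h by (auto simp: cnt_def pw_def filter_empty_conv)
  then have bound: "cnt (pw n w) \<le> 2 * length c" for n
    using cnt_nf[of "c @ pw n h @ winv c"] cnt_le[of c] cnt_le[of "winv c"]
    by (simp add: pw cnt_append)
  have "cnt (pw n w) = n * cnt w" for n by (induction n) (simp_all add: pw_Suc cnt_append pw_def[of 0] cnt_def)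
  with bound[of "Suc (2 * length c)"] have "cnt w = 0" by (cases "cnt w") auto
  then show ?thesis by (auto simp: homog_def cnt_def filter_empty_conv)
qed

lemma good_no_bad: "cyc_reduced w \<Longrightarrow> good w \<Longrightarrow> bad w = 0"
proof -
  assume "cyc_reduced w" "good w"
  then obtain s where s: "\<forall>x\<in>set w. snd x = s" "w \<noteq> []"
    using good_homog by (auto simp: homog_def cyc_reduced_def)
  have "False \<notin> set (turns v)" if "\<forall>x\<in>set v. snd x = s" for v
    using that by (induction v rule: turns.induct) auto
  from this[of "closed w"] s show ?thesis
    by (simp add: bad_def cturns_def closed_def filter_empty_conv) (metis (full_types))
qed

section \<open>Gap lists\<close>

text \<open>The gap list \<open>(e\<^sub>1, k\<^sub>1), \<dots>, (e\<^sub>n, k\<^sub>n)\<close> stands for the cyclic word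
  \<open>a\<^bsup>e\<^sub>1\<^esup> b\<^bsup>k\<^sub>1\<^esup> \<dots> a\<^bsup>e\<^sub>n\<^esup> b\<^bsup>k\<^sub>n\<^esup>\<close>, where a truth value codes
  the exponent 1 or -1. In these coordinates \<open>alpha\<close> changes \<open>k\<^sub>i\<close> by an amount that
  depends on the signs \<open>e\<^sub>i\<close> and \<open>e\<^bsub>i+1\<^esub>\<close> only.\<close>

definition bpow :: "int \<Rightarrow> word" where
  "bpow k = replicate (nat \<bar>k\<bar>) (Gen_b, 0 < k)"

definition gap_word :: "(bool \<times> int) list \<Rightarrow> word" where
  "gap_word G = concat (map (\<lambda>(e, k). (Gen_a, e) # bpow k) G)"

definition fsign :: "(bool \<times> int) list \<Rightarrow> bool \<Rightarrow> bool" where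
  "fsign G e = (case G of [] \<Rightarrow> e | g # _ \<Rightarrow> fst g)"

text \<open>Each exponent of b is listed with the signs of the a before and after it;
  \<open>e0\<close> is the sign behind the last gap. \<open>ctri\<close> closes the cycle by
  supplying the first sign.\<close>

fun tri :: "(bool \<times> int) list \<Rightarrow> bool \<Rightarrow> (bool \<times> int \<times> bool) list" where
  "tri [] e0 = []"
| "tri ((e, k) # G) e0 = (e, k, fsign G e0) # tri G e0"

abbreviation ctri :: "(bool \<times> int) list \<Rightarrow> (bool \<times> int \<times> bool) list" where
  "ctri G \<equiv> tri G (fsign G True)"

fun gturns :: "bool \<times> int \<times> bool \<Rightarrow> bool list" where
  "gturns (e, k, e') = (if k = 0 then [] else [(0 < k) = e, (0 < k) = e'])"

text \<open>Read off from a -> ab and a^-1 -> b^-1 a^-1: a positive a on the left adds a b to the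
  gap, a negative one on the right adds a b^-1. The result is 1 or -1 between equal signs and 0
  between opposite ones.\<close>

definition shift :: "bool \<Rightarrow> bool \<Rightarrow> int" where
  "shift e e' = (if e then 1 else 0) - (if e' then 0 else 1)"

fun shift_tri :: "bool \<times> int \<times> bool \<Rightarrow> bool \<times> int \<times> bool" where
  "shift_tri (e, k, e') = (e, k + shift e e', e')"

definition shift_gaps :: "(bool \<times> int) list \<Rightarrow> bool \<Rightarrow> (bool \<times> int) list" where
  "shift_gaps G e0 = map (\<lambda>(e, k, e'). (e, k + shift e e')) (tri G e0)"

abbreviation cshift_gaps :: "(bool \<times> int) list \<Rightarrow> (bool \<times> int) list" where
  "cshift_gaps G \<equiv> shift_gaps G (fsign G True)"

lemma gap_word_simps [simp]: "gap_word [] = []" "gap_word ((e, k) # G) = (Gen_a, e) # bpow k @ gap_word G"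
  by (simp_all add: gap_word_def)

lemma fsign_simps [simp]: "fsign [] e0 = e0" "fsign ((e, k) # G) e0 = e"
  by (simp_all add: fsign_def)

lemma shift_gaps_simps [simp]: "shift_gaps [] e0 = []"
  "shift_gaps ((e, k) # G) e0 = (e, k + shift e (fsign G e0)) # shift_gaps G e0"
  by (simp_all add: shift_gaps_def)

lemma fsign_shift [simp]: "fsign (shift_gaps G e0) e1 = fsign G e1"
  by (cases G) auto

lemma tri_shift: "tri (shift_gaps G e0) e0 = map shift_tri (tri G e0)"
  by (induction G e0 rule: tri.induct) auto

lemma shift_gaps_Nil_iff [simp]: "shift_gaps G e0 = [] \<longleftrightarrow> G = []"
  by (cases G) auto

lemma tri_append: "tri (G @ G') e0 = tri G (fsign G' e0) @ tri G' e0"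
proof (induction G)
  case (Cons g G)
  then show ?case by (cases g; cases G) auto
qed simp

lemma tri_fst: "(e, k, e') \<in> set (tri G e0) \<Longrightarrow> (e, k) \<in> set G"
  by (induction G e0 rule: tri.induct) auto

lemma tri_snd: "(e, k, e') \<in> set (tri G e0) \<Longrightarrow> e' = e0 \<or> (\<exists>k'. (e', k') \<in> set G)"
proof (induction G e0 rule: tri.induct)
  case (2 e1 k1 G e0)
  then show ?case by (cases G) auto
qed simp

lemma tri_ex: "(e, k) \<in> set G \<Longrightarrow> \<exists>e'. (e, k, e') \<in> set (tri G e0)"
  by (induction G e0 rule: tri.induct) auto

lemma gap_word_head: "\<exists>r. gap_word G @ [(Gen_a, e0)] = (Gen_a, fsign G e0) # r"
  by (cases G) auto

lemma closed_gap_word: "G \<noteq> [] \<Longrightarrow> closed (gap_word G) = gap_word G @ [(Gen_a, fsign G True)]"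
  by (cases G) (auto simp: closed_def)

lemma turns_gap_word: "turns (gap_word G @ [(Gen_a, e0)]) = concat (map gturns (tri G e0))"
proof (induction G e0 rule: tri.induct)
  case (2 e k G e0)
  obtain r where r: "gap_word G @ [(Gen_a, e0)] = (Gen_a, fsign G e0) # r" using gap_word_head by blast
  have rep: "turns (replicate (Suc n) (Gen_b, s) @ (Gen_a, e') # r) = (s = e') # turns ((Gen_a, e') # r)"
    for n s e' by (induction n) auto
  have "turns ((Gen_a, e) # bpow k @ (Gen_a, e') # r) = gturns (e, k, e') @ turns ((Gen_a, e') # r)" for e'
  proof (cases "k = 0")
    case False
    then obtain n where n: "bpow k = replicate (Suc n) (Gen_b, 0 < k)"
      unfolding bpow_def by (metis not0_implies_Suc nat_0_iff abs_le_zero_iff)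
    have "turns ((Gen_a, e) # bpow k @ (Gen_a, e') # r) = ((0 < k) = e) # turns (bpow k @ (Gen_a, e') # r)"
      unfolding n by auto
    then show ?thesis using False rep[of n "0 < k" e'] unfolding n by simp
  qed (simp add: bpow_def)
  then show ?case using 2 r by simp
qed simp

lemma cturns_gap_word: "G \<noteq> [] \<Longrightarrow> cturns (gap_word G) = concat (map gturns (ctri G))"
  by (simp add: cturns_def closed_gap_word turns_gap_word)

lemma length_filter_concat:
  "length (filter P (concat (map h zs))) = (\<Sum>z\<leftarrow>zs. length (filter P (h z)))"
  by (induction zs) auto

lemma bad_gap_word: "G \<noteq> [] \<Longrightarrow> bad (gap_word G) = (\<Sum>z\<leftarrow>ctri G. length (filter Not (gturns z)))"
  by (simp add: bad_def cturns_gap_word length_filter_concat)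

definition gap_reduced :: "(bool \<times> int) list \<Rightarrow> bool" where
  "gap_reduced G \<longleftrightarrow> G \<noteq> [] \<and> (\<forall>(e, k, e')\<in>set (ctri G). k = 0 \<longrightarrow> e = e')"

lemma reduced_gap_word: "reduced (gap_word G @ [(Gen_a, e0)]) \<longleftrightarrow> (\<forall>(e, k, e')\<in>set (tri G e0). k = 0 \<longrightarrow> e = e')"
proof (induction G e0 rule: tri.induct)
  case (2 e k G e0)
  obtain r where r: "gap_word G @ [(Gen_a, e0)] = (Gen_a, fsign G e0) # r" using gap_word_head by blast
  have rep: "reduced (replicate (Suc n) (Gen_b, s) @ (Gen_a, e') # r) \<longleftrightarrow> reduced ((Gen_a, e') # r)"
    for n s e' by (induction n) (auto simp: reduced_def)
  have "reduced ((Gen_a, e) # bpow k @ (Gen_a, e') # r) \<longleftrightarrow>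
    (k = 0 \<longrightarrow> e = e') \<and> reduced ((Gen_a, e') # r)" for e'
  proof (cases "k = 0")
    case False
    then obtain n where n: "bpow k = replicate (Suc n) (Gen_b, 0 < k)"
      unfolding bpow_def by (metis not0_implies_Suc nat_0_iff abs_le_zero_iff)
    have "reduced ((Gen_a, e) # bpow k @ (Gen_a, e') # r) \<longleftrightarrow> reduced (bpow k @ (Gen_a, e') # r)"
      unfolding n by (simp add: reduced_def)
    then show ?thesis using False rep[of n "0 < k" e'] unfolding n by simp
  qed (auto simp: bpow_def reduced_def)
  then show ?case using 2 r by simp
qed (simp add: reduced_def)

lemma cyc_reduced_gap_word: "gap_reduced G \<Longrightarrow> cyc_reduced (gap_word G)" and cyc_reduced_gap_wordD: "G \<noteq> [] \<Longrightarrow> cyc_reduced (gap_word G) \<Longrightarrow> gap_reduced G"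
proof -
  have "G \<noteq> [] \<Longrightarrow> gap_word G \<noteq> []" by (cases G) auto
  then show "gap_reduced G \<Longrightarrow> cyc_reduced (gap_word G)" "G \<noteq> [] \<Longrightarrow> cyc_reduced (gap_word G) \<Longrightarrow> gap_reduced G"
    by (simp_all add: cyc_reduced_def gap_reduced_def closed_gap_word reduced_gap_word)
qed

lemma gap_reduced_cshift: "gap_reduced G \<Longrightarrow> gap_reduced (cshift_gaps G)"
  unfolding gap_reduced_def by (auto simp: tri_shift shift_def split: if_splits)

lemma reduced_parse: "reduced v \<Longrightarrow> \<exists>k G. v = bpow k @ gap_word G"
proof (induction v)
  case Nil
  show ?case by (intro exI[of _ 0] exI[of _ "[]"]) (simp add: bpow_def)
next
  case (Cons x v)
  then obtain k G where v: "v = bpow k @ gap_word G" by (auto dest: reduced_tl)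
  obtain g s where x: "x = (g, s)" by (cases x)
  show ?case
  proof (cases g)
    case Gen_a
    then show ?thesis using v x by (intro exI[of _ 0] exI[of _ "(s, k) # G"]) (simp add: bpow_def)
  next
    case Gen_b
    define k' where "k' = (if s then k + 1 else k - 1)"
    have "k = 0 \<or> (0 < k) = s"
    proof (rule ccontr)
      assume *: "\<not> ?thesis"
      then obtain n where "bpow k = replicate (Suc n) (Gen_b, 0 < k)"
        unfolding bpow_def by (metis not0_implies_Suc nat_0_iff abs_le_zero_iff)
      then show False using Cons.prems * v x Gen_b by (auto simp: reduced_def)
    qed
    then have "nat \<bar>k'\<bar> = Suc (nat \<bar>k\<bar>)" "(0 < k') = s" "k \<noteq> 0 \<longrightarrow> (0 < k) = s"
      by (auto simp: k'_def)
    then have "bpow k' = x # bpow k" using x Gen_b by (cases "k = 0") (auto simp: bpow_def)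
    then show ?thesis using v by (intro exI[of _ k'] exI[of _ G]) simp
  qed
qed

definition gaps :: "word \<Rightarrow> (bool \<times> int) list \<Rightarrow> bool" where
  "gaps w G \<longleftrightarrow> gap_reduced G \<and> (\<exists>n. gap_word G = rotate n w)"

lemma gaps_gap_word: "gap_reduced G \<Longrightarrow> gaps (gap_word G) G"
  unfolding gaps_def by (metis rotate0 id_apply)

lemma gaps_exist:
  assumes "cyc_reduced w" "(Gen_a, s) \<in> set w"
  shows "\<exists>G. gaps w G"
proof -
  from assms(2) obtain u v where w: "w = u @ (Gen_a, s) # v" by (auto simp: in_set_conv_decomp)
  let ?w = "rotate (length u) w"
  have rot: "?w = (Gen_a, s) # v @ u" by (simp add: w rotate_append)
  have c: "cyc_reduced ?w" using assms(1) by simp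
  then have "reduced ?w" by (auto simp: cyc_reduced_def closed_def reduced_def successively_append_iff)
  then obtain k G where kG: "?w = bpow k @ gap_word G" using reduced_parse by blast
  have "k = 0"
  proof (rule ccontr)
    assume "k \<noteq> 0"
    then obtain n where "bpow k = replicate (Suc n) (Gen_b, 0 < k)"
      unfolding bpow_def by (metis not0_implies_Suc nat_0_iff abs_le_zero_iff)
    then show False using kG rot by simp
  qed
  then have "?w = gap_word G" using kG by (simp add: bpow_def)
  then show ?thesis
    using c cyc_reduced_gap_wordD[of G] rot unfolding gaps_def by (metis list.distinct(1) gap_word_simps(1))
qed

lemma gaps_facts:
  assumes "gaps w G"
  shows "cyc_reduced w" "length (gap_word G) = length w" "set (gap_word G) = set w" "bad (gap_word G) = bad w"
    "dead (cturns (gap_word G)) \<longleftrightarrow> dead (cturns w)" "w \<frown> gap_word G"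
    "successively P (closed (gap_word G)) \<longleftrightarrow> successively P (closed w)"
  using assms cyc_reduced_gap_word[of G] cnj_rotate_word successively_closed_rotate
  by (auto simp: gaps_def)

text \<open>A bad turn lies between two different generators. Hence both occur, and the cyclic word
  can be cut open at an a as well as at a b.\<close>

lemma bad_letters:
  assumes "0 < bad w" "cyc_reduced w"
  shows "\<exists>G. gaps w G" "\<exists>H. gaps (swap w) H"
proof -
  have "False \<in> set (turns v) \<Longrightarrow> \<exists>s t. (Gen_a, s) \<in> set v \<and> (Gen_b, t) \<in> set v" for v
  proof (induction v rule: turns.induct)
    case (1 x y v)
    then show ?case by (cases x rule: letter_cases; cases y rule: letter_cases) auto
  qed auto
  moreover have "False \<in> set (turns (closed w))"
    using assms(1) by (auto simp: bad_def cturns_def filter_empty_conv)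
  moreover have "set (closed w) = set w" using assms(2) by (auto simp: closed_def cyc_reduced_def)
  ultimately obtain s t where "(Gen_a, s) \<in> set w" "(Gen_b, t) \<in> set w" by metis
  then show "\<exists>G. gaps w G" "\<exists>H. gaps (swap w) H"
    using assms(2) gaps_exist[of w s] gaps_exist[of "swap w" t] by (auto simp: swap_in_iff)
qed

subsection \<open>The action of \<open>alpha\<close>\<close>

lemma bpow_add1: "lb # bpow k \<doteq> bpow (k + 1)"
proof (cases "0 \<le> k")
  case True
  then have "nat (k + 1) = Suc (nat k)" by simp
  with True show ?thesis by (cases "k = 0") (auto simp: bpow_def)
next
  case False
  then have "nat \<bar>k\<bar> = Suc (nat \<bar>k + 1\<bar>)" by simp
  then have "bpow k = lB # bpow (k + 1)" using False by (cases "k + 1 = 0") (auto simp: bpow_def)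
  then show ?thesis using winv_cancel(2)[of "[]" "[lb]" "bpow (k + 1)"] by simp
qed

lemma bpow_diff1: "bpow k @ [lB] \<doteq> bpow (k - 1)"
proof (cases "0 < k")
  case False
  then have "nat \<bar>k - 1\<bar> = Suc (nat \<bar>k\<bar>)" by simp
  then have "bpow (k - 1) = bpow k @ [lB]"
    using False by (cases "k = 0") (auto simp: bpow_def replicate_append_same)
  then show ?thesis by simp
next
  case True
  then have "nat \<bar>k\<bar> = Suc (nat \<bar>k - 1\<bar>)" by simp
  then have "bpow k = bpow (k - 1) @ [lb]"
    using True by (cases "k - 1 = 0") (auto simp: bpow_def replicate_append_same)
  then show ?thesis using winv_cancel(2)[of "bpow (k - 1)" "[lb]" "[]"] by simp
qed

lemma alpha_bpow: "alpha (bpow k) = bpow k"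
proof -
  have "alpha (replicate n (Gen_b, s)) = replicate n (Gen_b, s)" for n s
    by (induction n) (cases s; simp)+
  then show ?thesis by (simp add: bpow_def)
qed

text \<open>\<open>pre\<close> is the letter b^-1 which \<open>alpha\<close> creates in front of
  a^-1 and which belongs to the preceding gap. Handing it leftwards through the list leaves one such
  letter at either end; for a cyclic word they are equal and amount to a conjugation.\<close>

lemma alpha_gap_word:
  defines "pre \<equiv> \<lambda>e. if e then [] else [lB]"
  shows "alpha (gap_word G) @ pre e0 \<doteq> pre (fsign G e0) @ gap_word (shift_gaps G e0)"
proof (induction G e0 rule: tri.induct)
  case (2 e k G e0)
  let ?e' = "fsign G e0"
  have shift: "(if e then [lb] else []) @ bpow k @ pre ?e' \<doteq> bpow (k + shift e ?e')"
  proof -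
    have "(if e then [lb] else []) @ bpow k \<doteq> bpow (if e then k + 1 else k)"
      using bpow_add1[of k] by simp
    from weq_append[OF this weq_refl, of "pre ?e'"]
    have "(if e then [lb] else []) @ bpow k @ pre ?e' \<doteq> bpow (if e then k + 1 else k) @ pre ?e'" by simp
    also have "\<dots> \<doteq> bpow (k + shift e ?e')"
      using bpow_diff1[of "if e then k + 1 else k"] by (auto simp: pre_def shift_def)
    finally show ?thesis .
  qed
  have "alpha (gap_word ((e, k) # G)) @ pre e0 = 
    pre e @ [(Gen_a, e)] @ ((if e then [lb] else []) @ bpow k) @ (alpha (gap_word G) @ pre e0)"
    by (cases e) (simp_all add: alpha_bpow pre_def)
  also have "\<dots> \<doteq> pre e @ [(Gen_a, e)] @ ((if e then [lb] else []) @ bpow k) @ (pre ?e' @ gap_word (shift_gaps G e0))"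
    by (intro weq_append weq_refl 2)
  also have "\<dots> = pre e @ [(Gen_a, e)] @ ((if e then [lb] else []) @ bpow k @ pre ?e') @ gap_word (shift_gaps G e0)"
    by simp
  also have "\<dots> \<doteq> pre e @ [(Gen_a, e)] @ bpow (k + shift e ?e') @ gap_word (shift_gaps G e0)"
    by (intro weq_append weq_refl shift)
  finally show ?case by simp
qed simp

lemma gaps_alpha:
  assumes "gaps w G"
  shows "alpha w \<frown> gap_word (cshift_gaps G)"
proof -
  define p where "p = (if fsign G True then [] else [lB])"
  have fs: "fsign G (fsign G True) = fsign G True" by (cases G) auto
  have conj: "alpha (gap_word G) @ p \<doteq> p @ gap_word (cshift_gaps G)"
    using alpha_gap_word[of G "fsign G True"] by (simp only: fs p_def)
  have "alpha w \<frown> alpha (gap_word G)" using gaps_facts(6)[OF assms] by (rule cnj_extend)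
  also have "alpha (gap_word G) \<doteq> alpha (gap_word G) @ p @ winv p"
    using weq_sym[OF winv_cancel(2)[of "alpha (gap_word G)" p "[]"]] by simp
  also have "\<dots> \<doteq> (p @ gap_word (cshift_gaps G)) @ winv p"
    using weq_append[OF conj weq_refl, of "winv p"] by simp
  finally show ?thesis using cnj_trans cnjI[OF weq_refl] by fastforce
qed

lemma length_gap_word_alg: "length (gap_word (shift_gaps G e0)) \<le> 2 * length (gap_word G)"
proof -
  have "length (gap_word (shift_gaps G e0)) \<le> length (gap_word G) + length G"
  proof (induction G e0 rule: tri.induct)
    case (2 e k G e0)
    have "nat \<bar>k + shift e (fsign G e0)\<bar> \<le> Suc (nat \<bar>k\<bar>)" by (auto simp: shift_def)
    with 2 show ?case by (simp add: bpow_def)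
  qed simp
  moreover have "length G \<le> length (gap_word G)"
  proof (induction G)
    case (Cons g G)
    then show ?case by (cases g) simp
  qed simp
  ultimately show ?thesis by simp
qed

text \<open>Between opposite signs the gap is unchanged. Between equal signs it moves towards that
  sign: a wrong exponent keeps its two bad turns or vanishes with them, and a gap that was empty or
  right shows two good turns afterwards.\<close>

lemma gturns_upd_le: "length (filter Not (gturns (shift_tri z))) \<le> length (filter Not (gturns z))"
  if "\<And>e k e'. z = (e, k, e') \<Longrightarrow> k = 0 \<Longrightarrow> e = e'"
  using that by (cases z) (auto simp: shift_def split: if_splits)

lemma bad_cshift_le: "gap_reduced G \<Longrightarrow> bad (gap_word (cshift_gaps G)) \<le> bad (gap_word G)"
  unfolding gap_reduced_def by (auto simp: bad_gap_word tri_shift comp_def intro!: sum_list_mono gturns_upd_le)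

lemma sum_list_eq_pointwise:
  fixes f g :: "'a \<Rightarrow> nat"
  assumes "\<And>x. x \<in> set xs \<Longrightarrow> f x \<le> g x" "sum_list (map f xs) = sum_list (map g xs)" "x \<in> set xs"
  shows "f x = g x"
  using assms
proof (induction xs)
  case (Cons y xs)
  have "sum_list (map f xs) \<le> sum_list (map g xs)" "f y \<le> g y"
    using Cons.prems(1) by (auto intro: sum_list_mono)
  then have "f y = g y" "sum_list (map f xs) = sum_list (map g xs)" using Cons.prems(2) by auto
  then show ?case using Cons by auto
qed simp

text \<open>A gap between equal signs becomes empty only from exponent -1 relative to that sign, and
  this loses two bad turns. A gap between opposite signs is nonzero and stays put.\<close>

lemma bad_cshift_eq:
  assumes "gap_reduced G" "bad (gap_word (cshift_gaps G)) = bad (gap_word G)" "(e, k, e') \<in> set (ctri G)"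
  shows "k + shift e e' \<noteq> 0"
proof -
  have "length (filter Not (gturns (shift_tri (e, k, e')))) = length (filter Not (gturns (e, k, e')))"
  proof (rule sum_list_eq_pointwise[OF _ _ assms(3)])
    show "(\<Sum>z\<leftarrow>ctri G. length (filter Not (gturns (shift_tri z)))) = (\<Sum>z\<leftarrow>ctri G. length (filter Not (gturns z)))"
      using assms(1,2) by (simp add: bad_gap_word tri_shift comp_def gap_reduced_def)
  qed (use assms(1) in \<open>auto simp: gap_reduced_def intro!: gturns_upd_le\<close>)
  moreover have "k = 0 \<longrightarrow> e = e'" using assms(1,3) by (auto simp: gap_reduced_def)
  ultimately show ?thesis by (cases e; cases e') (auto simp: shift_def split: if_splits)
qed

text \<open>Transfers information between the gap lists of a word and of its swap: nonzero gaps
  isolate the letters a, and isolated letters b make all gaps 1, 0 or -1.\<close>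

definition adjfree :: "gen \<Rightarrow> word \<Rightarrow> bool" where
  "adjfree g w \<longleftrightarrow> successively (\<lambda>x y. \<not> (fst x = g \<and> fst y = g)) (closed w)"

lemma adjfree_swap: "w \<noteq> [] \<Longrightarrow> adjfree Gen_a (swap w) \<longleftrightarrow> adjfree Gen_b w"
proof -
  assume "w \<noteq> []"
  have "fst (hd (swap [x])) = Gen_a \<longleftrightarrow> fst x = Gen_b" for x by (cases x rule: letter_cases) auto
  then show ?thesis unfolding adjfree_def closed_swap[OF \<open>w \<noteq> []\<close>] successively_swap by simp
qed

lemma adjfree_gap_word:
  assumes "G \<noteq> []" "\<And>e k e'. (e, k, e') \<in> set (ctri G) \<Longrightarrow> k \<noteq> 0"
  shows "adjfree Gen_a (gap_word G)"
proof -
  let ?P = "\<lambda>x y. \<not> (fst x = Gen_a \<and> fst y = Gen_a)"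
  have "(\<forall>(e, k, e')\<in>set (tri G e0). k \<noteq> 0) \<Longrightarrow> successively ?P (gap_word G @ [(Gen_a, e0)])" for e0
  proof (induction G e0 rule: tri.induct)
    case (2 e k G e0)
    obtain r where r: "gap_word G @ [(Gen_a, e0)] = (Gen_a, fsign G e0) # r" using gap_word_head by blast
    obtain n where n: "bpow k = replicate (Suc n) (Gen_b, 0 < k)"
      using 2(2) unfolding bpow_def by (simp add: gr0_conv_Suc) (metis zero_less_abs_iff zero_less_nat_eq gr0_implies_Suc replicate_Suc)
    have rep: "successively ?P (replicate (Suc n) (Gen_b, s) @ (Gen_a, e') # r) \<longleftrightarrow> successively ?P ((Gen_a, e') # r)"
      for n s e' by (induction n) auto
    have "successively ?P ((Gen_a, e) # bpow k @ (Gen_a, e') # r) \<longleftrightarrow> successively ?P ((Gen_a, e') # r)" for e'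
      using rep[of n "0 < k" e'] unfolding n by simp
    then show ?case using 2 r by auto
  qed simp
  then show ?thesis using assms unfolding adjfree_def closed_gap_word[OF assms(1)] by auto
qed

lemma adjfree_small:
  assumes "G \<noteq> []" "adjfree Gen_b (gap_word G)" "(e, k) \<in> set G"
  shows "\<bar>k\<bar> \<le> 1"
proof -
  let ?P = "\<lambda>x y. \<not> (fst x = Gen_b \<and> fst y = Gen_b)"
  have "successively ?P (gap_word G @ r) \<Longrightarrow> \<forall>(e, k)\<in>set G. \<bar>k\<bar> \<le> 1" for r
  proof (induction G)
    case (Cons g G)
    obtain e k where g: "g = (e, k)" by (cases g)
    have "successively ?P (bpow k)" "successively ?P (gap_word G @ r)"
      using Cons.prems g by (auto simp: successively_append_iff successively_Cons)
    moreover have "\<bar>k\<bar> \<le> 1"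
    proof (rule ccontr)
      assume "\<not> \<bar>k\<bar> \<le> 1"
      then have "nat \<bar>k\<bar> = Suc (Suc (nat (\<bar>k\<bar> - 2)))" by simp
      then show False using calculation(1) by (simp add: bpow_def)
    qed
    ultimately show ?case using Cons.IH g by simp
  qed simp
  then show ?thesis using assms unfolding adjfree_def closed_gap_word[OF assms(1)] by blast
qed

lemma gaps_adjfree: "gaps w G \<Longrightarrow> adjfree g (gap_word G) \<longleftrightarrow> adjfree g w"
  unfolding adjfree_def by (rule gaps_facts(7))

subsection \<open>An obstruction\<close>

text \<open>Turns come in blocks of none or two, one block per gap; a cut through the list of turns
  falls between two blocks or into the middle of one.\<close>

lemma concat_split [consumes 2]:
  assumes "concat (map h zs) = u @ v" "\<forall>z\<in>set zs. h z = [] \<or> (\<exists>p q. h z = [p, q])"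
  obtains (aligned) zs1 zs2 where "zs = zs1 @ zs2" "u = concat (map h zs1)" "v = concat (map h zs2)"
    | (inside) zs1 z zs2 p q where "zs = zs1 @ z # zs2" "h z = [p, q]"
      "u = concat (map h zs1) @ [p]" "v = q # concat (map h zs2)"
proof -
  have "(\<exists>zs1 zs2. zs = zs1 @ zs2 \<and> u = concat (map h zs1) \<and> v = concat (map h zs2)) \<or>
    (\<exists>zs1 z zs2 p q. zs = zs1 @ z # zs2 \<and> h z = [p, q] \<and> u = concat (map h zs1) @ [p] \<and>
      v = q # concat (map h zs2))"
    using assms
  proof (induction zs arbitrary: u)
    case Nil
    then show ?case by auto
  next
    case (Cons z zs)
    have "\<forall>z\<in>set zs. h z = [] \<or> (\<exists>p q. h z = [p, q])" using Cons.prems(2) by simp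
    note IH = Cons.IH[OF _ this]
    have lift: ?case if "\<exists>u'. u = h z @ u' \<and> concat (map h zs) = u' @ v"
    proof -
      from that obtain u' where u': "u = h z @ u'" "concat (map h zs) = u' @ v" by blast
      from IH[OF u'(2)] show ?thesis
      proof
        assume "\<exists>zs1 zs2. zs = zs1 @ zs2 \<and> u' = concat (map h zs1) \<and> v = concat (map h zs2)"
        then obtain zs1 zs2 where "zs = zs1 @ zs2" "u' = concat (map h zs1)" "v = concat (map h zs2)" by blast
        then show ?thesis using u' by (intro disjI1 exI[of _ "z # zs1"] exI[of _ zs2]) simp
      next
        assume "\<exists>zs1 y zs2 p q. zs = zs1 @ y # zs2 \<and> h y = [p, q] \<and> u' = concat (map h zs1) @ [p] \<and>
          v = q # concat (map h zs2)"
        then obtain zs1 y zs2 p q where "zs = zs1 @ y # zs2" "h y = [p, q]" "u' = concat (map h zs1) @ [p]"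
          "v = q # concat (map h zs2)" by blast
        then show ?thesis using u'
          by (intro disjI2 exI[of _ "z # zs1"] exI[of _ y] exI[of _ zs2] exI[of _ p] exI[of _ q]) simp
      qed
    qed
    show ?case
    proof (cases "h z = []")
      case True
      then show ?thesis using Cons.prems(1) by (intro lift) auto
    next
      case False
      then obtain p q where pq: "h z = [p, q]" using Cons.prems(2) by auto
      then have eq: "p # q # concat (map h zs) = u @ v" using Cons.prems(1) by simp
      consider "u = []" | "u = [p]" | u' where "u = p # q # u'"
        using eq by (cases u; cases "tl u") auto
      then show ?thesis
      proof cases
        case 1
        then show ?thesis using Cons.prems(1) by (intro disjI1 exI[of _ "[]"] exI[of _ "z # zs"]) simp
      next
        case 2
        then show ?thesis using eq pq
          by (intro disjI2 exI[of _ "[]"] exI[of _ z] exI[of _ zs] exI[of _ p] exI[of _ q]) simp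
      next
        case 3
        then show ?thesis using eq pq by (intro lift) simp
      qed
    qed
  qed
  then show thesis using aligned inside by blast
qed

text \<open>A block that meets the pattern good, bad, good always contains a good turn and is
  therefore kept. Blocks newly inserted inside the pattern consist of good turns only, so the bad
  turn still has good neighbours. The blocks that may change or vanish are those of two bad turns,
  which cannot meet the pattern.\<close>

lemma dead_transform:
  fixes h h' :: "'z \<Rightarrow> bool list"
  assumes h: "\<And>z. z \<in> set zs \<Longrightarrow> h z = [] \<and> h' z = [True, True] \<or>
      (\<exists>p q. h z = [p, q] \<and> (p \<or> q \<longrightarrow> h' z = [p, q]))"
    and dead: "dead (concat (map h zs))"
  shows "dead (concat (map h' zs))"
proof -
  define ok where "ok zs \<longleftrightarrow> (\<forall>z\<in>set zs. h z = [] \<and> h' z = [True, True] \<or>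
      (\<exists>p q. h z = [p, q] \<and> (p \<or> q \<longrightarrow> h' z = [p, q])))" for zs
  have ok_append: "ok (xs @ ys) \<longleftrightarrow> ok xs \<and> ok ys" for xs ys by (auto simp: ok_def)
  have "ok zs" using h by (auto simp: ok_def)
  have lead1: "\<exists>r'. concat (map h' ys) = True # r'" if "ok ys" "concat (map h ys) = True # r" for ys r
    using that by (induction ys) (auto simp: ok_def)
  have lead: "\<exists>x y. concat (map h' ys) = x @ [True, False, True] @ y"
    if "ok ys" "concat (map h ys) = True # False # True # r" for ys r
    using that
  proof (induction ys)
    case (Cons z ys)
    show ?case
    proof (cases "h z = []")
      case True
      then obtain x y where "concat (map h' ys) = x @ [True, False, True] @ y" 
        using Cons by (auto simp: ok_def)
      then show ?thesis by (intro exI[of _ "h' z @ x"] exI[of _ y]) simp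
    next
      case False
      then have hz: "h z = [True, False]" "h' z = [True, False]" "concat (map h ys) = True # r"
        using Cons.prems by (auto simp: ok_def)
      moreover have "ok ys" using Cons.prems(1) by (simp add: ok_def)
      ultimately obtain r' where "concat (map h' ys) = True # r'" using lead1 by blast
      then show ?thesis using hz by (intro exI[of _ "[]"] exI[of _ r']) simp
    qed
  qed simp
  have lead2: "\<exists>x y. True # concat (map h' ys) = x @ [True, False, True] @ y"
    if "ok ys" "concat (map h ys) @ [p] = False # True # r" for ys p r
    using that
  proof (induction ys)
    case (Cons z ys)
    show ?case
    proof (cases "h z = []")
      case True
      then obtain x y where xy: "True # concat (map h' ys) = x @ [True, False, True] @ y" 
        using Cons by (auto simp: ok_def)
      moreover have "h' z = [True, True]" using True Cons.prems(1) by (auto simp: ok_def)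
      ultimately show ?thesis by (intro exI[of _ "[True, True] @ x"] exI[of _ y]) simp
    next
      case False
      then have "h z = [False, True]" "h' z = [False, True]" using Cons.prems by (auto simp: ok_def)
      then show ?thesis by (intro exI[of _ "[]"] exI[of _ "concat (map h' ys)"]) simp
    qed
  qed simp
  from dead obtain n x y where "rotate n (concat (map h zs)) = x @ [True, False, True] @ y"
    by (auto simp: dead_def)
  then have rot: "rotate (length x + n) (concat (map h zs)) = [True, False, True] @ y @ x"
    by (simp only: rotate_rotate[symmetric] rotate_append) simp
  define m where "m = (length x + n) mod length (concat (map h zs))"
  define u v where "u = take m (concat (map h zs))" and "v = drop m (concat (map h zs))"
  have vu: "v @ u = True # False # True # y @ x"
    using rot by (simp add: rotate_drop_take u_def v_def m_def)
  have "concat (map h zs) = u @ v" by (simp add: u_def v_def)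
  moreover have "\<forall>z\<in>set zs. h z = [] \<or> (\<exists>p q. h z = [p, q])" using h by blast
  ultimately show ?thesis
  \<comment> \<open>The rotation that brings the pattern to the front may split one block, whose
    halves then stand at the two ends of the rotated list.\<close>
  proof (cases rule: concat_split)
    case (aligned zs1 zs2)
    then obtain x y where "concat (map h' (zs2 @ zs1)) = x @ [True, False, True] @ y"
      using lead[of "zs2 @ zs1"] vu \<open>ok zs\<close> by (auto simp: ok_append)
    then have "dead (concat (map h' (zs2 @ zs1)))" by (rule deadI)
    then show ?thesis using aligned dead_append by simp
  next
    case (inside zs1 z zs2 p q)
    then have "q" "concat (map h (zs2 @ zs1)) @ [p] = False # True # y @ x" using vu by auto
    moreover have "ok (zs2 @ zs1)" "h' z = [p, True]"
      using \<open>ok zs\<close> inside \<open>q\<close> by (auto simp: ok_def)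
    ultimately obtain x y where "True # concat (map h' (zs2 @ zs1)) = x @ [True, False, True] @ y"
      using lead2 by blast
    then have "concat (map h' (z # zs2 @ zs1)) = (p # x) @ [True, False, True] @ y"
      using \<open>h' z = [p, True]\<close> by simp
    then have "dead (concat (map h' (z # zs2 @ zs1)))" by (rule deadI)
    then have "dead (concat (map h' (z # zs2)) @ concat (map h' zs1))" by simp
    then show ?thesis
      using inside dead_append[of "concat (map h' (z # zs2))" "concat (map h' zs1)"] by simp
  qed
qed

text \<open>A lone bad turn, i.e. one between two good turns, survives both \<open>alpha\<close> and \<open>beta\<close>: it belongs to
  a subword such as \<open>a b\<^sup>k a\<^sup>-\<^sup>j b\<^sup>-\<^sup>1\<close>, whose image under \<open>alpha beta\<close> contains the
  commutator of the basis.\<close>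

lemma dead_cshift:
  assumes "gap_reduced G" "dead (cturns (gap_word G))"
  shows "dead (cturns (gap_word (cshift_gaps G)))"
proof -
  have G: "G \<noteq> []" using assms(1) by (simp add: gap_reduced_def)
  have "dead (concat (map (\<lambda>z. gturns (shift_tri z)) (ctri G)))"
  proof (rule dead_transform)
    show "dead (concat (map gturns (ctri G)))" using assms(2) cturns_gap_word[OF G] by simp
    fix z assume "z \<in> set (ctri G)"
    moreover obtain e k e' where "z = (e, k, e')" by (cases z)
    ultimately show "gturns z = [] \<and> gturns (shift_tri z) = [True, True] \<or>
      (\<exists>p q. gturns z = [p, q] \<and> (p \<or> q \<longrightarrow> gturns (shift_tri z) = [p, q]))"
      using assms(1) unfolding gap_reduced_def by (cases e; cases e') (auto simp: shift_def)
  qed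
  then show ?thesis using G by (simp add: cturns_gap_word tri_shift comp_def)
qed

lemma step_alpha:
  assumes "gaps w G"
  shows "alpha w \<frown> gap_word (cshift_gaps G)" "gaps (gap_word (cshift_gaps G)) (cshift_gaps G)" "cyc_reduced (gap_word (cshift_gaps G))"
    "length (gap_word (cshift_gaps G)) \<le> 2 * length w" "bad (gap_word (cshift_gaps G)) \<le> bad w"
    "dead (cturns w) \<Longrightarrow> dead (cturns (gap_word (cshift_gaps G)))"
proof -
  have G: "gap_reduced G" using assms by (simp add: gaps_def)
  show "alpha w \<frown> gap_word (cshift_gaps G)" by (rule gaps_alpha[OF assms])
  show "gaps (gap_word (cshift_gaps G)) (cshift_gaps G)" "cyc_reduced (gap_word (cshift_gaps G))"
    using gaps_gap_word cyc_reduced_gap_word gap_reduced_cshift[OF G] by auto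
  show "length (gap_word (cshift_gaps G)) \<le> 2 * length w"
    using length_gap_word_alg[of G] gaps_facts(2)[OF assms] by simp
  show "bad (gap_word (cshift_gaps G)) \<le> bad w" using bad_cshift_le[OF G] gaps_facts(4)[OF assms] by simp
  show "dead (cturns w) \<Longrightarrow> dead (cturns (gap_word (cshift_gaps G)))"
    using dead_cshift[OF G] gaps_facts(5)[OF assms] by simp
qed

lemma beta_swap: "beta w = swap (alpha (swap w))"
  by (simp add: extend_extend)

lemma step_beta:
  assumes "gaps (swap w) H"
  shows "beta w \<frown> swap (gap_word (cshift_gaps H))" "cyc_reduced (swap (gap_word (cshift_gaps H)))"
    "length (swap (gap_word (cshift_gaps H))) \<le> 2 * length w" "bad (swap (gap_word (cshift_gaps H))) \<le> bad w"
    "dead (cturns w) \<Longrightarrow> dead (cturns (swap (gap_word (cshift_gaps H))))"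
  using step_alpha[OF assms] cnj_extend by (auto simp: beta_swap simp del: extend_extend)

lemma dead_not_good: "cyc_reduced w \<Longrightarrow> dead (cturns w) \<Longrightarrow> \<not> good (path_map p w)"
proof (induction p arbitrary: w)
  case Nil
  then show ?case using good_no_bad dead_bad by fastforce
next
  case (Cons s p)
  obtain G H where G: "gaps w G" and H: "gaps (swap w) H"
    using bad_letters[OF dead_bad[OF Cons.prems(2)] Cons.prems(1)] by blast
  have "\<not> good (path_map p (gap_word (cshift_gaps G)))" "\<not> good (path_map p (swap (gap_word (cshift_gaps H))))"
    using Cons step_alpha[OF G] step_beta[OF H] by blast+
  then show ?case
    using good_cnj[OF cnj_path_map[OF step_alpha(1)[OF G]]] good_cnj[OF cnj_path_map[OF step_beta(1)[OF H]]] by simp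
qed

subsection \<open>Bounding the search\<close>

text \<open>Exponents between like-signed a's are measured relative to that sign. One
  \<open>alpha\<close> raises each of them by one, so the level bounds the number of applications of
  \<open>alpha\<close> after which all are positive.\<close>

definition level :: "nat \<Rightarrow> (bool \<times> int) list \<Rightarrow> bool" where
  "level n G \<longleftrightarrow> (\<forall>(e, k, e')\<in>set (ctri G). e = e' \<longrightarrow> - int n < (if e then k else - k))"

lemma level_cshift:
  assumes "G \<noteq> []"
  shows "level (Suc n) G \<Longrightarrow> level n (cshift_gaps G)" "level 0 G \<Longrightarrow> level 0 (cshift_gaps G)"
  using assms unfolding level_def by (fastforce simp: tri_shift shift_def split: if_splits)+

lemma level_length: "length (gap_word G) \<le> n \<Longrightarrow> level n G"
proof -
  have "\<forall>(e, k)\<in>set G. \<bar>k\<bar> < int (length (gap_word G))"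
  proof (induction G)
    case (Cons g G)
    then show ?case by (cases g) (auto simp: bpow_def)
  qed simp
  then show "length (gap_word G) \<le> n \<Longrightarrow> level n G"
    unfolding level_def by (fastforce dest: tri_fst)
qed

text \<open>At level 0 all exponents between like-signed \<open>a\<close>'s have that sign. If the word is not dead then
  only one sign of \<open>b\<close> occurs, and its powers of \<open>a\<close> have exponents at least -1 relative to it.\<close>

lemma level_0_good:
  assumes w: "gaps w G" and lv: "level 0 G" and nd: "\<not> dead (cturns w)"
  shows "good (beta w)"
proof -
  have G: "gap_reduced G" "G \<noteq> []" using w by (simp_all add: gaps_def gap_reduced_def)
  have nz: "k \<noteq> 0" if "(e, k, e') \<in> set (ctri G)" for e k e'
    using that lv G by (fastforce simp: level_def gap_reduced_def split: if_splits)
  have nz': "k \<noteq> 0" if "(e, k) \<in> set G" for e k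
    using tri_ex[OF that] nz by blast
  have like: "(0 < k) = e" if "(e, k, e) \<in> set (ctri G)" for e k
    using that lv by (fastforce simp: level_def split: if_splits)
  \<comment> \<open>If adjacent gaps differed in sign, the a between them would agree with just one,
    giving one good and one bad turn there. The gap on the bad side cannot lie between equal signs
    at level 0, so its other turn is good and the bad turn is lone.\<close>
  have same: "(0 < snd g) = (0 < snd g')" if "G = G1 @ g # g' # G2" for G1 g g' G2
  proof (rule ccontr)
    assume neq: "\<not> ?thesis"
    obtain e k e' k' where g: "g = (e, k)" "g' = (e', k')" by (cases g, cases g')
    define e'' where "e'' = fsign G2 (fsign G True)"
    have tri: "ctri G = tri G1 e @ [(e, k, e'), (e', k', e'')] @ tri G2 (fsign G True)"
      by (subst that) (simp add: tri_append g e''_def)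
    have m: "(e, k, e') \<in> set (ctri G)" "(e', k', e'') \<in> set (ctri G)" by (simp_all add: tri)
    have neq': "(0 < k') = (\<not> 0 < k)" using neq unfolding g by simp
    have k0: "k \<noteq> 0" "k' \<noteq> 0" using nz m by blast+
    have "\<exists>x y. gturns (e, k, e') @ gturns (e', k', e'') = x @ [True, False, True] @ y"
    proof (cases "(0 < k) = e'")
      case True
      have "e'' \<noteq> e'"
      proof
        assume "e'' = e'"
        then have "(0 < k') = e'" using like[of e' k'] m(2) by simp
        then show False using True neq' by simp
      qed
      then have "(0 < k') = e''" using True neq' by simp
      then have "gturns (e, k, e') @ gturns (e', k', e'') = [(0 < k) = e] @ [True, False, True] @ []"
        using True neq' k0 by simp
      then show ?thesis by blast
    next
      case False
      have "e \<noteq> e'"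
      proof
        assume "e = e'"
        then have "(0 < k) = e'" using like[of e' k] m(1) by simp
        then show False using False by simp
      qed
      then have "(0 < k) = e" "(0 < k') = e'" using False neq' by simp_all
      then have "gturns (e, k, e') @ gturns (e', k', e'') = [] @ [True, False, True] @ [(0 < k') = e'']"
        using False k0 by simp
      then show ?thesis by blast
    qed
    then obtain x y where "gturns (e, k, e') @ gturns (e', k', e'') = x @ [True, False, True] @ y" by blast
    then have "cturns (gap_word G) = (concat (map gturns (tri G1 e)) @ x) @ [True, False, True] @
      (y @ concat (map gturns (tri G2 (fsign G True))))"
      by (simp only: cturns_gap_word[OF G(2)] tri map_append concat_append list.map concat.simps
          append_Nil2 append_assoc)
    then show False using deadI gaps_facts(5)[OF w] nd by blast
  qed
  have const: "\<forall>g\<in>set F. \<forall>g'\<in>set F. (0 < snd g) = (0 < snd g')"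
    if "\<And>F1 g g' F2. F = F1 @ g # g' # F2 \<Longrightarrow> (0 < snd g) = (0 < snd g')" for F :: "(bool \<times> int) list"
    using that
  proof (induction F)
    case (Cons f F)
    have 1: "\<forall>g\<in>set F. \<forall>g'\<in>set F. (0 < snd g) = (0 < snd g')"
      using Cons.prems[of "f # _"] by (intro Cons.IH) auto
    have 2: "(0 < snd g) = (0 < snd f)" if "g \<in> set F" for g
    proof -
      have "F \<noteq> []" using that by auto
      then have "(0 < snd f) = (0 < snd (hd F))"
        using Cons.prems[of "[]" f "hd F" "tl F"] by simp
      moreover have "hd F \<in> set F" using \<open>F \<noteq> []\<close> by simp
      ultimately show ?thesis using 1 that by blast
    qed
    have "(0 < snd g) = (0 < snd f)" if "g \<in> set (f # F)" for g
      using 2 that by (metis set_ConsD)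
    then show ?case by blast
  qed simp
  obtain e1 k1 where g1: "(e1, k1) \<in> set G" using G(2) by (cases G) auto
  define s where "s = (0 < k1)"
  have sgn: "(0 < k) = s" if "(e, k) \<in> set G" for e k
    using const[of G, OF same] that g1 by (fastforce simp: s_def)
  have gap_word_b: "\<exists>e k. (e, k) \<in> set F \<and> k \<noteq> 0 \<and> t = (0 < k)" if "(Gen_b, t) \<in> set (gap_word F)" for F t
    using that by (fastforce simp: gap_word_def bpow_def split: if_splits)
  have gap_word_b': "(Gen_b, 0 < k) \<in> set (gap_word F)" if "(e, k) \<in> set F" "k \<noteq> 0" for F e k
    using that by (fastforce simp: gap_word_def bpow_def)
  have b_sign: "t = s" if "(Gen_b, t) \<in> set w" for t
    using gap_word_b[of t G] sgn that gaps_facts(3)[OF w] by auto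
  have "(Gen_a, s) \<in> set (swap w)"
    using gap_word_b'[OF g1 nz'[OF g1]] gaps_facts(3)[OF w] by (simp add: swap_in_iff s_def)
  then obtain H where H: "gaps (swap w) H"
    using gaps_exist gaps_facts(1)[OF w] by (metis cyc_reduced_swap)
  have Hn: "gap_reduced H" "H \<noteq> []" using H by (simp_all add: gaps_def gap_reduced_def)
  have e: "e = s" if "(e, k) \<in> set H" for e k
  proof -
    have "(Gen_a, e) \<in> set (gap_word H)" using that by (force simp: gap_word_def)
    then show ?thesis using gaps_facts(3)[OF H] b_sign by (simp add: swap_in_iff)
  qed
  have "w \<noteq> []" using gaps_facts(1)[OF w] by (simp add: cyc_reduced_def)
  \<comment> \<open>All gaps of \<open>G\<close> being nonzero, the letters a are isolated, so the
    gaps of \<open>H\<close> have absolute value at most 1. All signs in \<open>H\<close> equal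
    \<open>s\<close>, hence one step makes every relative exponent at least 0 and leaves no bad
    turn.\<close>
  have "adjfree Gen_a (gap_word G)" by (rule adjfree_gap_word[OF G(2)]) (rule nz)
  then have "adjfree Gen_a w" using gaps_adjfree[OF w] by simp
  then have "adjfree Gen_b (swap w)" using adjfree_swap[of "swap w"] \<open>w \<noteq> []\<close> by simp
  then have small: "\<bar>k\<bar> \<le> 1" if "(e, k) \<in> set H" for e k
    using adjfree_small[OF Hn(2) _ that] gaps_adjfree[OF H] by simp
  have fs: "fsign H True = s"
  proof -
    obtain e0 k0 F where "H = (e0, k0) # F" using Hn(2) by (metis list.exhaust surj_pair)
    then show ?thesis using e[of e0 k0] by simp
  qed
  have e': "e' = s" if "(e, k, e') \<in> set (ctri H)" for e k e'
    using tri_snd[OF that] e fs by blast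
  have "length (filter Not (gturns (shift_tri z))) = 0" if "z \<in> set (ctri H)" for z
  proof -
    obtain e0 k e0' where z: "z = (e0, k, e0')" by (cases z)
    then have "e0 = s" "e0' = s" "\<bar>k\<bar> \<le> 1" using that e e' small tri_fst by blast+
    then show ?thesis using z by (cases s) (auto simp: shift_def)
  qed
  then have "bad (gap_word (cshift_gaps H)) = 0"
    using Hn by (simp add: bad_gap_word tri_shift comp_def)
  then have "good (swap (gap_word (cshift_gaps H)))"
    using good_if_no_bad step_beta(2)[OF H] by simp
  then show ?thesis using good_cnj[OF step_beta(1)[OF H]] by simp
qed

text \<open>With L = 2^l l: up to l steps \<open>alpha\<close> stretch a word of length l to at most
  L, and 2L + 3 further doublings allow for one \<open>beta\<close> and a phase of at most 2L + 2
  steps. The summand 1 keeps the value at least 8, so that it bounds the number of steps of a round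
  as well as the length after it.\<close>

definition growth :: "nat \<Rightarrow> nat" where
  "growth l = 2 ^ (2 * (2 ^ l * l) + 3) * (2 ^ l * l + 1)"

fun depth :: "nat \<Rightarrow> nat \<Rightarrow> nat" where
  "depth 0 l = 0"
| "depth (Suc t) l = growth l + depth t (growth l)"

lemma depth_mono: "l \<le> l' \<Longrightarrow> depth t l \<le> depth t l'"
proof (induction t arbitrary: l l')
  case (Suc t)
  have "2 ^ l * l \<le> 2 ^ l' * l'" using Suc.prems by (intro mult_mono power_increasing) auto
  then have "growth l \<le> growth l'"
    unfolding growth_def by (intro mult_mono power_increasing) auto
  with Suc show ?case by (simp add: add_mono)
qed simp

text \<open>Induction on the bad turns allowed. A step that loses one hands over to the induction
  hypothesis; otherwise the given path is followed through a run of \<open>alpha\<close>, a run of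
  \<open>beta\<close> and one more \<open>alpha\<close>, and is replaced by a direct finish as soon
  as level 0 is attained. Existence of some good path is used throughout to know that the current
  word is not dead.\<close>

lemma short_path:
  "cyc_reduced w \<Longrightarrow> length w \<le> l \<Longrightarrow> bad w \<le> t \<Longrightarrow> good (path_map p w) \<Longrightarrow>
    \<exists>p'. length p' \<le> depth t l \<and> good (path_map p' w)"
proof (induction t arbitrary: w l p)
  case 0
  then show ?case using good_if_no_bad by (intro exI[of _ "[]"]) simp
next
  case (Suc t)
  note IH = Suc.IH
  have trivial: "\<exists>p'. length p' \<le> m \<and> good (path_map p' w)" if "cyc_reduced w" "p = [] \<or> bad w = 0" "good (path_map p w)" for p w m
    using that good_if_no_bad by (intro exI[of _ "[]"]) auto
  have via: "\<exists>p'. length p' \<le> Suc m \<and> good (path_map p' w)"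
    if "(if s then alpha w else beta w) \<frown> w'" "\<exists>p'. length p' \<le> m \<and> good (path_map p' w')" for s w w' m
  proof -
    from that(2) obtain p' where "length p' \<le> m" "good (path_map p' w')" by blast
    then show ?thesis using good_cnj[OF cnj_path_map[OF that(1)]] by (intro exI[of _ "s # p'"]) simp
  qed
  have weaken: "\<exists>p'. length p' \<le> m' \<and> good (path_map p' w)"
    if "\<exists>p'. length p' \<le> m \<and> good (path_map p' w)" "m \<le> m'" for m m' w
    using that le_trans by blast
  have nondead: "\<not> dead (cturns w)" if "cyc_reduced w" "good (path_map p w)" for p w
    using that dead_not_good by blast
  have after_alpha: "good (path_map p w')" if "alpha w \<frown> w'" "good (path_map (True # p) w)" for p w w'
    using that good_cnj[OF cnj_path_map[OF that(1)]] by simp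
  have after_beta: "good (path_map p w')" if "beta w \<frown> w'" "good (path_map (False # p) w)" for p w w'
    using that good_cnj[OF cnj_path_map[OF that(1)]] by simp
  \<comment> \<open>Isolated letters b leave only the exponents 1, 0 and -1. If \<open>alpha\<close>
    loses no bad turn, the relative exponent -1 is absent between equal signs, so
    \<open>alpha\<close> leads to level 0 and \<open>beta\<close> finishes.\<close>
  have A_alpha: "\<exists>p'. length p' \<le> Suc (Suc (depth t (2 * l))) \<and> good (path_map p' w)"
    if "cyc_reduced w" "adjfree Gen_b w" "length w \<le> l" "bad w \<le> Suc t" "bad w \<noteq> 0" "good (path_map (True # p) w)"
    for w l p
  proof -
    from that obtain G where G: "gaps w G" using bad_letters by blast
    let ?w = "gap_word (cshift_gaps G)"
    note st = step_alpha[OF G]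
    have g: "good (path_map p ?w)" using after_alpha[OF st(1) that(6)] .
    have Gn: "gap_reduced G" "G \<noteq> []" using G by (simp_all add: gaps_def gap_reduced_def)
    show ?thesis
    proof (cases "bad ?w < bad w")
      case True
      then have "\<exists>p'. length p' \<le> depth t (2 * l) \<and> good (path_map p' ?w)"
        using IH[OF st(3) _ _ g, of "2 * l"] st(4) that(3,4) by simp
      from via[of True, OF _ this, of w] st(1)
      have "\<exists>p'. length p' \<le> Suc (depth t (2 * l)) \<and> good (path_map p' w)" by simp
      then show ?thesis by (rule weaken) simp
    next
      case False
      then have eq: "bad ?w = bad (gap_word G)" using st(5) gaps_facts(4)[OF G] by simp
      have "- int (Suc 0) < (if e then k else - k)" if "(e, k, e) \<in> set (ctri G)" for e k
      proof -
        have "\<bar>k\<bar> \<le> 1"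
          using adjfree_small[OF Gn(2) _ tri_fst[OF that]] gaps_adjfree[OF G] \<open>adjfree Gen_b w\<close> by simp
        moreover have "k + shift e e \<noteq> 0" by (rule bad_cshift_eq[OF Gn(1) eq that])
        ultimately show ?thesis by (cases e) (auto simp: shift_def)
      qed
      then have "level (Suc 0) G" unfolding level_def by fastforce
      then have "level 0 (cshift_gaps G)" by (rule level_cshift(1)[OF Gn(2)])
      then have "good (path_map [False] ?w)"
        using level_0_good[OF st(2)] nondead[OF st(3) g] by simp
      then have "\<exists>p'. length p' \<le> Suc (depth t (2 * l)) \<and> good (path_map p' ?w)"
        by (intro exI[of _ "[False]"]) simp
      from via[of True, OF _ this, of w] st(1) show ?thesis by simp
    qed
  qed
  \<comment> \<open>A run of \<open>beta\<close>, seen through \<open>swap\<close>: each step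
    without loss lowers the level \<open>n\<close> and keeps the letters b isolated. At level 0 an
    \<open>alpha\<close> finishes, and a path that turns to \<open>alpha\<close> earlier falls under
    \<open>A_alpha\<close>.\<close>
  have A: "\<exists>p'. length p' \<le> n + 2 + depth t (2 ^ (n + 2) * l) \<and> good (path_map p' w)"
    if "gaps (swap w) H" "level n H" "adjfree Gen_b w" "length w \<le> l" "bad w \<le> Suc t" "good (path_map p w)"
    for n w H l p
    using that
  proof (induction n arbitrary: w H l p)
    case (0 w H l p)
    have c: "cyc_reduced w" using gaps_facts(1)[OF 0(1)] by simp
    consider "p = [] \<or> bad w = 0" | p1 where "p = True # p1" "bad w \<noteq> 0" | p1 where "p = False # p1"
      by (cases p) (metis (full_types))+
    then show ?case
    proof cases
      case 1
      then show ?thesis using trivial[OF c _ 0(6)] by blast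
    next
      case 2
      with A_alpha[OF c 0(3,4,5)] 0(6)
      have "\<exists>p'. length p' \<le> Suc (Suc (depth t (2 * l))) \<and> good (path_map p' w)" by blast
      then show ?thesis using depth_mono[of "2 * l" "2 ^ 2 * l" t] by (elim weaken) simp
    next
      case 3
      have "good (beta (swap w))"
        using level_0_good[OF 0(1,2)] nondead[OF c 0(6)] by simp
      then have "good (swap (beta (swap w)))" by (rule good_swap)
      also have "swap (beta (swap w)) = alpha w" by (simp add: extend_extend)
      finally show ?thesis by (intro exI[of _ "[True]"]) simp
    qed
  next
    case (Suc n w H l p)
    have c: "cyc_reduced w" using gaps_facts(1)[OF Suc(2)] by simp
    have list_enc: "depth t (2 * l) \<le> depth t (2 ^ (Suc n + 2) * l)" by (intro depth_mono) simp
    consider "p = [] \<or> bad w = 0" | p1 where "p = True # p1" "bad w \<noteq> 0" | p1 where "p = False # p1"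
      by (cases p) (metis (full_types))+
    then show ?case
    proof cases
      case 1
      then show ?thesis using trivial[OF c _ Suc(7)] by blast
    next
      case 2
      with A_alpha[OF c Suc(4,5,6)] Suc(7)
      have "\<exists>p'. length p' \<le> Suc (Suc (depth t (2 * l))) \<and> good (path_map p' w)" by blast
      then show ?thesis using list_enc by (elim weaken) simp
    next
      case 3
      let ?w = "swap (gap_word (cshift_gaps H))"
      note st = step_beta[OF Suc(2)]
      have g: "good (path_map p1 ?w)" using after_beta[OF st(1)] Suc(7) 3 by blast
      have Hn: "gap_reduced H" "H \<noteq> []" using Suc(2) by (simp_all add: gaps_def gap_reduced_def)
      show ?thesis
      proof (cases "bad ?w < bad w")
        case True
        then have "\<exists>p'. length p' \<le> depth t (2 * l) \<and> good (path_map p' ?w)"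
          using IH[OF st(2) _ _ g, of "2 * l"] st(3) Suc(5,6) by simp
        from via[of False, OF _ this, of w] st(1)
        have "\<exists>p'. length p' \<le> Suc (depth t (2 * l)) \<and> good (path_map p' w)" by simp
        then show ?thesis using list_enc by (elim weaken) simp
      next
        case False
        then have eq: "bad (gap_word (cshift_gaps H)) = bad (gap_word H)"
          using st(4) gaps_facts(4)[OF Suc(2)] by simp
        have "adjfree Gen_a (gap_word (cshift_gaps H))"
        proof (rule adjfree_gap_word)
          fix e k e' assume "(e, k, e') \<in> set (ctri (cshift_gaps H))"
          then obtain z where "z \<in> set (ctri H)" "(e, k, e') = shift_tri z" by (auto simp: tri_shift)
          moreover obtain e0 k0 e0' where "z = (e0, k0, e0')" by (cases z)
          ultimately show "k \<noteq> 0" using bad_cshift_eq[OF Hn(1) eq, of e0 k0 e0'] by simp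
        qed (simp add: Hn)
        moreover have "gap_word (cshift_gaps H) \<noteq> []" using st(2) by (auto simp: cyc_reduced_def)
        ultimately have "adjfree Gen_b ?w" using adjfree_swap[of ?w] by simp
        moreover have "gaps (swap ?w) (cshift_gaps H)" using step_alpha(2)[OF Suc(2)] by simp
        moreover have "level n (cshift_gaps H)" using level_cshift(1)[OF Hn(2) Suc(3)] .
        ultimately have "\<exists>p'. length p' \<le> n + 2 + depth t (2 ^ (n + 2) * (2 * l)) \<and> good (path_map p' ?w)"
          using Suc.IH[of ?w "cshift_gaps H" "2 * l" p1] st(3,4) Suc(5,6) g by simp
        from via[of False, OF _ this, of w] st(1) show ?thesis by (simp add: algebra_simps)
      qed
    qed
  qed
  \<comment> \<open>A first \<open>beta\<close> without loss isolates the letters b, which opens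
    phase \<open>A\<close>. Its level is at most the new length 2l.\<close>
  have B_beta: "\<exists>p'. length p' \<le> 2 * l + 3 + depth t (2 ^ (2 * l + 3) * l) \<and> good (path_map p' w)"
    if "cyc_reduced w" "length w \<le> l" "bad w \<le> Suc t" "bad w \<noteq> 0" "good (path_map (False # p) w)"
    for w l p
  proof -
    from that obtain H where H: "gaps (swap w) H" using bad_letters by blast
    let ?w = "swap (gap_word (cshift_gaps H))"
    note st = step_beta[OF H]
    have g: "good (path_map p ?w)" using after_beta[OF st(1) that(5)] .
    have Hn: "gap_reduced H" "H \<noteq> []" using H by (simp_all add: gaps_def gap_reduced_def)
    show ?thesis
    proof (cases "bad ?w < bad w")
      case True
      then have "\<exists>p'. length p' \<le> depth t (2 * l) \<and> good (path_map p' ?w)"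
        using IH[OF st(2) _ _ g, of "2 * l"] st(3) that(2,3) by simp
      from via[of False, OF _ this, of w] st(1)
      have "\<exists>p'. length p' \<le> Suc (depth t (2 * l)) \<and> good (path_map p' w)" by simp
      moreover have "2 * l \<le> 2 ^ (2 * l + 3) * l"
        using power_increasing[of 1 "2 * l + 3" "2::nat"] by (intro mult_right_mono) auto
      then have "depth t (2 * l) \<le> depth t (2 ^ (2 * l + 3) * l)" by (rule depth_mono)
      ultimately show ?thesis by (elim weaken) simp
    next
      case False
      then have eq: "bad (gap_word (cshift_gaps H)) = bad (gap_word H)"
        using st(4) gaps_facts(4)[OF H] by simp
      have "adjfree Gen_a (gap_word (cshift_gaps H))"
      proof (rule adjfree_gap_word)
        fix e k e' assume "(e, k, e') \<in> set (ctri (cshift_gaps H))"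
        then obtain z where "z \<in> set (ctri H)" "(e, k, e') = shift_tri z" by (auto simp: tri_shift)
        moreover obtain e0 k0 e0' where "z = (e0, k0, e0')" by (cases z)
        ultimately show "k \<noteq> 0" using bad_cshift_eq[OF Hn(1) eq, of e0 k0 e0'] by simp
      qed (simp add: Hn)
      moreover have "gap_word (cshift_gaps H) \<noteq> []" using st(2) by (auto simp: cyc_reduced_def)
      ultimately have "adjfree Gen_b ?w" using adjfree_swap[of ?w] by simp
      moreover have "gaps (swap ?w) (cshift_gaps H)" using step_alpha(2)[OF H] by simp
      moreover have "level (2 * l) (cshift_gaps H)" using level_length st(3) that(2) by simp
      ultimately have "\<exists>p'. length p' \<le> 2 * l + 2 + depth t (2 ^ (2 * l + 2) * (2 * l)) \<and> good (path_map p' ?w)"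
        using A[of ?w "cshift_gaps H" "2 * l" "2 * l" p] st(3,4) that(2,3) g by simp
      from via[of False, OF _ this, of w] st(1)
      show ?thesis by (simp add: algebra_simps numeral_3_eq_3)
    qed
  qed
  \<comment> \<open>The opening run of \<open>alpha\<close>: every step lowers the level and at most
    doubles the length. At level 0 a \<open>beta\<close> finishes; an earlier \<open>beta\<close> on
    the path is treated by \<open>B_beta\<close>.\<close>
  have B: "\<exists>p'. length p' \<le> n + 4 + 2 * (2 ^ n * l) + depth t (2 ^ (2 * (2 ^ n * l) + 3) * (2 ^ n * l)) \<and> good (path_map p' w)"
    if "gaps w G" "level n G" "length w \<le> l" "bad w \<le> Suc t" "good (path_map p w)"
    for n w G l p
    using that
  proof (induction n arbitrary: w G l p)
    case (0 w G l p)
    note c = gaps_facts(1)[OF 0(1)]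
    consider "p = [] \<or> bad w = 0" | p1 where "p = True # p1" | p1 where "p = False # p1" "bad w \<noteq> 0"
      by (cases p) (metis (full_types))+
    then show ?case
    proof cases
      case 1
      then show ?thesis using trivial[OF c _ 0(5)] by blast
    next
      case 2
      have "good (beta w)" using level_0_good[OF 0(1,2)] nondead[OF c 0(5)] by simp
      then show ?thesis by (intro exI[of _ "[False]"]) simp
    next
      case 3
      with B_beta[OF c 0(3,4)] 0(5)
      have "\<exists>p'. length p' \<le> 2 * l + 3 + depth t (2 ^ (2 * l + 3) * l) \<and> good (path_map p' w)" by blast
      then show ?thesis by (elim weaken) simp
    qed
  next
    case (Suc n w G l p)
    note c = gaps_facts(1)[OF Suc(2)]
    define L where "L = 2 ^ Suc n * l"
    have L: "2 * l \<le> L" "2 ^ n * (2 * l) = L" by (simp_all add: L_def)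
    consider "p = [] \<or> bad w = 0" | p1 where "p = True # p1" | p1 where "p = False # p1" "bad w \<noteq> 0"
      by (cases p) (metis (full_types))+
    then show ?case
    proof cases
      case 1
      then show ?thesis using trivial[OF c _ Suc(6)] by blast
    next
      case 2
      let ?w = "gap_word (cshift_gaps G)"
      note st = step_alpha[OF Suc(2)]
      have "level n (cshift_gaps G)"
        using level_cshift(1)[OF _ Suc(3)] Suc(2) by (simp add: gaps_def gap_reduced_def)
      moreover have "good (path_map p1 ?w)" using after_alpha[OF st(1)] Suc(6) 2 by blast
      ultimately have "\<exists>p'. length p' \<le> n + 4 + 2 * L + depth t (2 ^ (2 * L + 3) * L) \<and> good (path_map p' ?w)"
        using Suc.IH[OF st(2), of "2 * l" p1] st(4,5) Suc(4,5) unfolding L(2) by simp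
      from via[of True, OF _ this, of w] st(1)
      have "\<exists>p'. length p' \<le> Suc (n + 4 + 2 * L + depth t (2 ^ (2 * L + 3) * L)) \<and> good (path_map p' w)"
        by simp
      then show ?thesis unfolding L_def[symmetric] by (rule weaken) simp
    next
      case 3
      with B_beta[OF c Suc(4,5)] Suc(6)
      have "\<exists>p'. length p' \<le> 2 * l + 3 + depth t (2 ^ (2 * l + 3) * l) \<and> good (path_map p' w)" by blast
      moreover have "2 ^ (2 * l + 3) * l \<le> 2 ^ (2 * L + 3) * L"
        using L(1) by (intro mult_mono power_increasing) auto
      then have "depth t (2 ^ (2 * l + 3) * l) \<le> depth t (2 ^ (2 * L + 3) * L)" by (rule depth_mono)
      ultimately show ?thesis using L(1) unfolding L_def[symmetric] by (elim weaken) simp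
    qed
  qed
  show ?case
  proof (cases "bad w = 0")
    case True
    then show ?thesis using trivial Suc.prems by blast
  next
    case False
    then obtain G where G: "gaps w G" using bad_letters Suc.prems(1) by blast
    define L where "L = 2 ^ l * l"
    have "level l G" using level_length gaps_facts(2)[OF G] Suc.prems(2) by simp
    from B[OF G this Suc.prems(2-4)]
    have *: "\<exists>p'. length p' \<le> l + 4 + 2 * L + depth t (2 ^ (2 * L + 3) * L) \<and> good (path_map p' w)"
      by (simp add: L_def)
    have "l \<le> L" by (simp add: L_def)
    moreover have g: "growth l = 2 ^ (2 * L + 3) * (L + 1)" by (simp add: growth_def L_def)
    \<comment> \<open>Absorbs the step count l + 4 + 2L, which is at most 3L + 4, into
      \<open>growth l\<close>.\<close>
    moreover have "8 * (L + 1) \<le> 2 ^ (2 * L + 3) * (L + 1)"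
      using power_increasing[of 3 "2 * L + 3" "2::nat"] by (intro mult_right_mono) auto
    moreover have "depth t (2 ^ (2 * L + 3) * L) \<le> depth t (growth l)"
      unfolding g by (intro depth_mono) simp
    ultimately have "l + 4 + 2 * L + depth t (2 ^ (2 * L + 3) * L) \<le> depth (Suc t) l" by simp
    with * show ?thesis by (rule weaken)
  qed
qed

section \<open>Computable functions\<close>

text \<open>The number of arguments is fixed here because programs carry no arities.\<close>

definition rec_fun :: "nat \<Rightarrow> (nat list \<Rightarrow> nat) \<Rightarrow> bool" where
  "rec_fun n F \<longleftrightarrow> (\<exists>p. \<forall>xs. length xs = n \<longrightarrow> rec_eval p xs (F xs))"

lemma rec_fun_const: "rec_fun n (\<lambda>_. c)"
proof (induction c)
  case 0
  show ?case unfolding rec_fun_def by (intro exI[of _ Zero]) (simp add: rec_eval.Zero)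
next
  case (Suc c)
  then obtain p where p: "\<And>xs. length xs = n \<Longrightarrow> rec_eval p xs c" by (auto simp: rec_fun_def)
  have "rec_eval (Comp Succ [p]) xs (Suc c)" if "length xs = n" for xs
    by (rule rec_eval.Comp[where ys = "[c]"]) (auto intro: p that rec_eval.Succ)
  then show ?case unfolding rec_fun_def by blast
qed

lemma rec_fun_proj: "i < n \<Longrightarrow> rec_fun n (\<lambda>xs. xs ! i)"
  unfolding rec_fun_def by (intro exI[of _ "Proj i"]) (simp add: rec_eval.Proj)

lemma rec_fun_comp1: "rec_fun (Suc 0) G \<Longrightarrow> rec_fun n F \<Longrightarrow> rec_fun n (\<lambda>xs. G [F xs])"
proof -
  assume "rec_fun (Suc 0) G" "rec_fun n F"
  then obtain g p where g: "\<And>xs. length xs = 1 \<Longrightarrow> rec_eval g xs (G xs)"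
    and p: "\<And>xs. length xs = n \<Longrightarrow> rec_eval p xs (F xs)" by (auto simp: rec_fun_def)
  have "rec_eval (Comp g [p]) xs (G [F xs])" if "length xs = n" for xs
    by (rule rec_eval.Comp[where ys = "[F xs]"]) (auto intro: p g that)
  then show ?thesis unfolding rec_fun_def by blast
qed

lemma rec_fun_comp2: "rec_fun 2 G \<Longrightarrow> rec_fun n F \<Longrightarrow> rec_fun n H \<Longrightarrow> rec_fun n (\<lambda>xs. G [F xs, H xs])"
proof -
  assume "rec_fun 2 G" "rec_fun n F" "rec_fun n H"
  then obtain g p q where g: "\<And>xs. length xs = 2 \<Longrightarrow> rec_eval g xs (G xs)"
    and p: "\<And>xs. length xs = n \<Longrightarrow> rec_eval p xs (F xs)" 
    and q: "\<And>xs. length xs = n \<Longrightarrow> rec_eval q xs (H xs)" by (auto simp: rec_fun_def)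
  have "rec_eval (Comp g [p, q]) xs (G [F xs, H xs])" if "length xs = n" for xs
    by (rule rec_eval.Comp[where ys = "[F xs, H xs]"]) (auto intro: p q g that)
  then show ?thesis unfolding rec_fun_def by blast
qed

lemma rec_fun_rec:
  assumes "rec_fun n F" "rec_fun (Suc (Suc n)) G"
  shows "rec_fun (Suc n) (\<lambda>xs. rec_nat (F (tl xs)) (\<lambda>k y. G (y # k # tl xs)) (hd xs))"
proof -
  from assms obtain p g where g: "\<And>xs. length xs = Suc (Suc n) \<Longrightarrow> rec_eval g xs (G xs)"
    and p: "\<And>xs. length xs = n \<Longrightarrow> rec_eval p xs (F xs)" by (auto simp: rec_fun_def)
  have "rec_eval (PrimRec p g) (k # xs) (rec_nat (F xs) (\<lambda>k y. G (y # k # xs)) k)"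
    if "length xs = n" for k xs
  proof (induction k)
    case 0
    then show ?case by (simp add: rec_eval.PrimRec_0 p that)
  next
    case (Suc k)
    show ?case using rec_eval.PrimRec_Suc[OF Suc g] that by simp
  qed
  then have "rec_eval (PrimRec p g) xs (rec_nat (F (tl xs)) (\<lambda>k y. G (y # k # tl xs)) (hd xs))"
    if "length xs = Suc n" for xs using that by (cases xs) auto
  then show ?thesis unfolding rec_fun_def by blast
qed

lemma rec_fun_cong: "rec_fun n F \<Longrightarrow> (\<And>xs. length xs = n \<Longrightarrow> F xs = G xs) \<Longrightarrow> rec_fun n G"
  unfolding rec_fun_def by auto

lemma length_1_iff: "length xs = Suc 0 \<longleftrightarrow> (\<exists>x. xs = [x])"
  by (cases xs) auto

lemma length_2_iff: "length xs = 2 \<longleftrightarrow> (\<exists>x y. xs = [x, y])"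
  by (cases xs; cases "tl xs") auto

lemma rec_fun_Suc: "rec_fun n F \<Longrightarrow> rec_fun n (\<lambda>xs. Suc (F xs))"
proof -
  have "rec_eval Succ xs (Suc (xs ! 0))" if "length xs = 1" for xs
    using that by (auto simp: length_1_iff intro: rec_eval.Succ)
  then have "rec_fun (Suc 0) (\<lambda>xs. Suc (xs ! 0))" unfolding rec_fun_def by auto
  then show "rec_fun n F \<Longrightarrow> ?thesis" using rec_fun_comp1 by force
qed

lemma rec_fun_add: "rec_fun n F \<Longrightarrow> rec_fun n G \<Longrightarrow> rec_fun n (\<lambda>xs. F xs + G xs)"
proof -
  have "rec_fun 2 (\<lambda>xs. rec_nat (tl xs ! 0) (\<lambda>k y. Suc ((y # k # tl xs) ! 0)) (hd xs))"
    unfolding numeral_2_eq_2 by (intro rec_fun_rec rec_fun_Suc rec_fun_proj) simp_all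
  moreover have "rec_nat x (\<lambda>k y. Suc y) m = m + x" for m x by (induction m) auto
  ultimately have "rec_fun 2 (\<lambda>xs. xs ! 0 + xs ! 1)"
    by (elim rec_fun_cong) (auto simp: length_2_iff)
  from rec_fun_comp2[OF this] show "rec_fun n F \<Longrightarrow> rec_fun n G \<Longrightarrow> ?thesis" by force
qed

lemma rec_fun_mult: "rec_fun n F \<Longrightarrow> rec_fun n G \<Longrightarrow> rec_fun n (\<lambda>xs. F xs * G xs)"
proof -
  have "rec_fun 2 (\<lambda>xs. rec_nat 0 (\<lambda>k y. (y # k # tl xs) ! 0 + (y # k # tl xs) ! 2) (hd xs))"
    unfolding numeral_2_eq_2 by (intro rec_fun_rec rec_fun_add rec_fun_proj rec_fun_const) simp_all
  moreover have "rec_nat 0 (\<lambda>k y. y + x) m = m * x" for m x :: nat by (induction m) auto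
  ultimately have "rec_fun 2 (\<lambda>xs. xs ! 0 * xs ! 1)"
    by (elim rec_fun_cong) (auto simp: length_2_iff)
  from rec_fun_comp2[OF this] show "rec_fun n F \<Longrightarrow> rec_fun n G \<Longrightarrow> ?thesis" by force
qed

lemma rec_fun_diff: "rec_fun n F \<Longrightarrow> rec_fun n G \<Longrightarrow> rec_fun n (\<lambda>xs. F xs - G xs)"
proof -
  have "rec_fun (Suc 0) (\<lambda>xs. rec_nat 0 (\<lambda>k y. (y # k # tl xs) ! 1) (hd xs))"
    by (intro rec_fun_rec rec_fun_proj rec_fun_const) simp_all
  moreover have "rec_nat 0 (\<lambda>k y. k) m = m - 1" for m by (induction m) auto
  ultimately have "rec_fun (Suc 0) (\<lambda>xs. xs ! 0 - 1)"
    by (auto elim!: rec_fun_cong simp: length_1_iff)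
  from rec_fun_comp1[OF this] have pred: "rec_fun n F \<Longrightarrow> rec_fun n (\<lambda>xs. F xs - 1)" for n F by force
  \<comment> \<open>Recursion runs over the first argument, so the subtrahend comes first and the
    arguments are exchanged at the end.\<close>
  have "rec_fun 2 (\<lambda>xs. rec_nat (tl xs ! 0) (\<lambda>k y. (y # k # tl xs) ! 0 - 1) (hd xs))"
    unfolding numeral_2_eq_2 by (intro rec_fun_rec pred rec_fun_proj rec_fun_const) simp_all
  moreover have "rec_nat x (\<lambda>k y. y - 1) m = x - m" for m x :: nat by (induction m) auto
  ultimately have "rec_fun 2 (\<lambda>xs. xs ! 1 - xs ! 0)"
    by (elim rec_fun_cong) (auto simp: length_2_iff)
  from rec_fun_comp2[OF this, of n G F] show "rec_fun n F \<Longrightarrow> rec_fun n G \<Longrightarrow> ?thesis" by simp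
qed

lemma rec_fun_triangle: "rec_fun n F \<Longrightarrow> rec_fun n (\<lambda>xs. triangle (F xs))"
proof -
  have "rec_fun (Suc 0) (\<lambda>xs. rec_nat 0 (\<lambda>k y. (y # k # tl xs) ! 0 + Suc ((y # k # tl xs) ! 1)) (hd xs))"
    by (intro rec_fun_rec rec_fun_proj rec_fun_const rec_fun_add rec_fun_Suc) simp_all
  moreover have "rec_nat 0 (\<lambda>k y. y + Suc k) m = triangle m" for m by (induction m) auto
  ultimately have "rec_fun (Suc 0) (\<lambda>xs. triangle (xs ! 0))"
    by (auto elim!: rec_fun_cong simp: length_1_iff)
  from rec_fun_comp1[OF this] show "rec_fun n F \<Longrightarrow> ?thesis" by force
qed

lemma rec_fun_prod_encode: "rec_fun n F \<Longrightarrow> rec_fun n G \<Longrightarrow> rec_fun n (\<lambda>xs. prod_encode (F xs, G xs))"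
  unfolding prod_encode_def by (simp add: rec_fun_add rec_fun_triangle)

text \<open>The index of the antidiagonal on which Cantor pairing places its argument.\<close>

definition diag :: "nat \<Rightarrow> nat" where
  "diag = rec_nat 0 (\<lambda>k y. y + (1 - (triangle (Suc y) - Suc k)))"

lemma mono_triangle: "m \<le> n \<Longrightarrow> triangle m \<le> triangle n"
  by (induction n) (auto simp: le_Suc_eq)

text \<open>The truncated difference in \<open>diag\<close> is a 0/1 test for
  \<open>triangle (Suc y) \<le> Suc k\<close>: the index advances exactly when the next triangular
  number is reached.\<close>

lemma diag_bounds: "triangle (diag z) \<le> z \<and> z < triangle (Suc (diag z))"
proof (induction z)
  case (Suc z)
  have "diag (Suc z) = diag z + (1 - (triangle (Suc (diag z)) - Suc z))" by (simp add: diag_def)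
  moreover have "diag (Suc z) = Suc (diag z) \<and> Suc z = triangle (Suc (diag z))"
    if "triangle (Suc (diag z)) \<le> Suc z"
    using that Suc calculation by auto
  ultimately show ?case
    using Suc by (cases "triangle (Suc (diag z)) \<le> Suc z") auto
qed (simp add: diag_def)

lemma diag_prod_encode: "diag (prod_encode (m, n)) = m + n"
proof -
  let ?z = "prod_encode (m, n)"
  have z: "triangle (m + n) \<le> ?z" "?z < triangle (Suc (m + n))" by (simp_all add: prod_encode_def)
  have "\<not> m + n < diag ?z" using mono_triangle[of "Suc (m + n)" "diag ?z"] diag_bounds[of ?z] z by auto
  moreover have "\<not> diag ?z < m + n" 
    using mono_triangle[of "Suc (diag ?z)" "m + n"] diag_bounds[of ?z] z by auto
  ultimately show ?thesis by simp
qed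

lemma rec_fun_diag: "rec_fun n F \<Longrightarrow> rec_fun n (\<lambda>xs. diag (F xs))"
proof -
  have "rec_fun (Suc 0) (\<lambda>xs. rec_nat 0 (\<lambda>k y. (y # k # tl xs) ! 0 + 
    (1 - (triangle (Suc ((y # k # tl xs) ! 0)) - Suc ((y # k # tl xs) ! 1)))) (hd xs))"
    by (intro rec_fun_rec rec_fun_proj rec_fun_const rec_fun_add rec_fun_Suc rec_fun_diff rec_fun_triangle) simp_all
  then have "rec_fun (Suc 0) (\<lambda>xs. diag (xs ! 0))"
    by (auto elim!: rec_fun_cong simp: length_1_iff diag_def)
  from rec_fun_comp1[OF this] show "rec_fun n F \<Longrightarrow> ?thesis" by force
qed

lemma fst_prod_decode: "fst (prod_decode z) = z - triangle (diag z)"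
  and snd_prod_decode: "snd (prod_decode z) = diag z - (z - triangle (diag z))"
proof -
  obtain m n where z: "z = prod_encode (m, n)" by (metis prod_decode_inverse surj_pair)
  show "fst (prod_decode z) = z - triangle (diag z)"
    "snd (prod_decode z) = diag z - (z - triangle (diag z))"
    unfolding z diag_prod_encode prod_encode_inverse by (simp_all add: prod_encode_def)
qed

lemma rec_fun_prod_decode:
  "rec_fun n F \<Longrightarrow> rec_fun n (\<lambda>xs. fst (prod_decode (F xs)))"
  "rec_fun n F \<Longrightarrow> rec_fun n (\<lambda>xs. snd (prod_decode (F xs)))"
  unfolding fst_prod_decode snd_prod_decode by (intro rec_fun_diff rec_fun_triangle rec_fun_diag; assumption)+

subsection \<open>Computability relative to encodings\<close>

definition rec1 :: "(nat \<Rightarrow> nat) \<Rightarrow> bool" where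
  "rec1 F \<longleftrightarrow> rec_fun (Suc 0) (\<lambda>xs. F (xs ! 0))"

lemma rec1_compose: "rec1 F \<Longrightarrow> rec_fun n G \<Longrightarrow> rec_fun n (\<lambda>xs. F (G xs))"
  unfolding rec1_def using rec_fun_comp1 by force

text \<open>The realiser is total on numbers but prescribed only on codes, so it may take any value
  elsewhere.\<close>

definition computable :: "('a \<Rightarrow> nat) \<Rightarrow> ('b \<Rightarrow> nat) \<Rightarrow> ('a \<Rightarrow> 'b) \<Rightarrow> bool" where
  "computable d e f \<longleftrightarrow> (\<exists>F. rec1 F \<and> (\<forall>x. F (d x) = e (f x)))"

abbreviation nat_enc :: "nat \<Rightarrow> nat" where "nat_enc \<equiv> id"
abbreviation bool_enc :: "bool \<Rightarrow> nat" where "bool_enc \<equiv> of_bool"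
definition pair_enc :: "('a \<Rightarrow> nat) \<Rightarrow> ('b \<Rightarrow> nat) \<Rightarrow> 'a \<times> 'b \<Rightarrow> nat" where
  "pair_enc d e p = prod_encode (d (fst p), e (snd p))"
definition list_enc :: "('a \<Rightarrow> nat) \<Rightarrow> 'a list \<Rightarrow> nat" where
  "list_enc e xs = list_encode (map e xs)"

lemma rec_fun_arg: "rec_fun (Suc 0) (\<lambda>xs. xs ! 0)"
  by (intro rec_fun_proj) simp

lemma cmpI: 
  "rec_fun (Suc 0) (\<lambda>xs. F (xs ! 0)) \<Longrightarrow> (\<And>x. F (d x) = e (f x)) \<Longrightarrow> computable d e f"
  unfolding computable_def rec1_def by (rule exI[of _ F]) simp

lemma cmpE: 
  assumes "computable d e f" 
  obtains F where "rec1 F" "\<And>x. F (d x) = e (f x)"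
  using assms unfolding computable_def by blast

lemma computable_id: "computable e e (\<lambda>x. x)"
  by (rule cmpI[where F = "\<lambda>x. x"]) (auto intro: rec_fun_arg)

lemma computable_const: "computable d e (\<lambda>_. c)"
  by (rule cmpI[where F = "\<lambda>_. e c"]) (auto intro: rec_fun_const)

lemma computable_comp:
  assumes "computable d e f" "computable e e' g"
  shows "computable d e' (\<lambda>x. g (f x))"
proof -
  from assms(1) obtain F where F: "rec1 F" "\<And>x. F (d x) = e (f x)" by (rule cmpE) (rule that)
  from assms(2) obtain G where G: "rec1 G" "\<And>x. G (e x) = e' (g x)" by (rule cmpE) (rule that)
  show ?thesis
    by (rule cmpI[where F = "\<lambda>x. G (F x)"]) 
      (rule rec1_compose[OF G(1)] rec1_compose[OF F(1)] rec_fun_arg | simp add: F G)+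
qed

lemma computable_pair:
  assumes "computable d e f" "computable d e' g"
  shows "computable d (pair_enc e e') (\<lambda>x. (f x, g x))"
proof -
  from assms(1) obtain F where F: "rec1 F" "\<And>x. F (d x) = e (f x)" by (rule cmpE) (rule that)
  from assms(2) obtain G where G: "rec1 G" "\<And>x. G (d x) = e' (g x)" by (rule cmpE) (rule that)
  show ?thesis
    by (rule cmpI[where F = "\<lambda>x. prod_encode (F x, G x)"])
      (rule rec_fun_prod_encode rec1_compose[OF G(1)] rec1_compose[OF F(1)] rec_fun_arg | simp add: F G pair_enc_def)+
qed

lemma computable_fst: "computable d (pair_enc e e') f \<Longrightarrow> computable d e (\<lambda>x. fst (f x))"
  and computable_snd: "computable d (pair_enc e e') f \<Longrightarrow> computable d e' (\<lambda>x. snd (f x))"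
proof -
  have "computable (pair_enc e e') e fst"
    by (rule cmpI[where F = "\<lambda>x. fst (prod_decode x)"]) (auto intro!: rec_fun_prod_decode rec_fun_arg simp: pair_enc_def)
  then show "computable d (pair_enc e e') f \<Longrightarrow> computable d e (\<lambda>x. fst (f x))" by (rule computable_comp[rotated])
  have "computable (pair_enc e e') e' snd"
    by (rule cmpI[where F = "\<lambda>x. snd (prod_decode x)"]) (auto intro!: rec_fun_prod_decode rec_fun_arg simp: pair_enc_def)
  then show "computable d (pair_enc e e') f \<Longrightarrow> computable d e' (\<lambda>x. snd (f x))" by (rule computable_comp[rotated])
qed

lemma computable_nat_op:
  assumes "\<And>n F G. rec_fun n F \<Longrightarrow> rec_fun n G \<Longrightarrow> rec_fun n (\<lambda>xs. h (F xs) (G xs))"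
    and "computable d nat_enc f" "computable d nat_enc g"
  shows "computable d nat_enc (\<lambda>x. h (f x) (g x))"
proof -
  from assms(2) obtain F where F: "rec1 F" "\<And>x. F (d x) = id (f x)" by (rule cmpE) (rule that)
  from assms(3) obtain G where G: "rec1 G" "\<And>x. G (d x) = id (g x)" by (rule cmpE) (rule that)
  show ?thesis
    by (rule cmpI[where F = "\<lambda>x. h (F x) (G x)"])
      (rule assms(1) rec1_compose[OF G(1)] rec1_compose[OF F(1)] rec_fun_arg | simp add: F G)+
qed

lemma computable_add: "computable d nat_enc f \<Longrightarrow> computable d nat_enc g \<Longrightarrow> computable d nat_enc (\<lambda>x. f x + g x)"
  by (rule computable_nat_op[where h = "(+)"]) (rule rec_fun_add)

lemma computable_mult: "computable d nat_enc f \<Longrightarrow> computable d nat_enc g \<Longrightarrow> computable d nat_enc (\<lambda>x. f x * g x)"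
  by (rule computable_nat_op[where h = "\<lambda>x y. x * y"]) (rule rec_fun_mult)

lemma computable_diff: "computable d nat_enc f \<Longrightarrow> computable d nat_enc g \<Longrightarrow> computable d nat_enc (\<lambda>x. f x - g x)"
  by (rule computable_nat_op[where h = "(-)"]) (rule rec_fun_diff)

lemma computable_prod_encode: "computable d nat_enc f \<Longrightarrow> computable d nat_enc g \<Longrightarrow> computable d nat_enc (\<lambda>x. prod_encode (f x, g x))"
  by (rule computable_nat_op[where h = "\<lambda>x y. prod_encode (x, y)"]) (rule rec_fun_prod_encode)

lemma computable_Suc: "computable d nat_enc f \<Longrightarrow> computable d nat_enc (\<lambda>x. Suc (f x))"
  using computable_add[OF _ computable_const, of d f 1] by simp

lemma computable_if:
  assumes "computable d bool_enc c" "computable d e f" "computable d e g"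
  shows "computable d e (\<lambda>x. if c x then f x else g x)"
proof -
  from assms(1) obtain C where C: "rec1 C" "\<And>x. C (d x) = bool_enc (c x)" by (rule cmpE) (rule that)
  from assms(2) obtain F where F: "rec1 F" "\<And>x. F (d x) = e (f x)" by (rule cmpE) (rule that)
  from assms(3) obtain G where G: "rec1 G" "\<And>x. G (d x) = e (g x)" by (rule cmpE) (rule that)
  show ?thesis
    by (rule cmpI[where F = "\<lambda>x. C x * F x + (1 - C x) * G x"])
      (rule rec_fun_add rec_fun_mult rec_fun_diff rec_fun_const rec1_compose[OF C(1)] rec1_compose[OF G(1)] rec1_compose[OF F(1)] rec_fun_arg
       | simp add: F G C)+
qed

lemma computable_eq_const: "computable d nat_enc f \<Longrightarrow> computable d bool_enc (\<lambda>x. f x = c)"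
proof -
  assume "computable d nat_enc f"
  then obtain F where F: "rec1 F" "\<And>x. F (d x) = id (f x)" by (rule cmpE) (rule that)
  show ?thesis
    by (rule cmpI[where F = "\<lambda>x. 1 - ((F x - c) + (c - F x))"])
      (rule rec_fun_add rec_fun_diff rec_fun_const rec1_compose[OF F(1)] rec_fun_arg | simp add: F of_bool_def)+
qed

lemma computable_iter:
  assumes "computable d nat_enc m" "computable d e f" "computable (pair_enc d e) e (\<lambda>p. g (fst p) (snd p))"
  shows "computable d e (\<lambda>x. (g x ^^ m x) (f x))"
proof -
  from assms(1) obtain M where M: "rec1 M" "\<And>x. M (d x) = id (m x)" by (rule cmpE) (rule that)
  from assms(2) obtain F where F: "rec1 F" "\<And>x. F (d x) = e (f x)" by (rule cmpE) (rule that)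
  from assms(3) obtain G where G: "rec1 G" "\<And>p. G (pair_enc d e p) = e (g (fst p) (snd p))" by (rule cmpE) (rule that)
  have "rec_fun 2 (\<lambda>xs. rec_nat (F (tl xs ! 0))
    (\<lambda>k y. G (prod_encode ((y # k # tl xs) ! 2, (y # k # tl xs) ! 0))) (hd xs))"
    unfolding numeral_2_eq_2 by (intro rec_fun_rec rec1_compose[OF F(1)] rec1_compose[OF G(1)] rec_fun_prod_encode rec_fun_proj) simp_all
  from rec_fun_comp2[OF this rec1_compose[OF M(1) rec_fun_arg] rec_fun_arg]
  have "rec_fun (Suc 0) (\<lambda>xs. rec_nat (F (xs ! 0)) (\<lambda>k y. G (prod_encode (xs ! 0, y))) (M (xs ! 0)))" by simp
  moreover have "rec_nat (F (d x)) (\<lambda>k y. G (prod_encode (d x, y))) k = e ((g x ^^ k) (f x))" for k x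
  proof (induction k)
    case (Suc k)
    then show ?case using G(2)[of "(x, (g x ^^ k) (f x))"] by (simp add: pair_enc_def)
  qed (simp add: F)
  ultimately show ?thesis
    by (intro cmpI[where F = "\<lambda>x. rec_nat (F x) (\<lambda>k y. G (prod_encode (x, y))) (M x)"])
      (simp_all add: M)
qed

text \<open>A finite table: nested tests for equality with the finitely many codes.\<close>

lemma computable_finite:
  fixes d :: "'a \<Rightarrow> nat"
  assumes "inj d" "finite (UNIV :: 'a set)"
  shows "computable d e f"
proof -
  define h where "h n = e (f (inv_into UNIV d n))" for n
  have "computable nat_enc nat_enc (\<lambda>n. if n \<in> A then h n else 0)" if "finite A" for A
    using that
  proof (induction A)
    case (insert a A)
    have "computable nat_enc nat_enc (\<lambda>n. if n = a then h a else if n \<in> A then h n else 0)"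
      by (rule computable_if computable_eq_const computable_id computable_const insert.IH)+
    also have "(\<lambda>n. if n = a then h a else if n \<in> A then h n else 0) =
      (\<lambda>n. if n \<in> insert a A then h n else 0)" by auto
    finally show ?case .
  qed (simp add: computable_const)
  from this[OF finite_imageI[OF assms(2)]]
  obtain F where F: "rec1 F" "\<And>n. F (id n) = id (if n \<in> range d then h n else 0)"
    by (rule cmpE) (rule that)
  show ?thesis
    by (rule cmpI[where F = F]) (use rec1_compose[OF F(1) rec_fun_arg] F(2) assms(1) in \<open>auto simp: h_def\<close>)
qed

subsection \<open>Lists\<close>

lemma computable_Nil_iff: "computable d (list_enc e) f \<Longrightarrow> computable d bool_enc (\<lambda>x. f x = [])"
proof -
  have "computable (list_enc e) bool_enc (\<lambda>xs. xs = [])"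
  proof -
    obtain F where F: "rec1 F" "\<And>x. F (id x) = bool_enc (x = 0)"
      using computable_eq_const[OF computable_id, of 0] by (rule cmpE) (rule that)
    show ?thesis
    proof (rule cmpI[where F = F])
      show "F (list_enc e xs) = bool_enc (xs = [])" for xs by (cases xs) (use F(2) in \<open>auto simp: list_enc_def\<close>)
    qed (rule rec1_compose[OF F(1) rec_fun_arg])
  qed
  then show "computable d (list_enc e) f \<Longrightarrow> ?thesis" by (rule computable_comp[rotated])
qed

lemma computable_Cons:
  assumes "computable d e f" "computable d (list_enc e) g"
  shows "computable d (list_enc e) (\<lambda>x. f x # g x)"
proof -
  from assms(1) obtain F where F: "rec1 F" "\<And>x. F (d x) = e (f x)" by (rule cmpE) (rule that)
  from assms(2) obtain G where G: "rec1 G" "\<And>x. G (d x) = list_enc e (g x)" by (rule cmpE) (rule that)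
  show ?thesis
    by (rule cmpI[where F = "\<lambda>x. Suc (prod_encode (F x, G x))"])
      (rule rec_fun_Suc rec_fun_prod_encode rec1_compose[OF G(1)] rec1_compose[OF F(1)] rec_fun_arg | simp add: F G list_enc_def)+
qed

lemma computable_nat_decode: "computable nat_enc (pair_enc nat_enc nat_enc) prod_decode"
  by (rule cmpI[where F = "\<lambda>x. x"]) (auto intro: rec_fun_arg simp: pair_enc_def)

lemma computable_nat_list_decode: "computable d nat_enc f \<Longrightarrow> computable d (list_enc nat_enc) (\<lambda>x. list_decode (f x))"
proof -
  have "computable nat_enc (list_enc nat_enc) list_decode"
    by (rule cmpI[where F = "\<lambda>x. x"]) (auto intro: rec_fun_arg simp: list_enc_def)
  then show "computable d nat_enc f \<Longrightarrow> ?thesis" by (rule computable_comp[rotated])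
qed

lemma computable_hd: "computable d (list_enc e) f \<Longrightarrow> computable d e (\<lambda>x. hd (f x))"
  and computable_tl: "computable d (list_enc e) f \<Longrightarrow> computable d (list_enc e) (\<lambda>x. tl (f x))"
proof -
  \<comment> \<open>The unspecified value \<open>hd []\<close> is still one fixed element, so its
    code serves as a constant on the code 0 of the empty list.\<close>
  have "computable nat_enc nat_enc (\<lambda>n. if n = 0 then e (hd []) else fst (prod_decode (n - 1)))"
    by (rule computable_if computable_eq_const computable_id computable_const computable_fst computable_comp[OF _ computable_nat_decode] computable_diff)+
  then obtain F where F: "rec1 F"
    "\<And>n. F (id n) = id (if n = 0 then e (hd []) else fst (prod_decode (n - 1)))" by (rule cmpE) (rule that)
  have "computable (list_enc e) e hd"
  proof (rule cmpI[where F = F])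
    show "F (list_enc e xs) = e (hd xs)" for xs by (cases xs) (use F(2) in \<open>auto simp: list_enc_def\<close>)
  qed (rule rec1_compose[OF F(1) rec_fun_arg])
  then show "computable d (list_enc e) f \<Longrightarrow> computable d e (\<lambda>x. hd (f x))" by (rule computable_comp[rotated])
  have "computable nat_enc nat_enc (\<lambda>n. if n = 0 then 0 else snd (prod_decode (n - 1)))"
    by (rule computable_if computable_eq_const computable_id computable_const computable_snd computable_comp[OF _ computable_nat_decode] computable_diff)+
  then obtain G where G: "rec1 G"
    "\<And>n. G (id n) = id (if n = 0 then 0 else snd (prod_decode (n - 1)))" by (rule cmpE) (rule that)
  have "computable (list_enc e) (list_enc e) tl"
  proof (rule cmpI[where F = G])
    show "G (list_enc e xs) = list_enc e (tl xs)" for xs by (cases xs) (use G(2) in \<open>auto simp: list_enc_def\<close>)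
  qed (rule rec1_compose[OF G(1) rec_fun_arg])
  then show "computable d (list_enc e) f \<Longrightarrow> computable d (list_enc e) (\<lambda>x. tl (f x))" by (rule computable_comp[rotated])
qed

lemma computable_list_code: "computable (list_enc e) nat_enc (list_enc e)"
  by (rule cmpI[where F = "\<lambda>x. x"]) (auto intro: rec_fun_arg)

lemma length_le_list_encode: "length xs \<le> list_encode xs"
proof (induction xs)
  case (Cons x xs)
  have "list_encode xs \<le> prod_encode (x, list_encode xs)" by (rule le_prod_encode_2)
  with Cons show ?case by simp
qed simp

text \<open>The step \<open>st\<close> consumes one list element and idles on the empty list. It may
  therefore be iterated as often as the code of the list says, since a list is never longer than its
  code.\<close>

lemma computable_foldl:
  assumes "computable (pair_enc d (pair_enc e e')) e (\<lambda>p. g (fst p) (fst (snd p)) (snd (snd p)))"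
    and "computable d e f" "computable d (list_enc e') l"
  shows "computable d e (\<lambda>x. foldl (g x) (f x) (l x))"
proof -
  define st where "st x = (\<lambda>(b, l). if l = [] then (b, l) else (g x b (hd l), tl l))" for x
  have "(st x ^^ n) (b, l) = (foldl (g x) b l, [])" if "length l \<le> n" for n b l x
    using that
  proof (induction n arbitrary: b l)
    case (Suc n)
    have "(st x ^^ Suc n) (b, l) = (st x ^^ n) (st x (b, l))" by (simp only: funpow_Suc_right comp_def)
    with Suc show ?case by (cases l) (auto simp: st_def)
  qed simp
  then have eq: "foldl (g x) (f x) (l x) = fst ((st x ^^ list_enc e' (l x)) (f x, l x))" for x
    using length_le_list_encode[of "map e' (l x)"] by (simp add: list_enc_def)
  have st: "(\<lambda>p. st (fst p) (snd p)) = (\<lambda>p. if snd (snd p) = [] then snd p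
      else (g (fst p) (fst (snd p)) (hd (snd (snd p))), tl (snd (snd p))))"
    by (auto simp: st_def fun_eq_iff)
  have "computable (pair_enc d (pair_enc e (list_enc e'))) e (\<lambda>p. g (fst p) (fst (snd p)) (hd (snd (snd p))))"
    by (rule computable_comp[OF _ assms(1), of _ "\<lambda>p. (fst p, fst (snd p), hd (snd (snd p)))", simplified])
      (rule computable_pair computable_fst computable_snd computable_hd computable_id)+
  note 1 = this
  have 2: "computable (pair_enc d (pair_enc e (list_enc e'))) (pair_enc e (list_enc e')) (\<lambda>p. st (fst p) (snd p))"
    unfolding st by (rule 1 computable_if computable_Nil_iff computable_pair computable_fst computable_snd computable_id computable_tl)+
  show ?thesis
    unfolding eq by (rule 2 computable_fst computable_iter computable_pair assms(2,3) computable_comp[OF assms(3) computable_list_code])+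
qed

lemma computable_rev: "computable d (list_enc e) f \<Longrightarrow> computable d (list_enc e) (\<lambda>x. rev (f x))"
proof -
  assume f: "computable d (list_enc e) f"
  have "computable d (list_enc e) (\<lambda>x. foldl (\<lambda>acc y. y # acc) [] (f x))"
    by (rule computable_foldl computable_const f computable_Cons computable_fst computable_snd computable_id)+
  moreover have "foldl (\<lambda>acc y. y # acc) zs xs = rev xs @ zs" for xs zs :: "'b list"
    by (induction xs arbitrary: zs) auto
  ultimately show ?thesis by simp
qed

lemma computable_foldr:
  assumes "computable (pair_enc d (pair_enc e' e)) e (\<lambda>p. g (fst p) (fst (snd p)) (snd (snd p)))"
    and "computable d e f" "computable d (list_enc e') l"
  shows "computable d e (\<lambda>x. foldr (g x) (l x) (f x))"
proof -
  have "computable (pair_enc d (pair_enc e e')) e (\<lambda>p. g (fst p) (snd (snd p)) (fst (snd p)))"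
    by (rule computable_comp[OF _ assms(1), of _ "\<lambda>p. (fst p, snd (snd p), fst (snd p))", simplified])
      (rule computable_pair computable_fst computable_snd computable_id)+
  note 1 = this
  show ?thesis
    unfolding foldr_conv_foldl by (rule 1 computable_foldl assms computable_rev)+
qed

lemma computable_bex:
  assumes "computable (pair_enc d nat_enc) bool_enc (\<lambda>p. P (fst p) (snd p))" "computable d nat_enc m"
  shows "computable d bool_enc (\<lambda>x. \<exists>k<m x. P x k)"
proof -
  define st where "st x = (\<lambda>(k, b). (Suc k, if b then True else P x k))" for x
  have "(st x ^^ n) (0, False) = (n, \<exists>k<n. P x k)" for x n
    by (induction n) (auto simp: st_def less_Suc_eq)
  then have eq: "(\<exists>k<m x. P x k) = snd ((st x ^^ m x) (0, False))" for x by simp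
  have st: "(\<lambda>p. st (fst p) (snd p)) = (\<lambda>p. (Suc (fst (snd p)), 
      if snd (snd p) then True else P (fst p) (fst (snd p))))"
    by (auto simp: st_def fun_eq_iff)
  have "computable (pair_enc d (pair_enc nat_enc bool_enc)) bool_enc (\<lambda>p. P (fst p) (fst (snd p)))"
    by (rule computable_comp[OF _ assms(1), of _ "\<lambda>p. (fst p, fst (snd p))", simplified])
      (rule computable_pair computable_fst computable_snd computable_id)+
  note 1 = this
  have 2: "computable (pair_enc d (pair_enc nat_enc bool_enc)) (pair_enc nat_enc bool_enc) (\<lambda>p. st (fst p) (snd p))"
    unfolding st by (rule 1 computable_if computable_pair computable_fst computable_snd computable_id computable_const computable_Suc)+
  show ?thesis unfolding eq by (rule 2 computable_snd[OF computable_iter] assms computable_const)+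
qed

section \<open>The search program\<close>

lemma finite_letter: "finite (UNIV :: letter set)"
proof -
  have "finite (UNIV :: gen set)"
    by (rule finite_subset[of _ "{Gen_a, Gen_b}"]) (auto intro: gen.exhaust)
  then show ?thesis by (simp add: finite_prod)
qed

lemma computable_letter: "computable letter_code e f"
  by (rule computable_finite[OF inj_letter_code finite_letter])

lemma computable_letter_pair: "computable (pair_enc letter_code letter_code) e f"
proof (rule computable_finite)
  show "inj (pair_enc letter_code letter_code)"
    using inj_letter_code by (auto simp: inj_def pair_enc_def prod_encode_eq)
  show "finite (UNIV :: (letter \<times> letter) set)"
    using finite_cartesian_product[OF finite_letter finite_letter] by simp
qed

abbreviation word_enc :: "word \<Rightarrow> nat" where "word_enc \<equiv> list_enc letter_code"

lemma computable_push:
  assumes "computable d letter_code f" "computable d word_enc g"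
  shows "computable d word_enc (\<lambda>x. push (f x) (g x))"
proof -
  have eq: "push x w = (if w = [] then [x] else if hd w = inv_letter x then tl w else x # w)" for x w
    by (cases w) auto
  have 1: "computable d bool_enc (\<lambda>x. hd (g x) = inv_letter (f x))"
    using computable_comp[OF computable_pair[OF assms(1) computable_hd[OF assms(2)]]
      computable_letter_pair[where f = "\<lambda>p. snd p = inv_letter (fst p)"]] by simp
  show ?thesis
    unfolding eq by (rule 1 computable_if computable_Nil_iff computable_Cons computable_tl computable_const assms)+
qed

text \<open>Numbers above 7 code the identity, so every number codes an automorphism.\<close>

definition moves :: "nat \<Rightarrow> word \<times> word" where
  "moves d = (if d = 0 then ([la, lb], [lb]) else if d = 1 then ([la], [lb, la])
    else if d = 2 then ([la], [lB]) else if d = 3 then ([lA], [lb])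
    else if d = 4 then ([la], [la, lb, lA]) else if d = 5 then ([la], [lA, lb, la])
    else if d = 6 then ([lb, la, lB], [lb]) else if d = 7 then ([lB, la, lb], [lb])
    else ([la], [lb]))"

definition act :: "nat \<Rightarrow> word \<Rightarrow> word" where
  "act d w = nf (extend (fst (moves d)) (snd (moves d)) w)"

definition run :: "nat list \<Rightarrow> word \<Rightarrow> word" where
  "run ds w = foldl (\<lambda>w d. act d w) w ds"

definition images :: "nat \<Rightarrow> letter \<Rightarrow> word" where
  "images d x = letter_image (fst (moves d)) (snd (moves d)) x"

text \<open>Substitution and free reduction merge into two nested folds, the shape in which
  computability is available.\<close>

lemma act_foldr: "act d w = foldr (\<lambda>x acc. foldr push (images d x) acc) w []"
  by (induction w) (simp_all add: act_def images_def nf_def)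

lemma computable_images: "computable (pair_enc nat_enc letter_code) word_enc (\<lambda>p. images (fst p) (snd p))"
proof -
  have l: "computable (pair_enc nat_enc letter_code) word_enc (\<lambda>p. letter_image (fst pq) (snd pq) (snd p))" for pq
    by (rule computable_comp[OF computable_snd[OF computable_id] computable_letter])+
  have im: "images d x = (if d = 0 then letter_image (fst (moves 0)) (snd (moves 0)) x
    else if d = 1 then letter_image (fst (moves 1)) (snd (moves 1)) x
    else if d = 2 then letter_image (fst (moves 2)) (snd (moves 2)) x
    else if d = 3 then letter_image (fst (moves 3)) (snd (moves 3)) x
    else if d = 4 then letter_image (fst (moves 4)) (snd (moves 4)) x
    else if d = 5 then letter_image (fst (moves 5)) (snd (moves 5)) x
    else if d = 6 then letter_image (fst (moves 6)) (snd (moves 6)) x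
    else if d = 7 then letter_image (fst (moves 7)) (snd (moves 7)) x
    else letter_image (fst (moves 8)) (snd (moves 8)) x)" for d x
    unfolding images_def by (simp add: moves_def)
  show ?thesis
    unfolding im by (rule computable_if computable_eq_const computable_fst computable_id l)+
qed

lemma computable_act:
  assumes "computable e nat_enc f" "computable e word_enc g"
  shows "computable e word_enc (\<lambda>x. act (f x) (g x))"
proof -
  let ?e = "pair_enc e (pair_enc letter_code word_enc)"
  have "computable ?e (pair_enc nat_enc letter_code) (\<lambda>p. (f (fst p), fst (snd p)))"
    by (rule computable_pair computable_comp[OF _ assms(1)] computable_fst computable_snd computable_id)+
  from computable_comp[OF this computable_images]
  have im: "computable ?e word_enc (\<lambda>p. images (f (fst p)) (fst (snd p)))" by simp
  show ?thesis unfolding act_foldr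
    by (rule computable_foldr assms im computable_const computable_push computable_fst computable_snd computable_id)+
qed

lemma computable_run:
  assumes "computable e (list_enc nat_enc) f" "computable e word_enc g"
  shows "computable e word_enc (\<lambda>x. run (f x) (g x))"
  unfolding run_def by (rule computable_foldl computable_act assms computable_fst computable_snd computable_id)+

lemma computable_positive:
  assumes "computable e word_enc f"
  shows "computable e bool_enc (\<lambda>x. positive (f x))"
proof -
  have "computable e bool_enc (\<lambda>x. foldl (\<lambda>b y. if b then snd y else False) True (f x))"
    by (rule computable_foldl assms computable_const computable_if computable_comp[OF _ computable_letter[where f = snd]] 
      computable_fst computable_snd computable_id)+
  moreover have "foldl (\<lambda>b y. if b then snd y else False) c w \<longleftrightarrow> c \<and> positive w" for c w
    by (induction w arbitrary: c) (auto simp: positive_def)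
  ultimately show ?thesis by simp
qed

lemma prod_encode_mono: "x \<le> x' \<Longrightarrow> y \<le> y' \<Longrightarrow> prod_encode (x, y) \<le> prod_encode (x', y')"
  unfolding prod_encode_def by (auto intro!: add_mono mono_triangle)

text \<open>Makes a bound on length and entries of a list of moves into a bound on its code, so that
  the search can run through an initial segment of the numbers.\<close>

lemma list_encode_mono:
  "length ds \<le> m \<Longrightarrow> \<forall>d\<in>set ds. d \<le> c \<Longrightarrow> list_encode ds \<le> list_encode (replicate m c)"
proof (induction ds arbitrary: m)
  case (Cons d ds)
  then obtain m' where "m = Suc m'" by (cases m) auto
  with Cons show ?case by (auto intro!: prod_encode_mono)
qed simp

lemma search_program:
  assumes "computable nat_enc nat_enc M"
  shows "\<exists>p. \<forall>u. rec_eval p [word_code u]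
    (bool_enc (\<exists>m < Suc (list_encode (replicate (M (word_code u)) 8)). positive (run (list_decode m) u)))"
proof -
  have wc: "word_code = word_enc" by (simp add: fun_eq_iff word_code_def list_enc_def)
  have M: "computable word_enc nat_enc (\<lambda>u. M (word_enc u))" by (rule computable_comp[OF computable_list_code assms])
  have "((\<lambda>y. Suc (prod_encode (8, y))) ^^ m) 0 = list_encode (replicate m 8)" for m
    by (induction m) auto
  moreover have "computable word_enc nat_enc (\<lambda>u. ((\<lambda>y. Suc (prod_encode (8, y))) ^^ M (word_enc u)) 0)"
    by (rule computable_iter M computable_const computable_Suc computable_prod_encode computable_snd computable_id)+
  ultimately have "computable word_enc nat_enc (\<lambda>u. list_encode (replicate (M (word_enc u)) 8))" by simp
  note 1 = this
  have "computable word_enc bool_enc (\<lambda>u. \<exists>m < Suc (list_encode (replicate (M (word_code u)) 8)). 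
      positive (run (list_decode m) u))"
    unfolding wc
    by (rule 1 computable_bex computable_Suc computable_positive computable_run computable_nat_list_decode computable_fst computable_snd computable_id)+
  then obtain F where F: "rec1 F" "\<And>u. F (word_code u) = bool_enc (\<exists>m <
      Suc (list_encode (replicate (M (word_code u)) 8)). positive (run (list_decode m) u))"
    unfolding computable_def wc by blast
  from F(1) obtain p where p: "\<And>xs. length xs = Suc 0 \<Longrightarrow> rec_eval p xs (F (xs ! 0))"
    unfolding rec1_def rec_fun_def by blast
  show ?thesis using p[of "[word_code _]"] F(2) by (metis length_Cons list.size(3) nth_Cons_0)
qed

section \<open>Automorphisms\<close>

lemma carrier_F2: "w \<in> carrier F2 \<longleftrightarrow> reduced w"
  and mult_F2: "u \<otimes>\<^bsub>F2\<^esub> v = foldr push u v"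
  by (simp_all add: F2_def)

lemma act_weq: "act d w \<doteq> extend (fst (moves d)) (snd (moves d)) w"
  by (simp add: act_def)

lemma act_cong: "u \<doteq> v \<Longrightarrow> act d u = act d v"
  using extend_weq[of u v] by (simp add: act_def weq_def)

lemma act_mult: "reduced v \<Longrightarrow> act d (foldr push u v) = foldr push (act d u) (act d v)"
proof -
  assume v: "reduced v"
  have "foldr push u v = nf (u @ v)" using v by (simp add: nf_append nf_reduced)
  then have "act d (foldr push u v) = act d (u @ v)" by (simp add: act_cong)
  then show ?thesis by (simp add: act_def nf_append foldr_push_nf)
qed

lemma moves_inverse:
  "\<exists>p q. (\<forall>w. extend p q (extend (fst (moves d)) (snd (moves d)) w) \<doteq> w) \<and>
    (\<forall>w. extend (fst (moves d)) (snd (moves d)) (extend p q w) \<doteq> w)"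
proof -
  have inv: "extend p q (extend p' q' w) \<doteq> w" if "extend p q p' \<doteq> [la]" "extend p q q' \<doteq> [lb]" for p q p' q' w
    using extend_weq2[OF that, of w] by (simp add: extend_extend)
  have *: "?thesis" if "extend p q (fst (moves d)) \<doteq> [la]" "extend p q (snd (moves d)) \<doteq> [lb]"
    "extend (fst (moves d)) (snd (moves d)) p \<doteq> [la]" "extend (fst (moves d)) (snd (moves d)) q \<doteq> [lb]" for p q
    using inv[OF that(1,2)] inv[OF that(3,4)] by blast
  consider "d = 0" | "d = 1" | "d = 2" | "d = 3" | "d = 4" | "d = 5" | "d = 6" | "d = 7" | "d \<ge> 8"
    by linarith
  then show ?thesis
  proof cases
    case 1 then show ?thesis by (intro *[of "[la, lB]" "[lb]"]) (simp_all add: moves_def weq_def nf_def)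
  next
    case 2 then show ?thesis by (intro *[of "[la]" "[lb, lA]"]) (simp_all add: moves_def weq_def nf_def)
  next
    case 3 then show ?thesis by (intro *[of "[la]" "[lB]"]) (simp_all add: moves_def weq_def nf_def)
  next
    case 4 then show ?thesis by (intro *[of "[lA]" "[lb]"]) (simp_all add: moves_def weq_def nf_def)
  next
    case 5 then show ?thesis by (intro *[of "[la]" "[lA, lb, la]"]) (simp_all add: moves_def weq_def nf_def)
  next
    case 6 then show ?thesis by (intro *[of "[la]" "[la, lb, lA]"]) (simp_all add: moves_def weq_def nf_def)
  next
    case 7 then show ?thesis by (intro *[of "[lB, la, lb]" "[lb]"]) (simp_all add: moves_def weq_def nf_def)
  next
    case 8 then show ?thesis by (intro *[of "[lb, la, lB]" "[lb]"]) (simp_all add: moves_def weq_def nf_def)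
  next
    case 9 then show ?thesis by (intro *[of "[la]" "[lb]"]) (simp_all add: moves_def weq_def nf_def)
  qed
qed

lemma act_bij: "bij_betw (act d) (carrier F2) (carrier F2)"
proof -
  obtain p q where 1: "\<And>w. extend p q (extend (fst (moves d)) (snd (moves d)) w) \<doteq> w"
    and 2: "\<And>w. extend (fst (moves d)) (snd (moves d)) (extend p q w) \<doteq> w"
    using moves_inverse by blast
  have "nf (extend p q (act d w)) = w" if "reduced w" for w
    using extend_weq[OF act_weq, of p q d w] 1[of w] nf_reduced[OF that] by (simp add: weq_def)
  moreover have "act d (nf (extend p q w)) = w" if "reduced w" for w
    using act_cong[OF weq_nf[of "extend p q w"], of d] 2[of w] nf_reduced[OF that]
    by (simp add: act_def weq_def)
  ultimately show ?thesis
    by (intro bij_betw_byWitness[where f' = "\<lambda>w. nf (extend p q w)"])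
      (auto simp: carrier_F2 act_def)
qed

lemma run_Cons: "run (d # ds) w = run ds (act d w)" and run_Nil: "run [] w = w"
  by (simp_all add: run_def)

lemma run_auto: "\<exists>\<phi>\<in>auto F2. \<forall>w\<in>carrier F2. \<phi> w = run ds w"
proof -
  have bij: "bij_betw (run ds) (carrier F2) (carrier F2)"
  proof (induction ds)
    case Nil
    then show ?case by (auto simp: run_Nil bij_betw_def inj_on_def)
  next
    case (Cons d ds)
    have "run (d # ds) = run ds \<circ> act d" by (auto simp: run_Cons)
    then show ?case using bij_betw_trans[OF act_bij Cons] by (simp only:)
  qed
  have "reduced u \<Longrightarrow> reduced v \<Longrightarrow> run ds (foldr push u v) = foldr push (run ds u) (run ds v)" for u v
  proof (induction ds arbitrary: u v)
    case (Cons d ds)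
    then show ?case by (simp add: run_Cons act_mult) (simp add: act_def)
  qed (simp add: run_Nil)
  then have "restrict (run ds) (carrier F2) \<in> hom F2 F2"
    using bij unfolding bij_betw_def
    by (auto simp: hom_def carrier_F2 mult_F2 reduced_foldr_push)
  moreover have "restrict (run ds) (carrier F2) \<in> Bij (carrier F2)"
    using bij by (auto simp: Bij_def)
  ultimately have "restrict (run ds) (carrier F2) \<in> auto F2" by (simp add: auto_def)
  then show ?thesis by (intro bexI) auto
qed

text \<open>An automorphism is the substitution by its values on a and b, and surjectivity makes
  these generate. Since \<open>\<phi> u\<close> is good at once, \<open>descends\<close> carries
  \<open>reaches\<close> back to \<open>u\<close>.\<close>

lemma auto_reaches:
  assumes "\<phi> \<in> auto F2" "reduced u" "positive (\<phi> u)"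
  shows "reaches u"
proof -
  have red: "reduced (\<phi> w)" if "reduced w" for w
    using assms(1) that by (auto simp: auto_def hom_def carrier_F2[symmetric])
  have hom: "\<phi> (foldr push v w) = foldr push (\<phi> v) (\<phi> w)" if "reduced v" "reduced w" for v w
    using assms(1) that by (auto simp: auto_def hom_def carrier_F2[symmetric] mult_F2[symmetric])
  have r1: "reduced [x]" for x by (simp add: reduced_def)
  define p q where "p = \<phi> [la]" and "q = \<phi> [lb]"
  have "\<phi> [] = []"
  proof -
    have "\<phi> [] @ \<phi> [] \<doteq> \<phi> []"
      using hom[of "[]" "[]"] by (simp add: weq_def nf_append nf_reduced red)
    note idem = this
    have "\<phi> [] \<doteq> winv (\<phi> []) @ \<phi> [] @ \<phi> []"
      using weq_sym[OF winv_cancel(1)[of "[]" "\<phi> []" "\<phi> []"]] by simp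
    also have "\<dots> \<doteq> winv (\<phi> []) @ \<phi> []" by (intro weq_append weq_refl idem)
    also have "\<dots> \<doteq> []" by (rule winv_left)
    finally have "\<phi> [] \<doteq> []" .
    then show ?thesis by (simp add: weq_reduced red)
  qed
  have inv: "\<phi> [inv_letter x] \<doteq> winv (\<phi> [x])" for x
  proof -
    have "\<phi> [inv_letter x] @ \<phi> [x] \<doteq> []"
      using hom[of "[inv_letter x]" "[x]"] r1 \<open>\<phi> [] = []\<close>
      by (simp add: weq_def nf_append nf_reduced red)
    note cancel = this
    have "\<phi> [inv_letter x] \<doteq> (\<phi> [inv_letter x] @ \<phi> [x]) @ winv (\<phi> [x])"
      using weq_sym[OF winv_cancel(2)[of "\<phi> [inv_letter x]" "\<phi> [x]" "[]"]] by simp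
    also have "\<dots> \<doteq> [] @ winv (\<phi> [x])" by (intro weq_append weq_refl cancel)
    finally show ?thesis by simp
  qed
  have letter: "\<phi> [x] \<doteq> letter_image p q x" for x
    using inv[of la] inv[of lb] by (cases x rule: letter_cases) (auto simp: p_def q_def)
  have phi: "\<phi> w \<doteq> extend p q w" if "reduced w" for w
    using that
  proof (induction w)
    case (Cons x w)
    have w: "reduced w" using Cons.prems by (rule reduced_tl)
    have "foldr push [x] w = x # w" using Cons.prems by (cases w) (auto simp: reduced_def)
    then have "\<phi> (x # w) = foldr push (\<phi> [x]) (\<phi> w)" using hom[OF r1 w] by metis
    then have "\<phi> (x # w) \<doteq> \<phi> [x] @ \<phi> w"
      by (simp add: weq_def nf_append nf_reduced red w reduced_foldr_push)
    also have "\<dots> \<doteq> letter_image p q x @ extend p q w" by (intro weq_append letter Cons.IH w)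
    finally show ?case by simp
  qed (simp add: \<open>\<phi> [] = []\<close>)
  have "\<exists>w. extend p q w \<doteq> [x]" for x
  proof -
    have "[x] \<in> \<phi> ` carrier F2"
      using assms(1) r1 by (auto simp: auto_def Bij_def bij_betw_def carrier_F2)
    then obtain w where "reduced w" "\<phi> w = [x]" by (auto simp: carrier_F2)
    then show ?thesis using phi weq_sym by metis
  qed
  then have "generating p q" by (simp add: generating_def)
  moreover have "good (\<phi> u)"
    unfolding good_def using assms(3) by (intro exI[of _ "\<phi> u"]) (auto simp: homog_def positive_def)
  then have "reaches (extend p q u)" using good_reaches reaches_weq[OF phi[OF assms(2)]] by simp
  moreover have "descends p q" unfolding p_def q_def by (intro descends red r1)
  ultimately show ?thesis by (auto simp: descends_def)
qed

section \<open>A computable bound\<close>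

lemma cyclic_reduction:
  "reduced u \<Longrightarrow> \<exists>c w. u = c @ w @ winv c \<and> (w = [] \<or> cyc_reduced w)"
proof (induction "length u" arbitrary: u rule: less_induct)
  case less
  show ?case
  proof (cases "u = [] \<or> cyc_reduced u")
    case True
    then show ?thesis by (intro exI[of _ "[]"] exI[of _ u]) auto
  next
    case False
    then have "hd u = inv_letter (last u)"
      using less.prems by (auto simp: cyc_reduced_def closed_def reduced_def successively_append_iff)
    moreover obtain x v where "u = x # v" using False by (cases u) auto
    ultimately obtain v' where v': "u = x # v' @ [inv_letter x]"
      by (cases v rule: rev_cases) auto
    then have "reduced v'" using less.prems
      by (auto simp: reduced_def successively_append_iff successively_Cons)
    then obtain c w where "v' = c @ w @ winv c" "w = [] \<or> cyc_reduced w" using less.hyps[of v'] v' by auto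
    then show ?thesis using v' by (intro exI[of _ "x # c"] exI[of _ w]) simp
  qed
qed

lemma reduction_cnj: "c @ w @ winv c \<frown> w"
  by (rule cnjI[OF weq_refl])

lemma length_turns: "length (turns w) \<le> length w - 1"
  by (induction w rule: turns.induct) auto

lemma bad_le: "bad w \<le> length w"
proof -
  have "bad w \<le> length (cturns w)" by (simp add: bad_def)
  also have "\<dots> \<le> length w" using length_turns[of "closed w"] by (simp add: cturns_def closed_def)
  finally show ?thesis .
qed

lemma good_Nil: "good []"
  unfolding good_def by (intro exI[of _ "[]"]) (simp add: homog_def)

lemma short_path_word:
  assumes "reaches_pos w" "length w \<le> l"
  shows "\<exists>p. length p \<le> depth l l \<and> good (path_map p w)"
proof -
  obtain c v where cv: "nf w = c @ v @ winv c" "v = [] \<or> cyc_reduced v"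
    using cyclic_reduction[OF reduced_nf] by blast
  have "w \<doteq> nf w" by (simp add: weq_sym)
  then have wv: "w \<frown> v" using reduction_cnj[of c v] weq_cnj_trans cv(1) by metis
  have "\<exists>p. length p \<le> depth l l \<and> good (path_map p v)"
  proof (cases "v = []")
    case True
    then show ?thesis using good_Nil by (intro exI[of _ "[]"]) simp
  next
    case False
    then have v: "cyc_reduced v" using cv by simp
    have "length v \<le> length (nf w)" by (simp add: cv(1))
    then have "length v \<le> l" using length_nf[of w] assms(2) by simp
    moreover obtain p where "good (path_map p v)"
      using assms(1) reaches_pos_cnj[OF wv] by (auto simp: reaches_pos_def)
    \<comment> \<open>Bad turns are at most as many as letters, so both arguments of
      \<open>depth\<close> can be \<open>l\<close>.\<close>
    ultimately show ?thesis using short_path[OF v _ order_trans[OF bad_le]] by blast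
  qed
  then show ?thesis using good_cnj[OF cnj_path_map[OF wv]] by blast
qed

lemma length_path_map: "length (path_map p w) \<le> 2 ^ length p * length w"
proof (induction p arbitrary: w)
  case (Cons s p)
  have "length (extend u v w) \<le> 2 * length w" if "length u \<le> 2" "length v \<le> 2" for u v w
  proof (induction w)
    case (Cons x w)
    then show ?case using that by (cases x rule: letter_cases) auto
  qed simp
  then have "length (if s then alpha w else beta w) \<le> 2 * length w" by simp
  then have "2 ^ length p * length (if s then alpha w else beta w) \<le> 2 ^ length p * (2 * length w)"
    by (rule mult_left_mono) simp
  with Cons[of "if s then alpha w else beta w"]
  have "length (path_map p (if s then alpha w else beta w)) \<le> 2 ^ length p * (2 * length w)"
    by (rule order_trans)
  moreover have "2 ^ length (s # p) * length w = 2 ^ length p * (2 * length w)" by simp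
  ultimately show ?case by (simp only: path_map.simps)
qed simp

lemma positive_reduced: "positive w \<Longrightarrow> reduced w"
proof (induction w)
  case (Cons x w)
  then show ?case by (cases w) (auto simp: positive_def reduced_def inv_letter_def)
qed simp

lemma run_append: "run (ds @ es) w = run es (run ds w)"
  by (simp add: run_def)

lemma run_cong: "u \<doteq> v \<Longrightarrow> run ds u \<doteq> run ds v"
proof (cases ds)
  case (Cons d es)
  then show "u \<doteq> v \<Longrightarrow> ?thesis" using act_cong[of u v d] by (simp add: run_Cons)
qed (simp add: run_Nil)

lemma run_reduced: "reduced w \<Longrightarrow> reduced (run ds w)"
  by (induction ds arbitrary: w) (auto simp: run_Nil run_Cons act_def)

lemma run_path: "run (map (\<lambda>s. if s then 0 else 1) p) w \<doteq> path_map p w"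
proof (induction p arbitrary: w)
  case (Cons s p)
  let ?ds = "map (\<lambda>s. if s then 0 else 1 :: nat) p"
  have "act (if s then 0 else 1) w \<doteq> (if s then alpha w else beta w)"
    using act_weq[of 0 w] act_weq[of 1 w] by (auto simp: moves_def)
  from weq_trans[OF run_cong[OF this, of ?ds] Cons] show ?case by (simp add: run_Cons)
qed (simp add: run_Nil)

text \<open>Moves 4 to 7 are the conjugations by single letters; the conjugator is stripped one
  letter at a time from the outside.\<close>

lemma run_conj: "\<exists>ds. set ds \<subseteq> {..8} \<and> length ds = length c \<and> run ds (c @ w @ winv c) \<doteq> w"
proof (induction c)
  case Nil
  then show ?case by (simp add: run_Nil)
next
  case (Cons x c)
  then obtain ds where ds: "set ds \<subseteq> {..8}" "length ds = length c" "run ds (c @ w @ winv c) \<doteq> w" by blast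
  have "\<exists>d\<le>8. extend (fst (moves d)) (snd (moves d)) z \<doteq> [inv_letter x] @ z @ [x]" for z
  proof -
    have "extend (fst (moves d)) (snd (moves d)) z \<doteq> [inv_letter x] @ z @ [x]"
      if "fst (moves d) \<doteq> [inv_letter x] @ [la] @ winv [inv_letter x]"
        "snd (moves d) \<doteq> [inv_letter x] @ [lb] @ winv [inv_letter x]" for d
      using weq_trans[OF extend_weq2[OF that] extend_conj, of z] by simp
    note conj = this
    show ?thesis
    proof (cases x rule: letter_cases)
      case 1 then show ?thesis by (intro exI[of _ 5] conjI conj) (simp_all add: moves_def weq_def nf_def)
    next
      case 2 then show ?thesis by (intro exI[of _ 4] conjI conj) (simp_all add: moves_def weq_def nf_def)
    next
      case 3 then show ?thesis by (intro exI[of _ 7] conjI conj) (simp_all add: moves_def weq_def nf_def)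
    next
      case 4 then show ?thesis by (intro exI[of _ 6] conjI conj) (simp_all add: moves_def weq_def nf_def)
    qed
  qed
  then obtain d where d: "d \<le> 8" "extend (fst (moves d)) (snd (moves d)) ((x # c) @ w @ winv (x # c)) \<doteq>
    [inv_letter x] @ ((x # c) @ w @ winv (x # c)) @ [x]" by blast
  have "act d ((x # c) @ w @ winv (x # c)) \<doteq> [inv_letter x] @ ((x # c) @ w @ winv (x # c)) @ [x]"
    by (rule weq_trans[OF act_weq d(2)])
  also have "\<dots> \<doteq> c @ w @ winv c @ [inv_letter x] @ [x]"
    using winv_cancel(1)[of "[]" "[x]" "c @ w @ winv c @ [inv_letter x] @ [x]"] by simp
  also have "\<dots> \<doteq> c @ w @ winv c"
    using winv_cancel(1)[of "c @ w @ winv c" "[x]" "[]"] by simp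
  finally have "run (d # ds) ((x # c) @ w @ winv (x # c)) \<doteq> w"
    using run_cong weq_trans ds(3) by (metis run_Cons)
  then show ?case using ds d(1) by (intro exI[of _ "d # ds"]) auto
qed

text \<open>The first summand bounds the conjugator to be stripped after the path, since each step
  at most doubles the length; the second is the path itself; 3 stands for one initial
  \<open>flip\<close> and two sign changes at the end.\<close>

definition run_bound :: "nat \<Rightarrow> nat" where
  "run_bound l = 2 ^ depth l l * l + depth l l + 3"

lemma reaches_run:
  assumes u: "reduced u" and reaches: "reaches u" and l: "length u \<le> l"
  shows "\<exists>ds. set ds \<subseteq> {..8} \<and> length ds \<le> run_bound l \<and> positive (run ds u)"
proof -
  obtain ds1 v where ds1: "set ds1 \<subseteq> {..8}" "length ds1 \<le> 1" "run ds1 u \<doteq> v" "length v \<le> l" "reaches_pos v"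
  proof (cases "reaches_pos u")
    case True
    then show thesis using that[of "[]" u] l by (simp add: run_Nil)
  next
    case False
    then have "reaches_pos (flip u)" using reaches by (simp add: reaches_def)
    moreover have "length (flip u) = length u"
    proof (induction u)
      case (Cons x u)
      then show ?case by (cases x rule: letter_cases) auto
    qed simp
    moreover have "run [2] u \<doteq> flip u" using act_weq[of 2 u] by (simp add: run_Cons run_Nil moves_def)
    ultimately show thesis using that[of "[2]" "flip u"] l by simp
  qed
  obtain p where p: "length p \<le> depth l l" "good (path_map p v)" using short_path_word ds1 by blast
  define ds2 :: "nat list" where "ds2 = map (\<lambda>s. if s then 0 else 1) p"
  have r2: "run (ds1 @ ds2) u \<doteq> path_map p v"
    unfolding run_append ds2_def using run_cong[OF ds1(3)] run_path weq_trans by blast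
  obtain c w where cw: "nf (path_map p v) = c @ w @ winv c" "w = [] \<or> cyc_reduced w"
    using cyclic_reduction[OF reduced_nf] by blast
  have "length c \<le> length (nf (path_map p v))" by (simp add: cw(1))
  also have "\<dots> \<le> 2 ^ length p * length v" using length_nf length_path_map le_trans by blast
  also have "\<dots> \<le> 2 ^ depth l l * l" using p ds1 by (intro mult_mono power_increasing) auto
  finally have c: "length c \<le> 2 ^ depth l l * l" .
  have avw: "path_map p v \<doteq> c @ w @ winv c" using weq_sym[OF weq_nf[of "path_map p v"]] by (simp only: cw(1))
  have "homog w"
  proof (cases "w = []")
    case False
    then have "cyc_reduced w" using cw(2) by simp
    moreover have "good w"
      using p(2) good_cnj[OF weq_cnj_trans[OF avw reduction_cnj]] by simp
    ultimately show ?thesis by (rule good_homog)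
  qed (simp add: homog_def)
  obtain ds3 where ds3: "set ds3 \<subseteq> {..8}" "length ds3 = length c" "run ds3 (c @ w @ winv c) \<doteq> w"
    using run_conj by blast
  have r3: "run (ds1 @ ds2 @ ds3) u \<doteq> w"
    using run_cong[OF weq_trans[OF r2 avw], of ds3] ds3(3) weq_trans
    unfolding run_append append_assoc[symmetric] by blast
  have ds2: "set ds2 \<subseteq> {..8}" "length ds2 \<le> depth l l" using p by (auto simp: ds2_def)
  have finish: ?thesis if "set ds4 \<subseteq> {..8}" "length ds4 \<le> 2" "run ds4 w \<doteq> z" "positive z" for ds4 z
  proof -
    let ?ds = "(ds1 @ ds2 @ ds3) @ ds4"
    have "run ?ds u \<doteq> z" 
      unfolding run_append[of "ds1 @ ds2 @ ds3"] using run_cong[OF r3] that(3) weq_trans by blast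
    then have "run ?ds u = z" 
      by (rule weq_reduced) (simp_all add: run_reduced u positive_reduced that)
    moreover have "length ?ds \<le> run_bound l" using ds1(2) ds2 ds3(2) c that(2) by (simp add: run_bound_def)
    moreover have "set ?ds \<subseteq> {..8}" using ds1(1) ds2 ds3(1) that(1) by auto
    ultimately show ?thesis using that(4) by blast
  qed
  from \<open>homog w\<close> consider "positive w" | "\<forall>x\<in>set w. \<not> snd x"
    by (auto simp: homog_def positive_def)
  then show ?thesis
  proof cases
    case 1
    then show ?thesis by (intro finish[of "[]" w]) (simp_all add: run_Nil)
  next
    case 2
    show ?thesis
    \<comment> \<open>A negative word is made positive by inverting b and then a, the moves 2 and 3,
      which together are \<open>neg\<close>.\<close>
    proof (rule finish)
      have "run [2, 3] w \<doteq> extend [lA] [lb] (act 2 w)"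
        using act_weq[of 3 "act 2 w"] by (simp add: run_Cons run_Nil moves_def)
      also have "\<dots> \<doteq> extend [lA] [lb] (flip w)"
        using extend_weq[OF act_weq[of 2 w]] by (simp add: moves_def)
      finally show "run [2, 3] w \<doteq> neg w" by (simp add: extend_extend)
      show "positive (neg w)" using 2
      proof (induction w)
        case (Cons x w)
        then show ?case by (cases x rule: letter_cases) (auto simp: positive_def)
      qed (simp add: positive_def)
    qed auto
  qed
qed

lemma computable_pow2: "computable d nat_enc f \<Longrightarrow> computable d nat_enc (\<lambda>x. 2 ^ f x)"
proof -
  assume f: "computable d nat_enc f"
  have "computable d nat_enc (\<lambda>x. ((\<lambda>y. 2 * y) ^^ f x) 1)"
    by (rule computable_iter f computable_const computable_mult computable_snd computable_id)+
  moreover have "((\<lambda>y. 2 * y) ^^ m) 1 = (2 :: nat) ^ m" for m by (induction m) auto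
  ultimately show ?thesis by simp
qed

lemma computable_growth: "computable d nat_enc f \<Longrightarrow> computable d nat_enc (\<lambda>x. growth (f x))"
proof -
  assume f: "computable d nat_enc f"
  show ?thesis unfolding growth_def by (rule computable_mult computable_add computable_pow2 f computable_const)+
qed

lemma computable_depth: 
  assumes f: "computable d nat_enc f" and g: "computable d nat_enc g" 
  shows "computable d nat_enc (\<lambda>x. depth (f x) (g x))"
proof -
  define st where "st s = (growth (fst s), snd s + growth (fst s))" for s
  have "snd ((st ^^ t) (l, a)) = a + depth t l" for t l a
  proof (induction t arbitrary: l a)
    case (Suc t)
    have "(st ^^ Suc t) (l, a) = (st ^^ t) (growth l, a + growth l)"
      by (simp only: funpow_Suc_right comp_def) (simp only: st_def fst_conv snd_conv)
    then show ?case by (simp only: Suc.IH depth.simps add.assoc)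
  qed simp
  then have eq: "depth (f x) (g x) = snd ((st ^^ f x) (g x, 0))" for x by simp
  have st: "computable (pair_enc d (pair_enc nat_enc nat_enc)) (pair_enc nat_enc nat_enc) (\<lambda>p. st (snd p))"
    unfolding st_def by (rule computable_pair computable_add computable_growth computable_fst computable_snd computable_id)+
  show ?thesis unfolding eq by (rule computable_snd[OF computable_iter] f st computable_pair g computable_const)+
qed

lemma computable_run_bound: "computable nat_enc nat_enc run_bound"
proof -
  have "computable nat_enc nat_enc (\<lambda>l. 2 ^ depth l l * l + depth l l + 3)"
    by (rule computable_add computable_mult computable_pow2 computable_depth computable_id computable_const)+
  then show ?thesis by (simp add: run_bound_def[abs_def])
qed

theorem mainTheorem2:
  "\<exists>f. \<forall>u\<in>carrier F2. rec_eval f [word_code u] (if potentially_positive u then 1 else 0)"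
proof -
  let ?B = "\<lambda>u. Suc (list_encode (replicate (run_bound (word_code u)) 8))"
  obtain f where f: "\<And>u. rec_eval f [word_code u] (bool_enc (\<exists>m < ?B u. positive (run (list_decode m) u)))"
    using search_program[OF computable_run_bound] by blast
  have "(\<exists>m < ?B u. positive (run (list_decode m) u)) \<longleftrightarrow> potentially_positive u" if u: "u \<in> carrier F2" for u
  proof
    assume "\<exists>m < ?B u. positive (run (list_decode m) u)"
    \<comment> \<open>Whatever list the number decodes to, \<open>run ds\<close> agrees on the group
      with an automorphism, so no check of length or entries has to be made.\<close>
    then obtain ds where "positive (run ds u)" by blast
    then show "potentially_positive u"
      using run_auto[of ds] u unfolding potentially_positive_def by metis
  next
    assume "potentially_positive u"
    then have "reaches u" using auto_reaches u unfolding potentially_positive_def carrier_F2 by blast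
    \<comment> \<open>The program sees only the code of \<open>u\<close>; as this is at least the
      length, it can replace the length in the bound.\<close>
    moreover have "length u \<le> word_code u"
      using length_le_list_encode[of "map letter_code u"] by (simp add: word_code_def)
    ultimately obtain ds where ds: "set ds \<subseteq> {..8}" "length ds \<le> run_bound (word_code u)" "positive (run ds u)"
      using reaches_run u carrier_F2 by blast
    have "\<forall>d\<in>set ds. d \<le> 8" using ds(1) by auto
    from list_encode_mono[OF ds(2) this] have "list_encode ds < ?B u" by simp
    then show "\<exists>m < ?B u. positive (run (list_decode m) u)" using ds(3) by (metis list_encode_inverse)
  qed
  then have "rec_eval f [word_code u] (if potentially_positive u then 1 else 0)"
    if "u \<in> carrier F2" for u
    using f[of u] that by (simp only: of_bool_def)
  then show ?thesis by blast
qed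

end
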